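(* Let $P(w)=\sum_{n=0}^{k} a_n w^n$ be a polynomial with constant coefficients $a_n\in\mathbb{C}$, $a_k\neq 0$, and consider the differential equation $$ww''-(w')^2+P(w)=0. \qquad (E)$$ Suppose that (E) has non-constant meromorphic solutions. Then $k\le 4$, and the meromorphic solutions of (E) are characterized as follows. 1) If $k=0$ or $k=1$, then (E) is a special case of the equation $ww''-(w')^2=\alpha_2 w''+\alpha_1 w'+\alpha_0 w+\beta$ with constants $\alpha_0,\alpha_1,\alpha_2,\beta\in\mathbb{C}$ not all zero. 2) If $k=2$, then $a_0=a_1=0$, and the non-constant meromorphic solutions of (E), which are actually the general solution of (E), are the zero-free entire functions $$w(z)=c_1 e^{-\frac{a_2}{2}z^2+c_2 z},\qquad c_1,c_2\in\mathbb{C},\ c_1\neq 0.$$ 3) If $k=3$ or $k=4$ (with $a_4:=0$ when $k=3$), then $a_2=0$, and any meromorphic solution $w$ of (E) satisfies $$(w')^2+a_4w^4+2a_3w^3+2Cw^2-2a_1w-a_0=0$$ for some $C\in\mathbb{C}$. The general solution of this first order equation is meromorphic and is given by the explicit list (BB) recalled in the context.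
   Context: "Meromorphic" means meromorphic on the whole complex plane $\mathbb{C}$. List (BB). For $m\in\{0,1,2,3,4\}$, a nonzero constant $\alpha_m\in\mathbb{C}$ and constants $e_1,\dots,e_m\in\mathbb{C}$, consider the binomial Briot-Bouquet equation $(du/dz)^2=\alpha_m\prod_{j=1}^m(u-e_j)$. Let $\wp$ and $\zeta$ be the Weierstrass functions, $(\wp')^2=4\wp^3-g_2\wp-g_3$, $\zeta'=-\wp$. The general solution (the arbitrary origin $z_0$ of $z$ is omitted, i.e. $z$ may be replaced by $z-z_0$) is as follows, where $\wp(a),A,B,D$ are suitable constants that are algebraic functions of $\alpha_m$ and the $e_j$: - $m=4$, $e_j$ all distinct: $u=\alpha_4^{-1/2}\left(\zeta(z+a)-\zeta(z-a)-2\zeta(a)+A\right)=\alpha_4^{-1/2}\left(A-\frac{\wp'(a)}{\wp(z)-\wp(a)}\right)$; - $m=4$, one double root $e_1$: $\frac{1}{u-e_1}=A\cosh(Bz)+D$; - $m=4$, two double roots $e_1,e_2$: $u=\frac{e_1+e_2}{2}+A\coth(Bz)$; - $m=4$, one triple root $e_1$ (and simple root $e_4$): $\frac{u-e_4}{u-e_1}=A\left[\frac{e_4-e_1}{2}z\right]^2$; - $m=4$, one quadruple root $e_1$: $u=e_1\pm\frac{\alpha_4^{-1/2}}{z}$; - $m=3$, $e_j$ all different: $u=\frac{e_1+e_2+e_3}{3}+\frac{4}{\alpha_3}\wp(z;g_2,g_3)$; - $m=3$, $e_1=e_2\neq e_3$: $u=A+B\coth^2(Dz)$; - $m=3$, $e_1=e_2=e_3$: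 $u=e_1+\frac{4}{\alpha_3z^2}$; - $m=2$, $e_1\neq e_2$: $u=\frac{e_1+e_2}{2}+A\cosh(Bz)$; - $m=2$, $e_1=e_2$: $u=e_1+e^{\pm\sqrt{\alpha_2}\,z}$; - $m=1$: $u=e_1+\frac{\alpha_1}{4}z^2$; - $m=0$: $u=\pm\sqrt{\alpha_0}\,z$. *)

theory Defs
  imports "HOL-Complex_Analysis.Complex_Analysis" "HOL-Computational_Algebra.Polynomial"
begin

section \<open>Autonomous differential equations of order at most two\<close>

text \<open>The differential polynomial \<open>\<Phi>\<close> stands for the equation \<open>\<Phi> u u' u'' = 0\<close>.\<close>

type_synonym ode = "complex \<Rightarrow> complex \<Rightarrow> complex \<Rightarrow> complex"

definition satisfies_at :: "ode \<Rightarrow> (complex \<Rightarrow> complex) \<Rightarrow> complex \<Rightarrow> bool" where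
  "satisfies_at \<Phi> u z \<longleftrightarrow> \<Phi> (u z) (deriv u z) (deriv (deriv u) z) = 0"

text \<open>A meromorphic function is represented by its \<open>nicely_meromorphic_on\<close> normal form: removable
  singularities are removed and the value at a pole is, by convention, 0. All identities between
  meromorphic functions are therefore required away from the poles only.\<close>

definition meromorphic_solution :: "ode \<Rightarrow> (complex \<Rightarrow> complex) \<Rightarrow> bool" where
  "meromorphic_solution \<Phi> u \<longleftrightarrow>
     u nicely_meromorphic_on UNIV \<and> (\<forall>z. \<not> is_pole u z \<longrightarrow> satisfies_at \<Phi> u z)"

definition nonconst_meromorphic_solutions :: "ode \<Rightarrow> (complex \<Rightarrow> complex) set" where
  "nonconst_meromorphic_solutions \<Phi> = {u. meromorphic_solution \<Phi> u \<and> \<not> u constant_on UNIV}"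

text \<open>\<open>F\<close> is the general solution and it is meromorphic in the plane: \<open>F\<close> consists of non-constant
  meromorphic solutions, and every non-constant holomorphic solution on an arbitrary domain is the
  restriction of a member of \<open>F\<close>. Constant (singular) solutions are not part of it.\<close>

definition general_solution :: "ode \<Rightarrow> (complex \<Rightarrow> complex) set \<Rightarrow> bool" where
  "general_solution \<Phi> F \<longleftrightarrow>
     F \<noteq> {} \<and> F \<subseteq> nonconst_meromorphic_solutions \<Phi> \<and>
     (\<forall>S u. open S \<and> connected S \<and> u holomorphic_on S \<and> \<not> u constant_on S \<and>
            (\<forall>z\<in>S. satisfies_at \<Phi> u z) \<longrightarrow>
            (\<exists>U\<in>F. \<forall>z\<in>S. \<not> is_pole U z \<and> u z = U z))"

text \<open>The meromorphic functions \<open>u\<close> with \<open>R z (u z)\<close>, up to the choice of the origin of \<open>z\<close>.\<close>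

definition given_by :: "(complex \<Rightarrow> complex \<Rightarrow> bool) \<Rightarrow> (complex \<Rightarrow> complex) set" where
  "given_by R = {u. u nicely_meromorphic_on UNIV \<and>
                    (\<exists>z0. \<forall>z. \<not> is_pole u z \<longrightarrow> R (z - z0) (u z))}"


section \<open>Weierstrass functions\<close>

definition period_lattice :: "complex \<Rightarrow> complex \<Rightarrow> complex set" where
  "period_lattice \<omega>1 \<omega>2 = {of_int m * \<omega>1 + of_int n * \<omega>2 | m n. True}"

text \<open>The two generators are linearly independent over the reals.\<close>

definition is_period_lattice :: "complex set \<Rightarrow> bool" where
  "is_period_lattice \<Lambda> \<longleftrightarrow> (\<exists>\<omega>1 \<omega>2. Im (cnj \<omega>1 * \<omega>2) \<noteq> 0 \<and> \<Lambda> = period_lattice \<omega>1 \<omega>2)"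

text \<open>The functions are parametrized by the lattice instead of its invariants \<open>g\<^sub>2\<close>, \<open>g\<^sub>3\<close>; the values
  at lattice points are meaningless.\<close>

definition weierstrass_p :: "complex set \<Rightarrow> complex \<Rightarrow> complex" where
  "weierstrass_p \<Lambda> z = 1 / z^2 + (\<Sum>\<^sub>\<infinity>\<omega>\<in>\<Lambda>-{0}. 1 / (z - \<omega>)^2 - 1 / \<omega>^2)"

definition weierstrass_zeta :: "complex set \<Rightarrow> complex \<Rightarrow> complex" where
  "weierstrass_zeta \<Lambda> z = 1 / z + (\<Sum>\<^sub>\<infinity>\<omega>\<in>\<Lambda>-{0}. 1 / (z - \<omega>) + 1 / \<omega> + z / \<omega>^2)"


section \<open>Algebraic dependence of constants\<close>

inductive_set generated_field :: "complex set \<Rightarrow> complex set" for X where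
  gen: "x \<in> X \<Longrightarrow> x \<in> generated_field X"
| one: "1 \<in> generated_field X"
| diff: "x \<in> generated_field X \<Longrightarrow> y \<in> generated_field X \<Longrightarrow> x - y \<in> generated_field X"
| mult: "x \<in> generated_field X \<Longrightarrow> y \<in> generated_field X \<Longrightarrow> x * y \<in> generated_field X"
| inverse: "x \<in> generated_field X \<Longrightarrow> inverse x \<in> generated_field X"

text \<open>That \<open>c\<close> is a value of an algebraic function of the parameters in \<open>X\<close> is rendered as: \<open>c\<close> is
  algebraic over the subfield of the complex numbers generated by \<open>X\<close>.\<close>

definition algebraic_in :: "complex set \<Rightarrow> complex \<Rightarrow> bool" where
  "algebraic_in X c \<longleftrightarrow>
     (\<exists>p. p \<noteq> 0 \<and> (\<forall>i. poly.coeff p i \<in> generated_field X) \<and> poly p c = 0)"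


section \<open>Binomial Briot-Bouquet equations\<close>

definition binomial_BB :: "complex \<Rightarrow> complex list \<Rightarrow> ode" where
  "binomial_BB \<alpha> es = (\<lambda>u u' u''. u'^2 - \<alpha> * (\<Prod>e\<leftarrow>es. u - e))"

text \<open>\<open>BB_list \<alpha> es\<close> states that the general solution of the equation is the one in the list. Each
  entry presupposes that the \<open>e\<^sub>j\<close> are labelled as displayed in its premise.

  In the entry for two double roots the constant \<open>A\<close> is a square root, and both of its values occur:
  the functions \<open>A coth(Bz)\<close> and \<open>-A coth(Bz)\<close> are not translates of each other. In all other entries
  a change of branch amounts to a translation of \<open>z\<close>, or the sign is displayed.\<close>

fun BB_list :: "complex \<Rightarrow> complex list \<Rightarrow> bool" where
  "BB_list \<alpha> [] \<longleftrightarrow>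
     general_solution (binomial_BB \<alpha> [])
       (\<Union>\<sigma>\<in>{1,-1}. given_by (\<lambda>z u. u = \<sigma> * csqrt \<alpha> * z))"
| "BB_list \<alpha> [e1] \<longleftrightarrow>
     general_solution (binomial_BB \<alpha> [e1]) (given_by (\<lambda>z u. u = e1 + \<alpha> / 4 * z^2))"
| "BB_list \<alpha> [e1, e2] \<longleftrightarrow>
     (e1 \<noteq> e2 \<longrightarrow>
        (\<exists>A B. algebraic_in {\<alpha>, e1, e2} A \<and> algebraic_in {\<alpha>, e1, e2} B \<and>
           general_solution (binomial_BB \<alpha> [e1, e2])
             (given_by (\<lambda>z u. u = (e1 + e2) / 2 + A * cosh (B * z))))) \<and>
     (e1 = e2 \<longrightarrow>
        general_solution (binomial_BB \<alpha> [e1, e2])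
          (\<Union>\<sigma>\<in>{1,-1}. given_by (\<lambda>z u. u = e1 + exp (\<sigma> * csqrt \<alpha> * z))))"
| "BB_list \<alpha> [e1, e2, e3] \<longleftrightarrow>
     (distinct [e1, e2, e3] \<longrightarrow>
        (\<exists>\<Lambda>. is_period_lattice \<Lambda> \<and>
           general_solution (binomial_BB \<alpha> [e1, e2, e3])
             (given_by (\<lambda>z u. u = (e1 + e2 + e3) / 3 + 4 / \<alpha> * weierstrass_p \<Lambda> z)))) \<and>
     (e1 = e2 \<and> e2 \<noteq> e3 \<longrightarrow>
        (\<exists>A B D. (\<forall>c\<in>{A, B, D}. algebraic_in {\<alpha>, e1, e2, e3} c) \<and>
           general_solution (binomial_BB \<alpha> [e1, e2, e3])
             (given_by (\<lambda>z u. u = A + B * (cosh (D * z) / sinh (D * z))^2)))) \<and>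
     (e1 = e2 \<and> e2 = e3 \<longrightarrow>
        general_solution (binomial_BB \<alpha> [e1, e2, e3])
          (given_by (\<lambda>z u. u = e1 + 4 / (\<alpha> * z^2))))"
| "BB_list \<alpha> [e1, e2, e3, e4] \<longleftrightarrow>
     (distinct [e1, e2, e3, e4] \<longrightarrow>
        (\<exists>\<Lambda> a A. is_period_lattice \<Lambda> \<and> a \<notin> \<Lambda> \<and>
           algebraic_in {\<alpha>, e1, e2, e3, e4} (weierstrass_p \<Lambda> a) \<and>
           algebraic_in {\<alpha>, e1, e2, e3, e4} A \<and>
           general_solution (binomial_BB \<alpha> [e1, e2, e3, e4])
             (given_by (\<lambda>z u.
                u = inverse (csqrt \<alpha>) *
                    (weierstrass_zeta \<Lambda> (z + a) - weierstrass_zeta \<Lambda> (z - a)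
                     - 2 * weierstrass_zeta \<Lambda> a + A) \<and>
                (z \<notin> \<Lambda> \<longrightarrow>
                 u = inverse (csqrt \<alpha>) *
                     (A - deriv (weierstrass_p \<Lambda>) a / (weierstrass_p \<Lambda> z - weierstrass_p \<Lambda> a)))))))
     \<and>
     (e1 = e2 \<and> distinct [e1, e3, e4] \<longrightarrow>
        (\<exists>A B D. (\<forall>c\<in>{A, B, D}. algebraic_in {\<alpha>, e1, e2, e3, e4} c) \<and>
           general_solution (binomial_BB \<alpha> [e1, e2, e3, e4])
             (given_by (\<lambda>z u. 1 / (u - e1) = A * cosh (B * z) + D)))) \<and>
     (e1 = e3 \<and> e2 = e4 \<and> e1 \<noteq> e2 \<longrightarrow>
        (\<exists>A B. (\<forall>c\<in>{A, B}. algebraic_in {\<alpha>, e1, e2, e3, e4} c) \<and>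
           general_solution (binomial_BB \<alpha> [e1, e2, e3, e4])
             (\<Union>\<sigma>\<in>{1,-1}. given_by (\<lambda>z u.
                u = (e1 + e2) / 2 + \<sigma> * A * (cosh (B * z) / sinh (B * z)))))) \<and>
     (e1 = e2 \<and> e2 = e3 \<and> e3 \<noteq> e4 \<longrightarrow>
        (\<exists>A. algebraic_in {\<alpha>, e1, e2, e3, e4} A \<and>
           general_solution (binomial_BB \<alpha> [e1, e2, e3, e4])
             (given_by (\<lambda>z u. (u - e4) / (u - e1) = A * ((e4 - e1) / 2 * z)^2)))) \<and>
     (e1 = e2 \<and> e2 = e3 \<and> e3 = e4 \<longrightarrow>
        general_solution (binomial_BB \<alpha> [e1, e2, e3, e4])
          (\<Union>\<sigma>\<in>{1,-1}. given_by (\<lambda>z u. u = e1 + \<sigma> * inverse (csqrt \<alpha>) / z)))"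
| "BB_list \<alpha> (e1 # e2 # e3 # e4 # e5 # es) \<longleftrightarrow> False"


section \<open>The equations of the theorem\<close>

definition eq_E :: "complex poly \<Rightarrow> ode" where
  "eq_E P = (\<lambda>w w' w''. w * w'' - w'^2 + poly P w)"

definition eq_linear_rhs :: "complex \<Rightarrow> complex \<Rightarrow> complex \<Rightarrow> complex \<Rightarrow> ode" where
  "eq_linear_rhs \<alpha>2 \<alpha>1 \<alpha>0 \<beta> =
     (\<lambda>w w' w''. w * w'' - w'^2 - (\<alpha>2 * w'' + \<alpha>1 * w' + \<alpha>0 * w + \<beta>))"

definition first_integral :: "complex poly \<Rightarrow> complex \<Rightarrow> ode" where
  "first_integral P C =
     (\<lambda>w w' w''. w'^2 + poly.coeff P 4 * w^4 + 2 * poly.coeff P 3 * w^3 + 2 * C * w^2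
                 - 2 * poly.coeff P 1 * w - poly.coeff P 0)"

end

theory Submission
  imports Defs "HOL-Computational_Algebra.Fundamental_Theorem_Algebra"
begin

text \<open>The proof rests on two facts about a non-constant meromorphic solution \<open>w\<close> of
  \<open>w w'' - w'^2 + P(w) = 0\<close>, one about its growth and one about its residues, and on
  a uniform way of finding the general solution of a first order autonomous equation.

  Growth. Put \<open>L = (log w)'' = (w w'' - w'^2) / w^2\<close>. If \<open>P\<close> has degree
  at least 3, the equation gives \<open>|L| \<ge> c |w|\<close> wherever \<open>|w|\<close> is
  large. In a suitable direction the harmonic function \<open>log |w|\<close> has second
  derivative \<open>|L|\<close>, and at a maximum point of \<open>|w(z)| (R^2 - |z -
  a|^2)^2\<close> in the disc of radius \<open>R\<close> this can only be balanced by the weight.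
  The outcome is \<open>|w(a)| R^2 \<le> 12 / c\<close> at points where \<open>|w(a)|\<close> is
  large (\<open>entire_growth_bound\<close>), so an entire \<open>w\<close> is bounded and hence
  constant (\<open>entire_solution_constant\<close>). For \<open>k \<ge> 3\<close> there is
  therefore a pole. At a pole, \<open>s = 1/w\<close> satisfies \<open>s^{k-4} (s s'' - s'^2) =
  \<Sum> a_n s^{k-n}\<close>, which for \<open>k \<ge> 5\<close> is contradictory at \<open>s =
  0\<close> (\<open>eq_E_pole_degree\<close>).

  Residues. The function \<open>H = (w'/w)^2 - a_0/w^2 - 2 a_1/w + 2 a_3 w + a_4 w^2\<close> has
  derivative \<open>- 2 a_2 w'/w\<close>. A derivative has residue 0, whereas the residue of
  \<open>w'/w\<close> is the order of \<open>w\<close>; so \<open>a_2 = 0\<close> as soon as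
  \<open>w\<close> has a zero or a pole (\<open>quadratic_coefficient_vanishes\<close>). For
  \<open>k = 2\<close> this makes every solution entire and zero-free; then \<open>1/w\<close> is
  an entire solution of an equation of the same type, and the growth argument leaves only
  \<open>a_0 = a_1 = 0\<close>, where \<open>(w'/w)' = - a_2\<close> is integrated directly
  (\<open>eq_E_quadratic\<close>). For \<open>k = 3, 4\<close> the vanishing of \<open>a_2\<close>
  makes \<open>H = - 2 C\<close> constant, which is the first integral
  (\<open>eq_E_imp_first_integral\<close>).

  First order equations \<open>u'^2 = Q(u)\<close>. Differentiation gives \<open>u'' =
  Q'(u)/2\<close> for every non-constant solution, and a solution of this equation is determined
  by the values of \<open>u\<close> and \<open>u'\<close> at one point. If \<open>U\<close> is one
  non-constant meromorphic solution, its range is dense by Liouville's theorem, so any local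
  solution takes a value of \<open>U\<close>, with the same derivative up to sign, and is a
  translate of \<open>U(z)\<close> or \<open>U(-z)\<close> (\<open>general_solutionI\<close>).
  Each entry of the list thus reduces to exhibiting one solution. In the degenerate entries this
  is a quotient of entire functions.

  Elliptic entries. For three distinct roots a solution \<open>V\<close> of \<open>V'^2 = 4 (V -
  e_1)(V - e_2)(V - e_3)\<close> with a pole at 0 is constructed near 0 and continued to the plane
  by the duplication formula, which doubles the radius of its disc
  (\<open>global_cubic_solution\<close>). A pole determines a solution uniquely, so the poles of
  \<open>V\<close> are its periods; the growth argument applied to \<open>1/(V - e)\<close> shows
  that \<open>V\<close> takes all values, and points with \<open>V = e_j\<close> are half-periods,
  which forces the periods to have rank two. Liouville's theorem then identifies \<open>V\<close>
  with a Weierstrass function up to a constant (\<open>elliptic_uniformization\<close>). For four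
  distinct roots the solution is an affine image of \<open>- \<wp>'(a) / (\<wp>(z) -
  \<wp>(a))\<close>, and its expression by zeta functions is an instance of the addition theorem
  (\<open>addition_identity\<close>).\<close>

section \<open>Meromorphic functions in normal form\<close>

lemma nicely_meromorphic_eq_at:
  assumes "f nicely_meromorphic_on {z}" "g nicely_meromorphic_on {z}"
    and "eventually (\<lambda>w. f w = g w) (at z)"
  shows "f z = g z"
proof -
  have "is_pole f z \<longleftrightarrow> is_pole g z" using is_pole_cong[OF assms(3)] by blast
  moreover have "f \<midarrow>z\<rightarrow> c \<longleftrightarrow> g \<midarrow>z\<rightarrow> c" for c by (rule tendsto_cong[OF assms(3)])
  moreover have "\<not> (is_pole f z \<and> f \<midarrow>z\<rightarrow> c)" for c
    unfolding is_pole_def using not_tendsto_and_filterlim_at_infinity[of "at z" f c] by auto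
  ultimately show ?thesis using assms(1,2) LIM_unique unfolding nicely_meromorphic_on_def by fastforce
qed

lemma meromorphic_zero_propagates:
  assumes "f meromorphic_on A" "open A" "connected A" "z0 \<in> A"
    and "eventually (\<lambda>z. f z = 0) (at z0)" "z \<in> A"
  shows "eventually (\<lambda>z. f z = 0) (at z)"
  using meromorphic_imp_constant_or_avoid[OF assms(1-3), of 0]
proof
  assume "eventually (\<lambda>z. f z = 0) (cosparse A)"
  thus ?thesis using assms eventually_cosparse_imp_eventually_at by blast
next
  assume "eventually (\<lambda>z. f z \<noteq> 0) (cosparse A)"
  hence "eventually (\<lambda>z. f z \<noteq> 0) (at z0)" using assms eventually_cosparse_imp_eventually_at by blast
  hence "eventually (\<lambda>z. False) (at z0)" using assms(5) by eventually_elim simp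
  thus ?thesis by simp
qed

text \<open>In normal form meromorphic functions that agree near a point agree there as well, poles
  included, because the value at a pole is fixed to be 0. The identity theorem therefore yields
  equality at every point.\<close>

lemma nicely_meromorphic_identity:
  assumes "f nicely_meromorphic_on A" "g nicely_meromorphic_on A" "open A" "connected A" "z0 \<in> A"
    and "eventually (\<lambda>z. f z = g z) (at z0)" "z \<in> A"
  shows "f z = g z" "is_pole f z \<longleftrightarrow> is_pole g z"
proof -
  have "(\<lambda>z. f z - g z) meromorphic_on A"
    using assms by (intro meromorphic_intros) (simp_all add: nicely_meromorphic_on_def)
  hence *: "eventually (\<lambda>z. f z = g z) (at z)"
    using meromorphic_zero_propagates[of "\<lambda>z. f z - g z" A z0 z] assms by simp
  show "f z = g z"
    using * assms by (intro nicely_meromorphic_eq_at) (auto intro: nicely_meromorphic_on_subset)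
  show "is_pole f z \<longleftrightarrow> is_pole g z" using is_pole_cong[OF *] by blast
qed

lemma nicely_meromorphic_eqI:
  assumes "f nicely_meromorphic_on UNIV" "g nicely_meromorphic_on UNIV"
    and "eventually (\<lambda>z. f z = g z) (at z0)"
  shows "f = g"
  using nicely_meromorphic_identity(1)[OF assms(1,2) open_UNIV connected_UNIV UNIV_I assms(3) UNIV_I] by blast

lemma filtermap_affine_at:
  fixes a b z :: complex
  assumes "a \<noteq> 0"
  shows "filtermap (\<lambda>z. a * z + b) (at z) = at (a * z + b)"
proof -
  have "filtermap (\<lambda>z. a * z + b) (nhds z) = nhds (a * z + b)"
  proof (rule filtermap_nhds_open_map[where f = "\<lambda>z. a * z + b"])
    show "isCont (\<lambda>z. a * z + b) z" by (intro continuous_intros)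
    fix S :: "complex set" assume "open S"
    have "(\<lambda>z. a * z + b) ` S = (\<lambda>w. (w - b) / a) -` S"
      using assms by (auto simp: image_iff field_simps intro!: bexI[of _ "(_ - b) / a"])
    also have "open \<dots>"
      using \<open>open S\<close> by (intro open_vimage continuous_intros) (auto simp: assms)
    finally show "open ((\<lambda>z. a * z + b) ` S)" .
  qed
  thus ?thesis by (rule filtermap_nhds_eq_imp_filtermap_at_eq) (use assms in auto)
qed

lemma is_pole_affine_iff:
  fixes a b z :: complex
  assumes "a \<noteq> 0"
  shows "is_pole (\<lambda>z. f (a * z + b)) z \<longleftrightarrow> is_pole f (a * z + b)"
  using is_pole_compose_iff[OF filtermap_affine_at[OF assms], of f] by (simp add: o_def)

lemma nicely_meromorphic_affine:
  fixes a b :: complex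
  assumes "f nicely_meromorphic_on UNIV" "a \<noteq> 0"
  shows "(\<lambda>z. f (a * z + b)) nicely_meromorphic_on UNIV"
  unfolding nicely_meromorphic_on_def
proof (intro conjI ballI)
  have "f meromorphic_on UNIV" using assms(1) by (simp add: nicely_meromorphic_on_def)
  thus "(\<lambda>z. f (a * z + b)) meromorphic_on UNIV"
    by (rule meromorphic_on_compose) (auto intro!: analytic_intros)
  fix z
  have "is_pole f (a * z + b) \<and> f (a * z + b) = 0 \<or> (f \<midarrow>a * z + b\<rightarrow> f (a * z + b))"
    using assms(1) by (simp add: nicely_meromorphic_on_def)
  moreover
  have "(f \<longlongrightarrow> c) (filtermap (\<lambda>z. a * z + b) (at z)) = ((\<lambda>z. f (a * z + b)) \<midarrow>z\<rightarrow> c)" for c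
    by (simp add: filterlim_filtermap)
  hence "(f \<midarrow>a * z + b\<rightarrow> f (a * z + b)) \<longleftrightarrow> ((\<lambda>z. f (a * z + b)) \<midarrow>z\<rightarrow> f (a * z + b))"
    by (simp only: filtermap_affine_at[OF assms(2)])
  ultimately show "is_pole (\<lambda>z. f (a * z + b)) z \<and> f (a * z + b) = 0 \<or>
        ((\<lambda>z. f (a * z + b)) \<midarrow>z\<rightarrow> f (a * z + b))"
    using is_pole_affine_iff[OF assms(2), of f b z] by argo
qed

section \<open>First order autonomous equations\<close>

definition first_order_ode :: "complex poly \<Rightarrow> ode" where
  "first_order_ode Q = (\<lambda>u u' u''. u'^2 - poly Q u)"

lemma satisfies_first_order:
  "satisfies_at (first_order_ode Q) u z \<longleftrightarrow> deriv u z ^ 2 = poly Q (u z)"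
  by (simp add: satisfies_at_def first_order_ode_def)

lemma eventually_analytic_at:
  assumes "f nicely_meromorphic_on UNIV"
  shows "eventually (\<lambda>w. f analytic_on {w} \<and> \<not> is_pole f w) (at z)"
proof -
  have m: "f meromorphic_on UNIV" using assms by (simp add: nicely_meromorphic_on_def)
  from meromorphic_on_imp_analytic_cosparse[OF m] meromorphic_on_imp_not_pole_cosparse[OF m]
  show ?thesis
    using eventually_cosparse_imp_eventually_at eventually_conj by blast
qed

lemma analytic_poly [analytic_intros]:
  fixes Q :: "complex poly"
  shows "f analytic_on A \<Longrightarrow> (\<lambda>z. poly Q (f z)) analytic_on A"
  by (induction Q) (auto intro!: analytic_intros)

lemma meromorphic_poly [meromorphic_intros]:
  fixes Q :: "complex poly"
  shows "f meromorphic_on A \<Longrightarrow> (\<lambda>z. poly Q (f z)) meromorphic_on A"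
  by (induction Q) (auto intro!: meromorphic_intros)

lemma analytic_eventually_zero_imp_zero:
  fixes f :: "complex \<Rightarrow> complex"
  assumes "f analytic_on {z}" "eventually (\<lambda>w. f w = 0) (at z)"
  shows "f z = 0"
proof -
  have "f \<midarrow>z\<rightarrow> f z"
    using analytic_at_imp_isCont[OF assms(1)] by (simp add: isCont_def)
  moreover have "f \<midarrow>z\<rightarrow> 0" using assms(2) by (simp add: tendsto_eventually)
  ultimately show ?thesis using LIM_unique by blast
qed

text \<open>The defect \<open>u'^2 - Q(u)\<close> is meromorphic, so the identity theorem spreads the
  equation from a neighbourhood of one point, which may even be a pole, to the plane.\<close>

lemma first_order_solutionI:
  assumes "u nicely_meromorphic_on UNIV"
    and "eventually (\<lambda>z. deriv u z ^ 2 = poly Q (u z)) (at z0)"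
  shows "meromorphic_solution (first_order_ode Q) u"
proof -
  define g where "g = (\<lambda>z. deriv u z ^ 2 - poly Q (u z))"
  have m: "u meromorphic_on UNIV" using assms(1) by (simp add: nicely_meromorphic_on_def)
  hence gm: "g meromorphic_on UNIV" unfolding g_def by (intro meromorphic_intros)
  have g0: "eventually (\<lambda>z. g z = 0) (at z0)"
    using assms(2) by eventually_elim (simp add: g_def)
  have "g z = 0" if "\<not> is_pole u z" for z
  proof (rule analytic_eventually_zero_imp_zero[of g z])
    show "eventually (\<lambda>w. g w = 0) (at z)"
      by (rule meromorphic_zero_propagates[OF gm open_UNIV connected_UNIV UNIV_I g0 UNIV_I])
    have "u analytic_on {z}" using nicely_meromorphic_on_imp_analytic_at[OF assms(1) _ that] by simp
    thus "g analytic_on {z}" unfolding g_def by (intro analytic_intros)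
  qed
  thus ?thesis using assms(1)
    by (simp add: meromorphic_solution_def satisfies_first_order g_def)
qed

lemma first_order_solutionD:
  assumes "meromorphic_solution (first_order_ode Q) u"
  shows "eventually (\<lambda>z. deriv u z ^ 2 = poly Q (u z)) (at z)"
  using eventually_analytic_at[of u z] assms
  by (auto simp: meromorphic_solution_def satisfies_first_order elim!: eventually_mono)

text \<open>Only the square of \<open>u'\<close> enters the equation, so reflections are admitted besides
  translations.\<close>

lemma first_order_solution_affine:
  assumes "meromorphic_solution (first_order_ode Q) u" "a\<^sup>2 = 1"
  shows "meromorphic_solution (first_order_ode Q) (\<lambda>z. u (a * z + b))"
proof -
  have a: "a \<noteq> 0" using assms(2) by auto
  have n: "u nicely_meromorphic_on UNIV" using assms(1) by (simp add: meromorphic_solution_def)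
  show ?thesis
    unfolding meromorphic_solution_def satisfies_first_order
  proof (intro conjI allI impI)
    show "(\<lambda>z. u (a * z + b)) nicely_meromorphic_on UNIV" by (rule nicely_meromorphic_affine[OF n a])
    fix z assume "\<not> is_pole (\<lambda>z. u (a * z + b)) z"
    hence np: "\<not> is_pole u (a * z + b)" using is_pole_affine_iff[OF a] by blast
    hence "u analytic_on {a * z + b}" using nicely_meromorphic_on_imp_analytic_at[OF n] by auto
    hence "deriv (\<lambda>z. u (a * z + b)) z = a * deriv u (a * z + b)"
      by (intro deriv_compose_linear' analytic_on_imp_differentiable_at) auto
    thus "(deriv (\<lambda>z. u (a * z + b)) z)\<^sup>2 = poly Q (u (a * z + b))"
      using np assms by (auto simp: meromorphic_solution_def satisfies_first_order power_mult_distrib)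
  qed
qed

lemma constant_on_affine_iff:
  fixes a b :: complex
  assumes "a \<noteq> 0"
  shows "(\<lambda>z. u (a * z + b)) constant_on UNIV \<longleftrightarrow> u constant_on UNIV"
proof
  assume "(\<lambda>z. u (a * z + b)) constant_on UNIV"
  then obtain c where c: "\<And>z. u (a * z + b) = c" by (auto simp: constant_on_def)
  have "u z = c" for z using c[of "(z - b) / a"] assms by simp
  thus "u constant_on UNIV" by (auto simp: constant_on_def)
qed (auto simp: constant_on_def)

lemma nonconst_solution_affine:
  assumes "u \<in> nonconst_meromorphic_solutions (first_order_ode Q)" "a\<^sup>2 = 1"
  shows "(\<lambda>z. u (a * z + b)) \<in> nonconst_meromorphic_solutions (first_order_ode Q)"
proof -
  have "a \<noteq> 0" using assms(2) by auto
  thus ?thesis using assms first_order_solution_affine[of Q u a b] constant_on_affine_iff[of a u b]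
    by (simp add: nonconst_meromorphic_solutions_def)
qed

lemma holomorphic_poly [holomorphic_intros]:
  fixes Q :: "complex poly"
  shows "f holomorphic_on A \<Longrightarrow> (\<lambda>z. poly Q (f z)) holomorphic_on A"
  by (induction Q) (auto intro!: holomorphic_intros)

text \<open>Differentiating \<open>u'^2 = Q(u)\<close> gives \<open>u' (2 u'' - Q'(u)) = 0\<close>, and
  \<open>u'\<close> vanishes on no open set. The second order equation no longer contains the
  singular constant solutions, at the cost of the derivative as additional initial datum; this is
  what makes uniqueness hold also at zeros of \<open>Q(u)\<close>.\<close>

lemma first_order_imp_second_order:
  assumes S: "open S" "connected S" "u holomorphic_on S" "\<not> u constant_on S"
    and eq: "\<And>z. z \<in> S \<Longrightarrow> deriv u z ^ 2 = poly Q (u z)" and z: "z \<in> S"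
  shows "deriv (deriv u) z = poly (pderiv Q) (u z) / 2"
proof (rule ccontr)
  define g where "g = (\<lambda>z. deriv (deriv u) z - poly (pderiv Q) (u z) / 2)"
  assume "\<not> ?thesis"
  hence gz: "g z \<noteq> 0" by (simp add: g_def)
  have du: "deriv u holomorphic_on S" using S by (intro holomorphic_deriv)
  have ddu: "deriv (deriv u) holomorphic_on S" using S du by (intro holomorphic_deriv)
  have prod: "deriv u w * g w = 0" if w: "w \<in> S" for w
  proof -
    have 1: "(u has_field_derivative deriv u w) (at w)"
      using S w holomorphic_derivI by blast
    have 2: "(deriv u has_field_derivative deriv (deriv u) w) (at w)"
      using S w du holomorphic_derivI by blast
    have "((\<lambda>w. deriv u w ^ 2 - poly Q (u w)) has_field_derivative
            (2 * deriv u w * deriv (deriv u) w - poly (pderiv Q) (u w) * deriv u w)) (at w)"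
      using DERIV_diff[OF DERIV_power[OF 2, of 2] DERIV_chain2[OF poly_DERIV 1, of Q]]
      by (simp add: mult_ac)
    moreover have "((\<lambda>w. deriv u w ^ 2 - poly Q (u w)) has_field_derivative 0) (at w)"
      by (rule has_field_derivative_transform_within_open[of "\<lambda>_. 0" _ _ S])
         (use S w eq in auto)
    ultimately have "2 * deriv u w * deriv (deriv u) w - poly (pderiv Q) (u w) * deriv u w = 0"
      by (rule DERIV_unique)
    thus ?thesis by (simp add: g_def algebra_simps)
  qed
  have "g holomorphic_on S" unfolding g_def using S(3) ddu
    by (intro holomorphic_intros) (use S in auto)
  hence "isCont g z" using S z holomorphic_on_imp_continuous_on continuous_on_eq_continuous_at by blast
  hence "eventually (\<lambda>w. g w \<noteq> 0) (nhds z)"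
    using gz tendsto_imp_eventually_ne[of g "g z" "nhds z" 0] by (simp add: continuous_at tendsto_at_iff_tendsto_nhds)
  moreover have "eventually (\<lambda>w. w \<in> S) (nhds z)" using S z eventually_nhds_in_open by blast
  ultimately have ev: "eventually (\<lambda>w. deriv u w = 0) (nhds z)"
    by eventually_elim (use prod in auto)
  have "deriv u nicely_meromorphic_on S" using du S
    by (intro analytic_on_imp_nicely_meromorphic_on) (simp add: analytic_on_open)
  moreover have "eventually (\<lambda>w. deriv u w = 0) (at z)" using ev by (simp add: eventually_nhds_conv_at)
  ultimately have "deriv u w = 0" if "w \<in> S" for w
    using nicely_meromorphic_identity(1)[of "deriv u" S "\<lambda>_. 0" z w] S z that by blast
  hence "(u has_field_derivative 0) (at w)" if "w \<in> S" for w
    using S that holomorphic_derivI[of u S w] by simp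
  hence "u constant_on S" using S by (intro has_field_derivative_0_imp_constant_on)
  thus False using S by blast
qed

section \<open>Uniqueness at regular points and at poles\<close>

lemma poly_diff_dvd:
  fixes x y :: "'a :: comm_ring_1"
  shows "x - y dvd poly p x - poly p y"
proof (induction p)
  case (pCons a p)
  have "poly (pCons a p) x - poly (pCons a p) y = x * (poly p x - poly p y) + (x - y) * poly p y"
    by (simp add: algebra_simps)
  thus ?case using dvd_add[OF dvd_mult[OF pCons.IH, of x] dvd_triv_left[of "x - y" "poly p y"]] by simp
qed auto

lemma has_fps_expansion_poly:
  fixes p :: "complex poly"
  assumes "f has_fps_expansion F"
  shows "(\<lambda>z. poly p (f z)) has_fps_expansion poly (map_poly fps_const p) F"
proof (induction p)
  case (pCons a p)
  have "(\<lambda>z. a + f z * poly p (f z)) has_fps_expansion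
          (fps_const a + F * poly (map_poly fps_const p) F)"
    using assms pCons by (intro fps_expansion_intros)
  thus ?case using pCons by (simp add: map_poly_pCons)
qed auto

text \<open>The difference \<open>D\<close> of two expansions with the same initial data vanishes to some
  order \<open>n \<ge> 2\<close> and satisfies \<open>D'' = D K\<close> for a power series
  \<open>K\<close>. But \<open>D''\<close> vanishes only to order \<open>n - 2\<close>.\<close>

lemma second_order_unique_fps:
  fixes p :: "complex poly"
  assumes exp: "f1 has_fps_expansion F1" "f2 has_fps_expansion F2"
    and eq: "eventually (\<lambda>z. deriv (deriv f1) z = poly p (f1 z)) (nhds 0)"
            "eventually (\<lambda>z. deriv (deriv f2) z = poly p (f2 z)) (nhds 0)"
    and init: "f1 0 = f2 0" "deriv f1 0 = deriv f2 0"
  shows "F1 = F2"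
proof (rule ccontr)
  assume "F1 \<noteq> F2"
  define D where "D = F1 - F2"
  hence D: "D \<noteq> 0" using \<open>F1 \<noteq> F2\<close> by simp
  have dd: "fps_deriv (fps_deriv F) = poly (map_poly fps_const p) F"
    if "f has_fps_expansion F" "eventually (\<lambda>z. deriv (deriv f) z = poly p (f z)) (nhds 0)" for f F
  proof -
    have "deriv (deriv f) has_fps_expansion fps_deriv (fps_deriv F)" using that by (intro fps_expansion_intros)
    hence "(\<lambda>z. poly p (f z)) has_fps_expansion fps_deriv (fps_deriv F)"
      using has_fps_expansion_cong[OF that(2) refl] by blast
    thus ?thesis using has_fps_expansion_poly[OF that(1), of p] fps_expansion_unique_complex by blast
  qed
  obtain K where K: "poly (map_poly fps_const p) F1 - poly (map_poly fps_const p) F2 = D * K"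
    using poly_diff_dvd[of F1 F2] unfolding D_def dvd_def by blast
  have DD: "fps_deriv (fps_deriv D) = D * K"
    using dd[OF exp(1) eq(1)] dd[OF exp(2) eq(2)] K by (simp add: D_def)
  have "f1 0 = fps_nth F1 0" "f2 0 = fps_nth F2 0"
    using exp has_fps_expansion_imp_0_eq_fps_nth_0 by blast+
  moreover have "deriv f1 0 = fps_nth (fps_deriv F1) 0" "deriv f2 0 = fps_nth (fps_deriv F2) 0"
    using exp has_fps_expansion_imp_0_eq_fps_nth_0 has_fps_expansion_deriv by blast+
  ultimately have "fps_nth D 0 = 0" "fps_nth D 1 = 0" using init by (simp_all add: D_def)
  moreover define n where "n = subdegree D"
  have nz: "fps_nth D n \<noteq> 0" using D by (simp add: n_def)
  ultimately have "n \<noteq> 0" "n \<noteq> 1" by metis+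
  hence "n \<ge> 2" by simp
  then obtain m where m: "n = m + 2" using nat_le_iff_add[of 2 n] by (auto simp: add.commute)
  have "fps_nth (D * K) m = 0" using m by (intro fps_mult_nth_outside_subdegrees(1)) (simp add: n_def)
  moreover have "fps_nth (fps_deriv (fps_deriv D)) m = of_nat (m + 1) * (of_nat (m + 2) * fps_nth D n)"
    by (simp add: m)
  ultimately show False using DD nz by (metis mult_eq_0_iff of_nat_eq_0_iff add_is_0 one_neq_zero zero_neq_numeral)
qed

lemma deriv_shift: "deriv (\<lambda>w. f (z + w)) = (\<lambda>w. deriv f (z + w :: complex))"
  unfolding deriv_def fun_eq_iff by (simp add: DERIV_shift[symmetric] add.commute[of z])

lemma second_order_unique:
  fixes p :: "complex poly"
  assumes an: "f1 analytic_on {z0}" "f2 analytic_on {z0}"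
    and eq: "eventually (\<lambda>z. deriv (deriv f1) z = poly p (f1 z)) (nhds z0)"
            "eventually (\<lambda>z. deriv (deriv f2) z = poly p (f2 z)) (nhds z0)"
    and init: "f1 z0 = f2 z0" "deriv f1 z0 = deriv f2 z0"
  shows "eventually (\<lambda>z. f1 z = f2 z) (nhds z0)"
proof -
  note e = an[THEN analytic_at_imp_has_fps_expansion]
  have eq': "eventually (\<lambda>z. deriv (deriv (\<lambda>w. f (z0 + w))) z = poly p (f (z0 + z))) (nhds 0)"
    if "eventually (\<lambda>z. deriv (deriv f) z = poly p (f z)) (nhds z0)" for f
    using that unfolding nhds_to_0[of z0] eventually_filtermap deriv_shift[of f] deriv_shift[of "deriv f"] .
  have "fps_expansion f1 z0 = fps_expansion f2 z0"
    by (rule second_order_unique_fps[OF e eq'[OF eq(1)] eq'[OF eq(2)]])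
       (use init in \<open>simp_all add: deriv_shift[of f1] deriv_shift[of f2]\<close>)
  with e have "eventually (\<lambda>w. eval_fps (fps_expansion f2 z0) w = f1 (z0 + w)) (nhds 0)"
    "eventually (\<lambda>w. eval_fps (fps_expansion f2 z0) w = f2 (z0 + w)) (nhds 0)"
    unfolding has_fps_expansion_def by simp_all
  hence "eventually (\<lambda>w. f1 (z0 + w) = f2 (z0 + w)) (nhds 0)" by eventually_elim simp
  thus ?thesis unfolding nhds_to_0[of z0] eventually_filtermap .
qed

lemma eventually_at_imp_eventually_nhds:
  fixes z :: "'a :: t1_space"
  assumes "eventually P (at z)"
  shows "eventually (\<lambda>w. eventually P (nhds w)) (at z)"
proof -
  obtain S where S: "open S" "z \<in> S" "\<And>w. w \<in> S \<Longrightarrow> w \<noteq> z \<Longrightarrow> P w"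
    using assms unfolding eventually_at_topological by blast
  have "eventually P (nhds w)" if "w \<in> S" "w \<noteq> z" for w
    unfolding eventually_nhds using S that by (intro exI[of _ "S - {z}"]) (auto intro: open_delete)
  thus ?thesis unfolding eventually_at_topological using S by blast
qed

text \<open>A pole is studied in the coordinate \<open>1/v\<close>, completed by the value 0 at the pole.\<close>

lemma inverse_at_pole:
  assumes mero: "v meromorphic_on {z0}" and pole: "is_pole v z0"
  defines "s \<equiv> remove_sings (\<lambda>z. inverse (v z))"
  shows "s analytic_on {z0}" "s z0 = 0"
    "eventually (\<lambda>w. v analytic_on {w} \<and> v w \<noteq> 0 \<and> s w = inverse (v w) \<and>
        deriv s w = - deriv v w / v w ^ 2) (at z0)"
proof -
  have iso: "isolated_singularity_at (\<lambda>z. inverse (v z)) z0"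
    using meromorphic_on_inverse[OF mero] by (simp add: meromorphic_at_iff)
  have lim: "((\<lambda>z. inverse (v z)) \<longlongrightarrow> 0) (at z0)"
    using is_pole_tendsto[OF pole] by (simp add: o_def)
  show "s analytic_on {z0}" unfolding s_def by (rule remove_sings_analytic_at[OF iso lim])
  show "s z0 = 0" unfolding s_def using lim by (rule remove_sings_eqI)
  have e1: "eventually (\<lambda>w. s w = inverse (v w)) (at z0)"
    unfolding s_def by (rule eventually_remove_sings_eq_at[OF iso])
  have "eventually (\<lambda>w. v w \<noteq> 0) (at z0)"
    using non_zero_neighbour_pole[OF pole] .
  moreover have "isolated_singularity_at v z0" using mero by (simp add: meromorphic_at_iff)
  hence "eventually (\<lambda>w. v analytic_on {w}) (at z0)"
    by (simp add: isolated_singularity_at_altdef)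
  ultimately show "eventually (\<lambda>w. v analytic_on {w} \<and> v w \<noteq> 0 \<and> s w = inverse (v w) \<and>
        deriv s w = - deriv v w / v w ^ 2) (at z0)"
    using e1 eventually_at_imp_eventually_nhds[OF e1]
  proof eventually_elim
    case (elim w)
    have "(v has_field_derivative deriv v w) (at w)"
      using elim(2) analytic_on_imp_differentiable_at DERIV_deriv_iff_field_differentiable by blast
    hence "((\<lambda>z. inverse (v z)) has_field_derivative - deriv v w / v w ^ 2) (at w)"
      using elim(1) by (auto intro!: derivative_eq_intros simp: field_simps power2_eq_square)
    hence "deriv (\<lambda>z. inverse (v z)) w = - deriv v w / v w ^ 2" by (rule DERIV_imp_deriv)
    thus ?case using elim deriv_cong_ev[OF elim(4) refl] by simp
  qed
qed

text \<open>For \<open>s = 1/v\<close> the equation becomes \<open>s'^2 = s^4 Q(1/s)\<close>. When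
  \<open>Q\<close> has degree 3 the right-hand side is a polynomial in \<open>s\<close> that
  vanishes at 0, so \<open>s' = 0\<close> at the pole and \<open>s\<close> solves a regular second
  order equation across it.\<close>

lemma cubic_pole_second_order:
  assumes Q: "degree Q = 3" and mero: "v meromorphic_on {z0}" and pole: "is_pole v z0"
    and eq: "eventually (\<lambda>w. deriv v w ^ 2 = poly Q (v w)) (at z0)"
  defines "s \<equiv> remove_sings (\<lambda>z. inverse (v z))"
  shows "eventually (\<lambda>z. deriv (deriv s) z = poly (smult (1/2) (pderiv (pCons 0 (reflect_poly Q)))) (s z)) (nhds z0)"
    "deriv s z0 = 0"
proof -
  define S where "S = pCons 0 (reflect_poly Q)"
  note inv = inverse_at_pole[OF mero pole, folded s_def]
  have ev: "eventually (\<lambda>w. deriv s w ^ 2 = poly S (s w)) (at z0)"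
    using inv(3) eq
  proof eventually_elim
    case (elim w)
    have "poly S (s w) = s w * (s w ^ 3 * poly Q (v w))"
      using elim Q by (simp add: S_def poly_reflect_poly_nz)
    also have "\<dots> = s w ^ 4 * deriv v w ^ 2" using elim by (simp add: eval_nat_numeral mult_ac)
    also have "deriv s w = - (deriv v w * s w ^ 2)" using elim by (simp add: power_inverse divide_inverse)
    hence "s w ^ 4 * deriv v w ^ 2 = deriv s w ^ 2" by (simp add: power_mult_distrib flip: power_mult)
    finally show ?case by simp
  qed
  have d0: "deriv s z0 ^ 2 - poly S (s z0) = 0"
  proof (rule analytic_eventually_zero_imp_zero[of "\<lambda>z. deriv s z ^ 2 - poly S (s z)"])
    show "(\<lambda>z. deriv s z ^ 2 - poly S (s z)) analytic_on {z0}"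
      using inv(1) by (intro analytic_intros)
    show "eventually (\<lambda>w. deriv s w ^ 2 - poly S (s w) = 0) (at z0)" using ev by eventually_elim simp
  qed
  thus "deriv s z0 = 0" using inv(2) by (simp add: S_def)
  have "eventually (\<lambda>w. deriv s w ^ 2 = poly S (s w)) (nhds z0)"
    using ev d0 by (simp add: eventually_nhds_conv_at)
  moreover obtain r0 where r0: "r0 > 0" "s holomorphic_on ball z0 r0"
    using inv(1) by (auto simp: analytic_on_def)
  hence "eventually (\<lambda>w. w \<in> ball z0 r0) (nhds z0)" by (intro eventually_nhds_in_open) auto
  ultimately have "eventually (\<lambda>w. deriv s w ^ 2 = poly S (s w) \<and> w \<in> ball z0 r0) (nhds z0)"
    by (rule eventually_conj)
  then obtain r where r: "r > 0" "\<And>w. dist w z0 < r \<Longrightarrow> deriv s w ^ 2 = poly S (s w) \<and> w \<in> ball z0 r0"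
    unfolding eventually_nhds_metric by blast
  have hol: "s holomorphic_on ball z0 r"
    using r r0 by (intro holomorphic_on_subset[OF r0(2)]) (auto simp: dist_commute)
  have nc: "\<not> s constant_on ball z0 r"
  proof
    assume "s constant_on ball z0 r"
    hence "s w = 0" if "w \<in> ball z0 r" for w
      using that r(1) inv(2) unfolding constant_on_def by (metis centre_in_ball)
    moreover have "eventually (\<lambda>w. w \<in> ball z0 r) (at z0)"
      using r(1) by (intro eventually_at_in_open') auto
    hence "eventually (\<lambda>w. w \<in> ball z0 r \<and> v w \<noteq> 0 \<and> s w = inverse (v w)) (at z0)"
      using inv(3) by eventually_elim auto
    hence "\<exists>w. w \<in> ball z0 r \<and> v w \<noteq> 0 \<and> s w = inverse (v w)"
      using eventually_happens trivial_limit_at by blast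
    ultimately show False by auto
  qed
  have "eventually (\<lambda>w. w \<in> ball z0 r) (nhds z0)" using r(1) by (intro eventually_nhds_in_open) auto
  thus "eventually (\<lambda>z. deriv (deriv s) z = poly (smult (1/2) (pderiv (pCons 0 (reflect_poly Q)))) (s z)) (nhds z0)"
  proof eventually_elim
    case (elim w)
    have "deriv (deriv s) w = poly (pderiv S) (s w) / 2"
      by (rule first_order_imp_second_order[of "ball z0 r" s S])
         (use hol nc r elim in \<open>auto simp: dist_commute\<close>)
    thus ?case by (simp add: S_def)
  qed
qed

text \<open>A pole already determines the solution: the reciprocals of two solutions both start with value 0
  and derivative 0.\<close>

lemma cubic_pole_unique:
  assumes Q: "degree Q = 3"
    and 1: "v1 meromorphic_on {z0}" "is_pole v1 z0" "eventually (\<lambda>w. deriv v1 w ^ 2 = poly Q (v1 w)) (at z0)"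
    and 2: "v2 meromorphic_on {z0}" "is_pole v2 z0" "eventually (\<lambda>w. deriv v2 w ^ 2 = poly Q (v2 w)) (at z0)"
  shows "eventually (\<lambda>w. v1 w = v2 w) (at z0)"
proof -
  note i1 = inverse_at_pole[OF 1(1,2)] and i2 = inverse_at_pole[OF 2(1,2)]
  note c1 = cubic_pole_second_order[OF Q 1] and c2 = cubic_pole_second_order[OF Q 2]
  have "eventually (\<lambda>w. remove_sings (\<lambda>z. inverse (v1 z)) w = remove_sings (\<lambda>z. inverse (v2 z)) w) (nhds z0)"
    by (rule second_order_unique[OF i1(1) i2(1) c1(1) c2(1)]) (use c1(2) c2(2) i1(2) i2(2) in auto)
  hence "eventually (\<lambda>w. remove_sings (\<lambda>z. inverse (v1 z)) w = remove_sings (\<lambda>z. inverse (v2 z)) w) (at z0)"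
    by (simp add: eventually_nhds_conv_at)
  thus ?thesis using i1(3) i2(3) by eventually_elim simp
qed

section \<open>The general solution from one meromorphic solution\<close>

text \<open>If the values avoided a disc around \<open>a\<close>, the function \<open>1/(U - a)\<close>
  would be bounded and entire, hence constant.\<close>

lemma meromorphic_range_dense:
  assumes U: "U nicely_meromorphic_on UNIV" "\<not> U constant_on UNIV" and W: "open W" "W \<noteq> {}"
  shows "\<exists>z. \<not> is_pole U z \<and> U z \<in> W"
proof (rule ccontr)
  assume no: "\<not> ?thesis"
  obtain a where "a \<in> W" using W by blast
  then obtain \<epsilon> where \<epsilon>: "\<epsilon> > 0" "ball a \<epsilon> \<subseteq> W" using W openE by blast
  have far: "norm (U z - a) \<ge> \<epsilon>" if "\<not> is_pole U z" for z
    using no that \<epsilon> by (force simp: dist_norm norm_minus_commute)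
  define h where "h = (\<lambda>z. inverse (U z - a))"
  have Um: "U meromorphic_on UNIV" using U by (simp add: nicely_meromorphic_on_def)
  have hm: "h meromorphic_on UNIV" unfolding h_def by (intro meromorphic_intros Um)
  define g where "g = remove_sings h"
  have g: "g nicely_meromorphic_on UNIV" unfolding g_def by (rule remove_sings_nicely_meromorphic[OF hm])
  have ge: "eventually (\<lambda>w. g w = h w \<and> norm (g w) \<le> 1 / \<epsilon>) (at z)" for z
  proof -
    have "isolated_singularity_at h z" using hm by (auto simp: meromorphic_on_altdef)
    from eventually_remove_sings_eq_at[OF this] eventually_analytic_at[OF U(1), of z]
    show ?thesis unfolding g_def
    proof eventually_elim
      case (elim w)
      thus ?case using far[of w] \<epsilon>(1) by (simp add: h_def norm_inverse inverse_eq_divide norm_divide frac_le)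
    qed
  qed
  have np: "\<not> is_pole g z" for z
  proof
    assume "is_pole g z"
    hence "eventually (\<lambda>w. norm (g w) \<ge> 1 / \<epsilon> + 1) (at z)"
      unfolding is_pole_def filterlim_at_infinity[OF order.refl] using \<epsilon>(1) 
      by (metis add_pos_pos divide_pos_pos zero_less_one)
    hence "eventually (\<lambda>w. False) (at z)" using ge[of z] by eventually_elim linarith
    thus False by simp
  qed
  have ga: "g analytic_on {z}" for z using nicely_meromorphic_on_imp_analytic_at[OF g _ np] by simp
  have bd: "norm (g z) \<le> 1 / \<epsilon>" for z
  proof (rule tendsto_upperbound)
    show "((\<lambda>w. norm (g w)) \<longlongrightarrow> norm (g z)) (at z)"
      using analytic_at_imp_isCont[OF ga[of z]] by (intro tendsto_norm) (simp add: isCont_def)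
    show "eventually (\<lambda>w. norm (g w) \<le> 1 / \<epsilon>) (at z)" using ge[of z] by eventually_elim blast
  qed auto
  have "g holomorphic_on UNIV" using ga analytic_imp_holomorphic analytic_on_analytic_at by blast
  moreover have "bounded (range g)" using bd by (auto simp: bounded_iff)
  ultimately obtain c where c: "\<And>z. g z = c" using Liouville_theorem unfolding constant_on_def by blast
  have "eventually (\<lambda>w. U w = a + inverse c) (at 0)" using ge[of 0]
    by eventually_elim (use c in \<open>auto simp: h_def\<close>)
  from nicely_meromorphic_eqI[OF U(1) nicely_meromorphic_on_const this]
  show False using U(2) by (auto simp: constant_on_def)
qed

lemma nonconst_second_order:
  assumes "u \<in> nonconst_meromorphic_solutions (first_order_ode Q)" "\<not> is_pole u z"
  shows "deriv (deriv u) z = poly (pderiv Q) (u z) / 2"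
proof -
  have n: "u nicely_meromorphic_on UNIV" and nc: "\<not> u constant_on UNIV"
    and eq: "\<And>z. \<not> is_pole u z \<Longrightarrow> deriv u z ^ 2 = poly Q (u z)"
    using assms by (auto simp: nonconst_meromorphic_solutions_def meromorphic_solution_def satisfies_first_order)
  have "u analytic_on {z}" using nicely_meromorphic_on_imp_analytic_at[OF n _ assms(2)] by simp
  then obtain r where r: "r > 0" "u holomorphic_on ball z r" by (auto simp: analytic_on_def)
  show ?thesis
  proof (rule first_order_imp_second_order[of "ball z r"])
    show "\<not> u constant_on ball z r"
      using constant_on_extend_nicely_meromorphic_on[OF n, of "ball z r"] nc r by auto
    fix w assume "w \<in> ball z r"
    hence "u analytic_on {w}" using r by (meson analytic_at open_ball)
    thus "deriv u w ^ 2 = poly Q (u w)" using eq analytic_at_imp_no_pole by blast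
  qed (use r in auto)
qed

text \<open>The values of a local solution \<open>u\<close> on its domain form an open set, which the dense
  range of \<open>U\<close> meets: \<open>u(z_1) = U(z_2)\<close>. Both derivatives there are
  square roots of the same number, so \<open>u\<close> agrees with \<open>U\<close> up to the
  translation taking \<open>z_1\<close> to \<open>z_2\<close>, after a reflection if the signs
  differ.\<close>

lemma general_solutionI:
  assumes U: "U \<in> nonconst_meromorphic_solutions (first_order_ode Q)"
    and F: "F \<subseteq> nonconst_meromorphic_solutions (first_order_ode Q)"
    and trans: "\<And>c. (\<lambda>z. U (z + c)) \<in> F" "\<And>c. (\<lambda>z. U (- z + c)) \<in> F"
  shows "general_solution (first_order_ode Q) F"
  unfolding general_solution_def
proof (intro conjI allI impI)
  show "F \<noteq> {}" using trans by blast
  show "F \<subseteq> nonconst_meromorphic_solutions (first_order_ode Q)" by fact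
  fix S u
  assume "open S \<and> connected S \<and> u holomorphic_on S \<and> \<not> u constant_on S \<and>
           (\<forall>z\<in>S. satisfies_at (first_order_ode Q) u z)"
  hence S: "open S" "connected S" and u: "u holomorphic_on S" "\<not> u constant_on S"
    and eq: "\<And>z. z \<in> S \<Longrightarrow> deriv u z ^ 2 = poly Q (u z)"
    by (auto simp: satisfies_first_order)
  have Un: "U nicely_meromorphic_on UNIV" "\<not> U constant_on UNIV"
    and Ueq: "\<And>z. \<not> is_pole U z \<Longrightarrow> deriv U z ^ 2 = poly Q (U z)"
    using U by (auto simp: nonconst_meromorphic_solutions_def meromorphic_solution_def satisfies_first_order)
  have "open (u ` S)" using open_mapping_thm3 open_mapping_thm u S by blast
  moreover have "S \<noteq> {}" using u by (auto simp: constant_on_def)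
  ultimately obtain z2 where z2: "\<not> is_pole U z2" "U z2 \<in> u ` S"
    using meromorphic_range_dense[OF Un, of "u ` S"] by auto
  then obtain z1 where z1: "z1 \<in> S" "U z2 = u z1" by auto
  \<comment> \<open>The sign \<open>a\<close> decides between translation and reflection.\<close>
  have "deriv U z2 ^ 2 = deriv u z1 ^ 2" using Ueq[OF z2(1)] eq[OF z1(1)] z1(2) by simp
  then obtain a :: complex where a: "a^2 = 1" "a = 1 \<or> a = -1" "a * deriv U z2 = deriv u z1"
    by (force simp: power2_eq_iff)
  define V where "V = (\<lambda>z. U (a * z + (z2 - a * z1)))"
  have VF: "V \<in> F" using a(2) trans(1)[of "z2 - z1"] trans(2)[of "z2 + z1"] unfolding V_def by fastforce
  have V: "V \<in> nonconst_meromorphic_solutions (first_order_ode Q)" using VF F by blast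
  hence Vn: "V nicely_meromorphic_on UNIV"
    by (simp add: nonconst_meromorphic_solutions_def meromorphic_solution_def)
  have "a \<noteq> 0" using a by auto
  hence Vnp: "\<not> is_pole V z1" using z2(1) unfolding V_def by (subst is_pole_affine_iff) auto
  hence Va: "V analytic_on {z1}" using nicely_meromorphic_on_imp_analytic_at[OF Vn] by simp
  have "U analytic_on {z2}" using nicely_meromorphic_on_imp_analytic_at[OF Un(1) _ z2(1)] by simp
  hence dV: "deriv V z1 = deriv u z1" unfolding V_def
    using a(3) by (subst deriv_compose_linear') (auto intro: analytic_on_imp_differentiable_at)
  have ua: "u analytic_on {w}" if "w \<in> S" for w using that u S analytic_at by blast
  have "eventually (\<lambda>w. u w = V w) (nhds z1)"
  proof (rule second_order_unique)
    show "u analytic_on {z1}" "V analytic_on {z1}" using ua z1 Va by auto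
    show "u z1 = V z1" "deriv u z1 = deriv V z1" using z1 dV by (auto simp: V_def)
    have "eventually (\<lambda>w. w \<in> S) (nhds z1)" using z1 S by (simp add: eventually_nhds_in_open)
    thus "eventually (\<lambda>w. deriv (deriv u) w = poly (smult (1/2) (pderiv Q)) (u w)) (nhds z1)"
      by eventually_elim (use first_order_imp_second_order[OF S u eq] in auto)
    have "eventually (\<lambda>w. \<not> is_pole V w) (nhds z1)"
      using eventually_analytic_at[OF Vn, of z1] Vnp by (auto simp: eventually_nhds_conv_at elim: eventually_mono)
    thus "eventually (\<lambda>w. deriv (deriv V) w = poly (smult (1/2) (pderiv Q)) (V w)) (nhds z1)"
      by eventually_elim (use nonconst_second_order[OF V] in auto)
  qed
  hence fr: "eventually (\<lambda>w. u w = V w) (at z1)" by (simp add: eventually_nhds_conv_at)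
  have un: "u nicely_meromorphic_on S"
    using u S by (intro analytic_on_imp_nicely_meromorphic_on) (simp add: analytic_on_open)
  have "u z = V z" "is_pole u z = is_pole V z" if "z \<in> S" for z
    using nicely_meromorphic_identity[OF un nicely_meromorphic_on_subset[OF Vn] S z1(1) fr that] by auto
  moreover have "\<not> is_pole u z" if "z \<in> S" for z using ua[OF that] analytic_at_imp_no_pole by blast
  ultimately show "\<exists>V\<in>F. \<forall>z\<in>S. \<not> is_pole V z \<and> u z = V z" using VF by blast
qed

text \<open>A formula is a relation \<open>R\<close> between \<open>z\<close> and \<open>u\<close> that may
  be void or ambiguous at isolated points, such as poles or lattice points. It is enough that it
  holds off the poles and determines \<open>u\<close> in punctured neighbourhoods; the identity
  theorem does the rest.\<close>

lemma given_by_formula: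
  assumes f: "f meromorphic_on UNIV"
    and holds: "\<And>z. \<not> is_pole f z \<Longrightarrow> R z (remove_sings f z)"
    and determines: "\<And>z. eventually (\<lambda>w. \<forall>u. R w u \<longrightarrow> u = f w) (at z)"
  shows "given_by R = range (\<lambda>c z. remove_sings f (z + c))"
proof -
  define U where "U = remove_sings f"
  have Un: "U nicely_meromorphic_on UNIV" unfolding U_def by (rule remove_sings_nicely_meromorphic[OF f])
  have iso: "isolated_singularity_at f z" for z using f by (auto simp: meromorphic_on_altdef)
  have pole: "is_pole U z \<longleftrightarrow> is_pole f z" for z unfolding U_def by (rule is_pole_remove_sings_iff[OF iso])
  have Ut: "(\<lambda>z. U (z + c)) nicely_meromorphic_on UNIV" for c
    using nicely_meromorphic_affine[OF Un, of 1 c] by simp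
  have pt: "is_pole (\<lambda>z. U (z + c)) z \<longleftrightarrow> is_pole U (z + c)" for c z
    using is_pole_affine_iff[of 1 U c z] by simp
  show ?thesis unfolding U_def[symmetric]
  proof safe
    fix v assume "v \<in> given_by R"
    then obtain z0 where v: "v nicely_meromorphic_on UNIV" "\<And>z. \<not> is_pole v z \<Longrightarrow> R (z - z0) (v z)"
      by (auto simp: given_by_def)
    have "eventually (\<lambda>w. U w = f w) (at (-z0))" 
      unfolding U_def by (rule eventually_remove_sings_eq_at[OF iso])
    with determines[of "-z0"] have "eventually (\<lambda>w. \<forall>u. R w u \<longrightarrow> u = U w) (at (-z0))"
      by eventually_elim auto
    hence "eventually (\<lambda>w. \<forall>u. R w u \<longrightarrow> u = U w) (filtermap (\<lambda>w. 1 * w + (- z0)) (at 0))"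
      by (subst filtermap_affine_at) simp_all
    hence "eventually (\<lambda>w. \<forall>u. R (w - z0) u \<longrightarrow> u = U (w - z0)) (at 0)"
      by (simp add: eventually_filtermap)
    hence "eventually (\<lambda>w. v w = U (w + (-z0))) (at 0)" using eventually_analytic_at[OF v(1), of 0]
      by eventually_elim (use v in auto)
    from nicely_meromorphic_eqI[OF v(1) Ut this]
    show "v \<in> range (\<lambda>c z. U (z + c))" by (rule range_eqI)
  next
    fix c
    show "(\<lambda>z. U (z + c)) \<in> given_by R"
      unfolding given_by_def
    proof (intro CollectI conjI exI[of _ "-c"] allI impI)
      fix z assume "\<not> is_pole (\<lambda>z. U (z + c)) z"
      thus "R (z - - c) (U (z + c))" using holds[of "z + c"] pole pt by (simp add: U_def)
    qed (rule Ut)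
  qed
qed

text \<open>The pole ensures that the solution is not constant.\<close>

lemma formula_solution:
  assumes f: "f meromorphic_on UNIV" and pole: "is_pole f p"
    and eq: "eventually (\<lambda>z. deriv f z ^ 2 = poly Q (f z)) (at z0)"
  shows "remove_sings f \<in> nonconst_meromorphic_solutions (first_order_ode Q)"
proof -
  define U where "U = remove_sings f"
  have Un: "U nicely_meromorphic_on UNIV" unfolding U_def by (rule remove_sings_nicely_meromorphic[OF f])
  have iso: "isolated_singularity_at f z" for z using f by (auto simp: meromorphic_on_altdef)
  have "eventually (\<lambda>w. U w = f w) (at z0)" 
      unfolding U_def by (rule eventually_remove_sings_eq_at[OF iso])
  from this eventually_at_imp_eventually_nhds[OF this] eq
  have "eventually (\<lambda>w. deriv U w ^ 2 = poly Q (U w)) (at z0)"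
  proof eventually_elim
    case (elim w)
    thus ?case using deriv_cong_ev[OF elim(2) refl] by simp
  qed
  hence "meromorphic_solution (first_order_ode Q) U" by (rule first_order_solutionI[OF Un])
  moreover have "is_pole U p" using pole is_pole_remove_sings_iff[OF iso] by (simp add: U_def)
  hence "\<not> U constant_on UNIV"
    using not_is_pole_const[of _ p] by (metis UNIV_I constant_on_def ext)
  ultimately show ?thesis by (simp add: nonconst_meromorphic_solutions_def U_def)
qed

text \<open>The reflections of an even solution are translates of it.\<close>

lemma general_solution_translates_even:
  assumes U: "U \<in> nonconst_meromorphic_solutions (first_order_ode Q)"
    and G: "given_by R = range (\<lambda>c z. U (z + c))" and even: "\<And>z. U (- z) = U z"
  shows "general_solution (first_order_ode Q) (given_by R)"
proof (rule general_solutionI[OF U])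
  show "given_by R \<subseteq> nonconst_meromorphic_solutions (first_order_ode Q)"
    unfolding G using nonconst_solution_affine[OF U, of 1] by auto
  fix c
  show "(\<lambda>z. U (z + c)) \<in> given_by R" unfolding G by blast
  have "U (- z + c) = U (z + (-c))" for z using even[of "-z + c"] by (simp add: algebra_simps)
  hence "(\<lambda>z. U (- z + c)) = (\<lambda>z. U (z + (-c)))" by blast
  thus "(\<lambda>z. U (- z + c)) \<in> given_by R" unfolding G by blast
qed

text \<open>When the solution is not even, its reflections are the translates of the solution with the other
  sign.\<close>

lemma general_solution_translates_signs:
  assumes U: "U \<in> nonconst_meromorphic_solutions (first_order_ode Q)"
    and G: "given_by (R 1) = range (\<lambda>c z. U (z + c))"
    and G': "given_by (R (-1)) = range (\<lambda>c z. V (z + c))" and odd: "\<And>z. V z = U (- z)"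
  shows "general_solution (first_order_ode Q) (\<Union>\<sigma>\<in>{1, - 1 :: complex}. given_by (R \<sigma>))"
proof (rule general_solutionI[OF U])
  show "(\<Union>\<sigma>\<in>{1, - 1}. given_by (R \<sigma>)) \<subseteq> nonconst_meromorphic_solutions (first_order_ode Q)"
    using nonconst_solution_affine[OF U, of 1] nonconst_solution_affine[OF U, of "-1" "- _"] by (auto simp: G G' odd)
  fix c
  show "(\<lambda>z. U (z + c)) \<in> (\<Union>\<sigma>\<in>{1, - 1}. given_by (R \<sigma>))" by (auto simp: G)
  have "(\<lambda>z. U (- z + c)) = (\<lambda>z. V (z + (-c)))" by (simp add: odd)
  thus "(\<lambda>z. U (- z + c)) \<in> (\<Union>\<sigma>\<in>{1, - 1}. given_by (R \<sigma>))" using G' by blast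
qed

section \<open>Growth of entire solutions\<close>

lemma second_derivative_at_max:
  fixes f f' :: "real \<Rightarrow> real"
  assumes d: "d > 0" and f: "\<And>t. \<bar>t\<bar> < d \<Longrightarrow> (f has_real_derivative f' t) (at t)"
    and f': "(f' has_real_derivative D) (at 0)" and max: "\<And>t. \<bar>t\<bar> < d \<Longrightarrow> f t \<le> f 0"
  shows "D \<le> 0"
proof (rule ccontr)
  assume "\<not> D \<le> 0"
  hence "D > 0" by simp
  have "f' 0 = 0" by (rule DERIV_local_max[OF f[of 0] d]) (use d max in auto)
  then obtain d' where d': "d' > 0" "\<And>h. 0 < h \<Longrightarrow> h < d' \<Longrightarrow> f' h > 0"
    using DERIV_pos_inc_right[OF f' \<open>D > 0\<close>] by auto
  define t where "t = min d d' / 2"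
  have t: "0 < t" "t < d" "t < d'" using d d'(1) by (auto simp: t_def)
  have "\<exists>\<xi>>0. \<xi> < t \<and> f t - f 0 = (t - 0) * f' \<xi>"
    by (rule MVT2) (use t f in auto)
  then obtain \<xi> where "0 < \<xi>" "\<xi> < t" "f t - f 0 = t * f' \<xi>" by auto
  hence "f t > f 0" using d'(2)[of \<xi>] t by (auto simp: algebra_simps)
  thus False using max[of t] t by auto
qed

lemma Re_along_line_deriv:
  assumes "(g has_field_derivative g') (at (z + of_real t * e))"
  shows "((\<lambda>t. Re (g (z + of_real t * e))) has_real_derivative Re (e * g')) (at t)"
proof -
  have "((\<lambda>t. z + of_real t * e) has_vector_derivative e) (at t)"
    by (auto intro!: derivative_eq_intros simp: has_vector_derivative_def scaleR_conv_of_real)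
  hence "((g \<circ> (\<lambda>t. z + of_real t * e)) has_vector_derivative e * g') (at t)"
    using assms by (intro field_vector_diff_chain_at) auto
  from bounded_linear.has_vector_derivative[OF bounded_linear_Re this]
  show ?thesis by (simp add: has_real_derivative_iff_has_vector_derivative o_def)
qed

text \<open>The weight vanishes on the boundary of the disc, so \<open>|w(z)| (R^2 - |z - a|^2)^2\<close>
  has an interior maximum \<open>z_0\<close>. With \<open>L = (log w)''(z_0)\<close> the
  hypothesis reads \<open>|L| \<ge> c |w(z_0)|\<close>. In a direction \<open>e\<close> with
  \<open>e^2 L = |L|\<close> the function \<open>log |w|\<close> has second derivative
  \<open>|L|\<close>, and the second derivative test bounds it by the contribution of the weight,
  \<open>12 R^2 / \<rho>^2\<close> with \<open>\<rho> = R^2 - |z_0 - a|^2\<close>. Multiplying by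
  \<open>\<rho>^2\<close> gives a bound for the maximum, hence for the value at the centre. The
  exponent 2 of the weight is what cancels \<open>\<rho>^2\<close> here.\<close>

lemma entire_growth_bound:
  assumes hol: "w holomorphic_on UNIV" and c: "c > 0" and K: "K > 0" and R: "R > 0"
    and growth: "\<And>z. norm (w z) \<ge> K \<Longrightarrow>
      norm (w z * deriv (deriv w) z - deriv w z ^ 2) \<ge> c * norm (w z) ^ 3"
    and big: "norm (w a) > K"
  shows "norm (w a) * R^2 \<le> 12 / c"
proof -
  define \<phi> where "\<phi> = (\<lambda>z. norm (w z) * (R^2 - norm (z - a) ^ 2)^2)"
  have "continuous_on (cball a R) \<phi>" unfolding \<phi>_def
    using hol by (intro continuous_intros holomorphic_on_imp_continuous_on holomorphic_on_subset[OF hol]) auto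
  moreover have "cball a R \<noteq> {}" using R by simp
  ultimately obtain z0 where z0: "z0 \<in> cball a R" "\<And>z. z \<in> cball a R \<Longrightarrow> \<phi> z \<le> \<phi> z0"
    using continuous_attains_sup[of "cball a R" \<phi>] compact_cball by blast
  have \<phi>a: "\<phi> a = norm (w a) * R^4" by (simp add: \<phi>_def flip: power_mult)
  have "norm (w a) > 0" using big K by linarith
  hence "\<phi> a > 0" using \<phi>a R by simp
  moreover have "\<phi> a \<le> \<phi> z0" using R by (intro z0(2)) simp
  ultimately have pos: "\<phi> z0 > 0" by linarith
  define \<rho> where "\<rho> = R^2 - norm (z0 - a) ^ 2"
  have "\<rho> \<noteq> 0" "w z0 \<noteq> 0" using pos by (auto simp: \<phi>_def \<rho>_def)
  moreover have nz0: "norm (z0 - a) \<le> R" using z0(1) by (simp add: dist_norm norm_minus_commute)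
  hence "\<rho> \<ge> 0" using power_mono[OF nz0, of 2] by (simp add: \<rho>_def)
  ultimately have \<rho>: "\<rho> > 0" by simp
  have \<rho>R: "\<rho> \<le> R^2" by (simp add: \<rho>_def)
  have wa: "norm (w a) * R^4 \<le> norm (w z0) * \<rho>^2"
    using \<open>\<phi> a \<le> \<phi> z0\<close> \<phi>a by (simp add: \<phi>_def \<rho>_def)
  \<comment> \<open>The maximum is attained where \<open>w\<close> is large, because the weight is largest at the
    centre.\<close>
  have "norm (w z0) \<ge> K"
  proof (rule ccontr)
    assume "\<not> ?thesis"
    hence "norm (w z0) * \<rho>^2 \<le> K * (R^2)^2" using \<rho> \<rho>R K by (intro mult_mono power_mono) auto
    hence "norm (w a) * R^4 \<le> K * R^4" using wa by (simp flip: power_mult)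
    thus False using big R by simp
  qed
  note gr = growth[OF this]
  have "z0 \<in> ball a R" using \<rho> nz0 power_mono[of R "norm (z0 - a)" 2] R
    by (cases "norm (z0 - a) = R") (auto simp: \<rho>_def dist_norm norm_minus_commute)
  moreover have opw: "open {z. w z \<noteq> 0}"
    using open_Collect_neq[OF holomorphic_on_imp_continuous_on[OF hol] continuous_on_const] .
  ultimately have "open (ball a R \<inter> {z. w z \<noteq> 0})" "z0 \<in> ball a R \<inter> {z. w z \<noteq> 0}"
    using \<open>w z0 \<noteq> 0\<close> by auto
  then obtain r where r0: "r > 0" "ball z0 r \<subseteq> ball a R \<inter> {z. w z \<noteq> 0}"
    by (rule openE)
  hence r: "r > 0" "ball z0 r \<subseteq> ball a R" "\<And>z. z \<in> ball z0 r \<Longrightarrow> w z \<noteq> 0" by auto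
  have wB: "w holomorphic_on ball z0 r" by (rule holomorphic_on_subset[OF hol]) auto
  \<comment> \<open>A local logarithm of \<open>w\<close>.\<close>
  obtain g where g: "g holomorphic_on ball z0 r" "\<And>z. z \<in> ball z0 r \<Longrightarrow> exp (g z) = w z"
    using holomorphic_logarithm_exists[OF convex_ball open_ball wB r(3)] r(1) centre_in_ball by metis
  have dg: "deriv g holomorphic_on ball z0 r" using g by (intro holomorphic_deriv) auto
  have g1: "(g has_field_derivative deriv g z) (at z)" if "z \<in> ball z0 r" for z
    using holomorphic_derivI[OF g(1) open_ball that] .
  have g2: "(deriv g has_field_derivative deriv (deriv g) z) (at z)" if "z \<in> ball z0 r" for z
    using holomorphic_derivI[OF dg open_ball that] .
  have w1: "deriv w z = w z * deriv g z" if z: "z \<in> ball z0 r" for z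
  proof -
    have "((\<lambda>z. exp (g z)) has_field_derivative exp (g z) * deriv g z) (at z)"
      using g1[OF z] by (auto intro!: derivative_eq_intros)
    hence "(w has_field_derivative w z * deriv g z) (at z)"
      using g(2) z by (auto intro: has_field_derivative_transform_within_open[of _ _ z "ball z0 r"])
    thus ?thesis by (rule DERIV_imp_deriv)
  qed
  have z0B: "z0 \<in> ball z0 r" using r by simp
  have "(w has_field_derivative w z0 * deriv g z0) (at z0)"
    using holomorphic_derivI[OF hol open_UNIV UNIV_I] w1[OF z0B] by metis
  hence "((\<lambda>z. w z * deriv g z) has_field_derivative (w z0 * deriv g z0 * deriv g z0 + w z0 * deriv (deriv g) z0)) (at z0)"
    using g2[OF z0B] by (auto intro!: derivative_eq_intros)
  hence "(deriv w has_field_derivative (w z0 * deriv g z0 * deriv g z0 + w z0 * deriv (deriv g) z0)) (at z0)"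
    by (rule has_field_derivative_transform_within_open[OF _ open_ball z0B]) (use w1 in auto)
  hence w2: "deriv (deriv w) z0 = w z0 * deriv g z0 ^ 2 + w z0 * deriv (deriv g) z0"
    by (simp add: DERIV_imp_deriv power2_eq_square)
  define L where "L = deriv (deriv g) z0"
  have "w z0 * deriv (deriv w) z0 - deriv w z0 ^ 2 = w z0 ^ 2 * L"
    using w2 w1[OF z0B] by (simp add: L_def algebra_simps power2_eq_square)
  hence "c * norm (w z0) ^ 3 \<le> norm (w z0) ^ 2 * norm L"
    using gr by (simp add: norm_mult norm_power)
  hence "norm (w z0) ^ 2 * (c * norm (w z0)) \<le> norm (w z0) ^ 2 * norm L"
    by (simp add: power2_eq_square power3_eq_cube algebra_simps)
  hence Lge: "c * norm (w z0) \<le> norm L" using \<open>w z0 \<noteq> 0\<close> by simp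
  \<comment> \<open>The direction in which \<open>Re g\<close> is most convex.\<close>
  obtain e where e: "norm e = 1" "e^2 * L = of_real (norm L)"
  proof (cases "L = 0")
    case True thus ?thesis using that[of 1] by simp
  next
    case False
    define e where "e = csqrt (of_real (norm L) / L)"
    have e2: "e^2 = of_real (norm L) / L" by (simp add: e_def)
    hence "norm e ^ 2 = 1" using False by (simp flip: norm_power add: norm_divide)
    hence "norm e = 1" by (simp add: power2_eq_1_iff) (smt (verit) norm_ge_zero)
    thus ?thesis using that[of e] e2 False by simp
  qed
  define \<beta> where "\<beta> = Re (cnj e * (z0 - a))"
  have "\<bar>\<beta>\<bar> \<le> norm (cnj e * (z0 - a))" unfolding \<beta>_def by (rule abs_Re_le_cmod)
  hence "\<bar>\<beta>\<bar> \<le> R" using e nz0 by (simp add: norm_mult)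
  hence \<beta>: "\<beta>^2 \<le> R^2" using abs_le_square_iff[of \<beta> R] R by simp
  \<comment> \<open>The weight, before squaring, along the line through \<open>z_0\<close> in direction
    \<open>e\<close>.\<close>
  define q where "q = (\<lambda>t. \<rho> - 2 * \<beta> * t - t^2)"
  have q: "R^2 - norm (z0 + of_real t * e - a) ^ 2 = q t" for t
  proof -
    have "norm (z0 + of_real t * e - a) ^ 2 = norm (z0 - a)^2 + 2 * \<beta> * t + t^2 * norm e ^ 2"
      unfolding cmod_power2 \<beta>_def by (simp add: algebra_simps power2_eq_square)
    thus ?thesis using e(1) by (simp add: q_def \<rho>_def)
  qed
  have line: "z0 + of_real t * e \<in> ball z0 r" if "\<bar>t\<bar> < r" for t
    using that e(1) by (simp add: dist_norm norm_mult)
  have qpos: "q t > 0" if t: "\<bar>t\<bar> < r" for t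
  proof -
    have "z0 + of_real t * e \<in> ball a R" using line[OF t] r by blast
    hence "norm (z0 + of_real t * e - a) < R" by (simp add: dist_norm norm_minus_commute)
    hence "norm (z0 + of_real t * e - a) ^ 2 < R^2" by (intro power_strict_mono) auto
    thus ?thesis using q[of t] by simp
  qed
  \<comment> \<open>The logarithm of the weighted modulus along this line.\<close>
  define f where "f = (\<lambda>t. Re (g (z0 + of_real t * e)) + 2 * ln (q t))"
  define f' where "f' = (\<lambda>t. Re (e * deriv g (z0 + of_real t * e)) + 2 * ((- 2 * \<beta> - 2 * t) / q t))"
  have fexp: "exp (f t) = \<phi> (z0 + of_real t * e)" if t: "\<bar>t\<bar> < r" for t
  proof -
    have "exp (f t) = norm (w (z0 + of_real t * e)) * exp (ln (q t) * 2)"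
      unfolding f_def g(2)[OF line[OF t], symmetric] by (simp add: exp_add mult.commute)
    also have "exp (ln (q t) * 2) = q t ^ 2" using qpos[OF t] by (simp add: exp_double mult.commute[of _ 2])
    finally show ?thesis by (simp add: \<phi>_def q)
  qed
  have q': "(q has_real_derivative (- 2 * \<beta> - 2 * t)) (at t)" for t
    unfolding q_def by (auto intro!: derivative_eq_intros)
  have "Re (e * (e * L)) + 2 * (((- 2) * q 0 - (- 2 * \<beta>) * (- 2 * \<beta>)) / (q 0)^2) \<le> 0"
  proof (rule second_derivative_at_max[OF r(1)])
    fix t :: real assume t: "\<bar>t\<bar> < r"
    have "((\<lambda>t. ln (q t)) has_real_derivative ((- 2 * \<beta> - 2 * t) / q t)) (at t)"
      using q'[of t] qpos[OF t] by (auto intro!: derivative_eq_intros)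
    thus "(f has_real_derivative f' t) (at t)"
      unfolding f_def f'_def
      by (intro DERIV_add[OF Re_along_line_deriv[OF g1[OF line[OF t]]]] DERIV_cmult)
    have "\<phi> (z0 + of_real t * e) \<le> \<phi> z0"
      using line[OF t] r(2) by (intro z0(2)) auto
    hence "exp (f t) \<le> exp (f 0)" using fexp[OF t] fexp[of 0] r(1) by simp
    thus "f t \<le> f 0" by simp
  next
    have 1: "((\<lambda>t. Re (e * deriv g (z0 + of_real t * e))) has_real_derivative Re (e * (e * L))) (at 0)"
      using Re_along_line_deriv[of "\<lambda>z. e * deriv g z" "e * L" z0 0 e] DERIV_cmult[OF g2[OF z0B], of e]
      by (simp add: L_def)
    have 2: "((\<lambda>t. (- 2 * \<beta> - 2 * t) / q t) has_real_derivative
         ((- 2) * q 0 - (- 2 * \<beta>) * (- 2 * \<beta>)) / (q 0)^2) (at 0)"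
      using q'[of 0] qpos[of 0] r(1) by (auto intro!: derivative_eq_intros simp: power2_eq_square)
    show "(f' has_real_derivative Re (e * (e * L)) + 2 * (((- 2) * q 0 - (- 2 * \<beta>) * (- 2 * \<beta>)) / (q 0)^2)) (at 0)"
      unfolding f'_def by (intro DERIV_add[OF 1] DERIV_cmult[OF 2])
  qed
  moreover have "e * (e * L) = of_real (norm L)" using e(2) by (simp add: power2_eq_square mult_ac)
  hence "Re (e * (e * L)) = norm L" by (simp only: Re_complex_of_real)
  moreover have "q 0 = \<rho>" by (simp add: q_def)
  moreover have "2 * (((- 2) * \<rho> - (- 2 * \<beta>) * (- 2 * \<beta>)) / \<rho>^2) = - ((4 * \<rho> + 8 * \<beta>^2) / \<rho>^2)"
    using \<rho> by (simp add: field_simps power2_eq_square)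
  ultimately have "norm L \<le> (4 * \<rho> + 8 * \<beta>^2) / \<rho>^2"
    by (simp only:)
  also have "\<dots> \<le> (12 * R^2) / \<rho>^2"
    using \<rho>R \<beta> by (intro divide_right_mono) auto
  finally have "c * norm (w z0) \<le> 12 * R^2 / \<rho>^2" using Lge by linarith
  hence "norm (w z0) * \<rho>^2 \<le> 12 * R^2 / c" using \<rho> c by (simp add: field_simps)
  hence "norm (w a) * R^4 \<le> 12 * R^2 / c" using wa by linarith
  hence "R^2 * (norm (w a) * R^2) \<le> R^2 * (12 / c)" by (simp add: eval_nat_numeral mult_ac)
  thus ?thesis by (rule mult_left_le_imp_le) (use R in simp)
qed

lemma entire_growth_constant:
  assumes hol: "w holomorphic_on UNIV" and c: "c > 0" and K: "K > 0"
    and growth: "\<And>z. norm (w z) \<ge> K \<Longrightarrow>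
      norm (w z * deriv (deriv w) z - deriv w z ^ 2) \<ge> c * norm (w z) ^ 3"
  shows "w constant_on UNIV"
proof -
  have "norm (w a) \<le> K" for a
  proof (rule ccontr)
    assume "\<not> norm (w a) \<le> K"
    hence big: "norm (w a) > K" by simp
    hence wa: "norm (w a) > 0" using K by linarith
    \<comment> \<open>The hypothesis holds in the whole plane, so any \<open>R\<close> may be used; this one would
      give \<open>24 / c \<le> 12 / c\<close>.\<close>
    define R where "R = sqrt (24 / (c * norm (w a)))"
    have R: "R > 0" using c wa by (simp add: R_def)
    have R2: "R^2 = 24 / (c * norm (w a))" using c wa by (simp add: R_def)
    have "norm (w a) * R^2 \<le> 12 / c" by (rule entire_growth_bound[OF hol c K R growth big])
    thus False using c wa by (simp add: R2 field_simps)
  qed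
  hence "bounded (range w)" by (auto simp: bounded_iff)
  thus ?thesis using Liouville_theorem hol by blast
qed

lemma poly_cubic_lower_bound:
  fixes P :: "complex poly"
  assumes "degree P \<ge> 3"
  shows "\<exists>c>0. \<exists>K>0. \<forall>x. norm x \<ge> K \<longrightarrow> norm (poly P x) \<ge> c * norm x ^ 3"
proof -
  define l where "l = norm (lead_coeff P)"
  have l: "l > 0" using assms by (auto simp: l_def)
  have "(\<lambda>y. norm (poly (reflect_poly P) y)) \<midarrow>0\<rightarrow> norm (poly (reflect_poly P) 0)"
    using DERIV_isCont[OF poly_DERIV[of "reflect_poly P" 0]] by (intro tendsto_norm) (simp add: isCont_def)
  moreover have "norm (poly (reflect_poly P) 0) = l" by (simp add: l_def poly_0_coeff_0)
  ultimately have "eventually (\<lambda>y. norm (poly (reflect_poly P) y) > l / 2) (at 0)"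
    using l by (intro order_tendstoD) auto
  then obtain d where d: "d > 0" "\<And>y. y \<noteq> 0 \<Longrightarrow> norm y < d \<Longrightarrow> norm (poly (reflect_poly P) y) > l / 2"
    unfolding eventually_at by (auto simp: dist_norm)
  define K where "K = max 1 (2 / d)"
  have "norm (poly P x) \<ge> l / 2 * norm x ^ 3" if x: "norm x \<ge> K" for x
  proof -
    have x1: "norm x \<ge> 1" "norm x \<ge> 2 / d" using x by (auto simp: K_def)
    have nz: "x \<noteq> 0" using x1 by auto
    have "norm (inverse x) \<le> d / 2" using x1 d nz by (simp add: norm_inverse norm_divide field_simps)
    hence "norm (poly (reflect_poly P) (inverse x)) > l / 2" using d nz by (intro d(2)) auto
    moreover have "poly (reflect_poly P) (inverse x) = inverse x ^ degree P * poly P x"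
      using nz by (simp add: poly_reflect_poly_nz)
    ultimately have "l / 2 < norm (poly P x) / norm x ^ degree P"
      by (simp add: norm_mult norm_power norm_inverse norm_divide field_simps)
    hence "l / 2 * norm x ^ degree P \<le> norm (poly P x)" using nz by (simp add: field_simps)
    moreover have "l / 2 * norm x ^ 3 \<le> l / 2 * norm x ^ degree P"
      using l x1(1) assms by (intro mult_left_mono power_increasing) auto
    ultimately show ?thesis by linarith
  qed
  moreover have "K > 0" by (simp add: K_def)
  moreover have "l / 2 > 0" using l by simp
  ultimately show ?thesis by blast
qed

text \<open>By the equation, \<open>|w w'' - w'^2| = |P(w)|\<close>, which grows at least like
  \<open>|w|^3\<close>.\<close>

lemma entire_solution_constant:
  assumes hol: "w holomorphic_on UNIV" and P: "degree P \<ge> 3"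
    and eq: "\<And>z. w z * deriv (deriv w) z - deriv w z ^ 2 + poly P (w z) = 0"
  shows "w constant_on UNIV"
proof -
  obtain c K where "c > 0" "K > 0" and lb: "\<And>x. norm x \<ge> K \<Longrightarrow> norm (poly P x) \<ge> c * norm x ^ 3"
    using poly_cubic_lower_bound[OF P] by blast
  moreover have "norm (w z * deriv (deriv w) z - deriv w z ^ 2) = norm (poly P (w z))" for z
    using eq[of z] by (metis add_eq_0_iff norm_minus_cancel)
  ultimately show ?thesis by (intro entire_growth_constant[OF hol, of c K]) auto
qed

text \<open>A non-constant solution of \<open>y'^2 = Q(y)\<close> satisfies \<open>y'' = Q'(y)/2\<close> and
  hence also an equation \<open>y y'' - y'^2 + P(y) = 0\<close>. The leading coefficient of
  \<open>P = Q - x Q'/2\<close> is that of \<open>Q\<close> times \<open>1 - n/2\<close>, where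
  \<open>n\<close> is the degree; this is not 0 for \<open>n \<ge> 3\<close>.\<close>

lemma entire_first_order_constant:
  assumes hol: "y holomorphic_on UNIV" and Q: "degree Q \<ge> 3"
    and eq: "\<And>z. deriv y z ^ 2 = poly Q (y z)"
  shows "y constant_on UNIV"
proof (rule ccontr)
  assume nc: "\<not> y constant_on UNIV"
  define P where "P = Q - smult (1/2) (pCons 0 (pderiv Q))"
  have cP: "coeff P n = coeff Q n * (1 - of_nat n / 2)" for n
    by (cases n) (simp_all add: P_def coeff_pderiv field_simps)
  have "coeff P (degree Q) = lead_coeff Q * (1 - of_nat (degree Q) / 2)" using cP by simp
  moreover have "of_nat (degree Q) \<noteq> (of_nat 2 :: complex)" using Q
    unfolding of_nat_eq_iff by linarith
  moreover have "lead_coeff Q \<noteq> 0" using Q by auto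
  ultimately have "coeff P (degree Q) \<noteq> 0" by simp
  hence "degree P \<ge> 3" using le_degree[of P "degree Q"] Q by linarith
  have "y constant_on UNIV"
  proof (rule entire_solution_constant[OF hol \<open>degree P \<ge> 3\<close>])
    fix z
    have "deriv (deriv y) z = poly (pderiv Q) (y z) / 2"
      by (rule first_order_imp_second_order[OF open_UNIV connected_UNIV hol nc eq UNIV_I])
    thus "y z * deriv (deriv y) z - deriv y z ^ 2 + poly P (y z) = 0"
      by (simp add: P_def eq)
  qed
  thus False using nc by blast
qed

section \<open>Zeros and poles of solutions of the second order equation\<close>

lemma poly_degree_le_4:
  fixes P :: "'a :: comm_ring_1 poly"
  assumes "degree P \<le> 4"
  shows "poly P x = coeff P 0 + coeff P 1 * x + coeff P 2 * x^2 + coeff P 3 * x^3 + coeff P 4 * x^4"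
proof -
  have "poly P x = (\<Sum>i\<le>4. coeff P i * x ^ i)"
    unfolding poly_altdef by (rule sum.mono_neutral_left) (use assms in \<open>auto simp: coeff_eq_0\<close>)
  also have "{..4::nat} = {0,1,2,3,4}" by auto
  finally show ?thesis by (simp add: algebra_simps)
qed

text \<open>The equation says that the derivative of \<open>H = (F'/F)^2 - a_0/F^2 - 2 a_1/F + 2 a_3 F + a_4
  F^2\<close> is \<open>- 2 a_2 F'/F\<close>. The residue of a derivative is 0 and that of
  \<open>F'/F\<close> is the order of \<open>F\<close>.\<close>

lemma residue_obstruction_formal:
  fixes F :: "complex fls"
  assumes eq: "F * fls_deriv (fls_deriv F) - fls_deriv F ^ 2 + fls_const a0 + fls_const a1 * F
     + fls_const a2 * F^2 + fls_const a3 * F^3 + fls_const a4 * F^4 = 0"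
    and F: "fls_subdegree F \<noteq> 0"
  shows "a2 = 0"
proof -
  have Fnz: "F \<noteq> 0" using F by auto
  define I where "I = inverse F"
  have FI: "F * I = 1" using Fnz by (simp add: I_def)
  define d where "d = fls_deriv F"
  define dd where "dd = fls_deriv d"
  have "fls_deriv (F * I) = 0" using FI by simp
  hence "d * I + F * fls_deriv I = 0" by (simp add: d_def algebra_simps)
  hence "I * (d * I + F * fls_deriv I) = 0" by simp
  moreover have "I * (d * I + F * fls_deriv I) = d * I^2 + (F * I) * fls_deriv I"
    by (simp add: algebra_simps power2_eq_square)
  ultimately have "d * I^2 + fls_deriv I = 0" using FI by simp
  hence dI: "fls_deriv I = - d * I^2" by (simp add: eq_neg_iff_add_eq_0 add.commute)
  define H where "H = (d * I)^2 - fls_const a0 * I^2 - 2 * fls_const a1 * I + 2 * fls_const a3 * F + fls_const a4 * F^2"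
  \<comment> \<open>Numerals are constants of the ring of Laurent series.\<close>
  have c2: "fls_deriv (2 :: complex fls) = 0" by (metis fls_const_numeral fls_deriv_const)
  have "fls_deriv H = 2 * (d * I) * (dd * I + d * fls_deriv I) - fls_const a0 * (2 * I * fls_deriv I)
     - 2 * fls_const a1 * fls_deriv I + 2 * fls_const a3 * d + fls_const a4 * (2 * F * d)"
    unfolding H_def by (simp add: fls_deriv_mult power2_eq_square d_def[symmetric] dd_def[symmetric] c2 algebra_simps)
  also have "\<dots> = 2 * d * I^3 * (F * dd - d^2 + fls_const a0 + fls_const a1 * F + fls_const a3 * F^3 + fls_const a4 * F^4)"
  proof -
    have FI': "I = inverse F" by (simp add: I_def)
    show ?thesis unfolding dI unfolding FI' using Fnz by (simp add: field_simps power2_eq_square power3_eq_cube power4_eq_xxxx)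
  qed
  also have "F * dd - d^2 + fls_const a0 + fls_const a1 * F + fls_const a3 * F^3 + fls_const a4 * F^4 = - (fls_const a2 * F^2)"
    using eq unfolding d_def[symmetric] dd_def[symmetric] by (simp add: algebra_simps eq_neg_iff_add_eq_0)
  also have "2 * d * I^3 * - (fls_const a2 * F^2) = fls_const (- 2 * a2) * (d * I)"
    using Fnz by (simp add: I_def field_simps power2_eq_square power3_eq_cube fls_const_mult_const[symmetric] del: fls_const_mult_const)
  finally have "fls_residue (fls_const (- 2 * a2) * (d * I)) = 0" using fls_residue_deriv[of H] by metis
  moreover have "fls_residue (d * I) = of_int (fls_subdegree F)"
    unfolding d_def I_def using fls_residue_deriv_times_inverse_eq_subdegree by blast
  ultimately show ?thesis using F by simp
qed

lemma isolated_zeroI: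
  assumes "f nicely_meromorphic_on UNIV" "\<not> f constant_on UNIV" "f z = 0" "\<not> is_pole f z"
  shows "isolated_zero f z"
proof -
  have "f analytic_on {z}" using nicely_meromorphic_on_imp_analytic_at[OF assms(1) _ assms(4)] by simp
  moreover have "eventually (\<lambda>w. f w \<noteq> 0) (at z)"
  proof (rule ccontr)
    assume "\<not> ?thesis"
    hence "\<exists>\<^sub>F w in at z. f w = 0" by (simp add: frequently_def)
    from frequently_eq_meromorphic_imp_constant[OF this assms(1)] have "f w = 0" for w by auto
    thus False using assms(2) by (auto simp: constant_on_def)
  qed
  ultimately show ?thesis using assms(3) by (simp add: isolated_zero_analytic_iff)
qed

lemma quadratic_coefficient_vanishes:
  assumes mero: "f meromorphic_on {z0}" and sing: "is_pole f z0 \<or> isolated_zero f z0"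
    and P: "degree P \<le> 4"
    and eq: "eventually (\<lambda>z. f z * deriv (deriv f) z - deriv f z ^ 2 + poly P (f z) = 0) (at z0)"
  shows "coeff P 2 = 0"
proof -
  obtain F where F: "(\<lambda>w. f (z0 + w)) has_laurent_expansion F"
    using mero by (auto simp: meromorphic_on_def)
  have F1: "(\<lambda>w. deriv f (z0 + w)) has_laurent_expansion fls_deriv F"
    using has_laurent_expansion_deriv[OF F] by (simp add: deriv_shift[of f])
  have F2: "(\<lambda>w. deriv (deriv f) (z0 + w)) has_laurent_expansion fls_deriv (fls_deriv F)"
    using has_laurent_expansion_deriv[OF F1] by (simp add: deriv_shift[of "deriv f"])
  let ?g = "\<lambda>w. f (z0 + w) * deriv (deriv f) (z0 + w) - deriv f (z0 + w) ^ 2 + coeff P 0 + coeff P 1 * f (z0 + w)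
     + coeff P 2 * f (z0 + w) ^ 2 + coeff P 3 * f (z0 + w) ^ 3 + coeff P 4 * f (z0 + w) ^ 4"
  have "?g has_laurent_expansion (F * fls_deriv (fls_deriv F) - fls_deriv F ^ 2 + fls_const (coeff P 0)
      + fls_const (coeff P 1) * F + fls_const (coeff P 2) * F^2 + fls_const (coeff P 3) * F^3 + fls_const (coeff P 4) * F^4)"
    (is "_ has_laurent_expansion ?G")
    by (intro laurent_expansion_intros F F1 F2)
  moreover have "eventually (\<lambda>w. ?g w = 0) (at 0)"
    using eq unfolding at_to_0[of z0] eventually_filtermap poly_degree_le_4[OF P]
    by eventually_elim (simp add: add_ac)
  hence "?g has_laurent_expansion 0 \<longleftrightarrow> (\<lambda>_. 0) has_laurent_expansion 0"
    by (intro has_laurent_expansion_cong) auto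
  hence "?g has_laurent_expansion 0" by simp
  ultimately have "?G = 0" using has_laurent_expansion_unique by blast
  moreover have "fls_subdegree F \<noteq> 0"
    using sing is_pole_fls_subdegree_iff[OF F] isolated_zero_fls_subdegree_iff[OF F] by linarith
  ultimately show ?thesis by (rule residue_obstruction_formal)
qed

lemma meromorphic_solution_E:
  "meromorphic_solution (eq_E P) w \<longleftrightarrow> w nicely_meromorphic_on UNIV \<and>
    (\<forall>z. \<not> is_pole w z \<longrightarrow> w z * deriv (deriv w) z - deriv w z ^ 2 + poly P (w z) = 0)"
  by (simp add: meromorphic_solution_def satisfies_at_def eq_E_def)

text \<open>The expression \<open>w w'' - w'^2\<close> is \<open>w^2 (log w)''\<close>, and \<open>log (1/w)
  = - log w\<close>.\<close>

lemma reciprocal_wronskian: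
  assumes an: "w analytic_on {z}" and nz: "w z \<noteq> 0" and ev: "eventually (\<lambda>x. s x = inverse (w x)) (nhds z)"
  shows "s z * deriv (deriv s) z - deriv s z ^ 2 = - (w z * deriv (deriv w) z - deriv w z ^ 2) * s z ^ 4"
proof -
  have D: "(f has_field_derivative deriv f z) (at z)" if "f analytic_on {z}" for f z
    using that analytic_on_imp_differentiable_at DERIV_deriv_iff_field_differentiable by blast
  obtain S where S: "open S" "z \<in> S" "w holomorphic_on S" using an by (auto simp: analytic_at)
  have "isCont w z" using an by (rule analytic_at_imp_isCont)
  hence "eventually (\<lambda>x. w x \<noteq> 0) (nhds z)"
    using nz tendsto_imp_eventually_ne[of w "w z" "nhds z" 0] by (simp add: continuous_at tendsto_at_iff_tendsto_nhds)
  moreover have "eventually (\<lambda>x. x \<in> S) (nhds z)" using S by (simp add: eventually_nhds_in_open)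
  moreover have "eventually (\<lambda>x. eventually (\<lambda>x. s x = inverse (w x)) (nhds x)) (nhds z)"
    using ev by (simp add: eventually_eventually)
  ultimately have d: "eventually (\<lambda>x. deriv s x = - (deriv w x * inverse (w x) ^ 2)) (nhds z)"
  proof eventually_elim
    case (elim x)
    have "w analytic_on {x}" using S elim by (auto simp: analytic_at)
    hence "((\<lambda>x. inverse (w x)) has_field_derivative - (deriv w x * inverse (w x) ^ 2)) (at x)"
      using D[of w x] elim by (auto intro!: derivative_eq_intros simp: power2_eq_square)
    thus ?case using deriv_cong_ev[OF elim(3) refl] by (simp add: DERIV_imp_deriv)
  qed
  have "((\<lambda>x. - (deriv w x * inverse (w x) ^ 2)) has_field_derivative
      - (deriv (deriv w) z * inverse (w z) ^ 2 - 2 * deriv w z ^ 2 * inverse (w z) ^ 3)) (at z)"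
    using D[of w z] D[of "deriv w" z] an nz analytic_deriv[OF an]
    by (auto intro!: derivative_eq_intros simp: algebra_simps eval_nat_numeral)
  hence dd: "deriv (deriv s) z = - (deriv (deriv w) z * inverse (w z) ^ 2 - 2 * deriv w z ^ 2 * inverse (w z) ^ 3)"
    using deriv_cong_ev[OF d refl] by (simp add: DERIV_imp_deriv)
  show ?thesis
    unfolding eventually_nhds_x_imp_x[OF ev] dd eventually_nhds_x_imp_x[OF d] using nz
    by (simp add: field_simps eval_nat_numeral)
qed

text \<open>With \<open>s = 1/w\<close> and a polynomial of degree \<open>k > 4\<close> the equation turns
  into \<open>s^{k-4} (s s'' - s'^2) = a_k + a_{k-1} s + ...\<close>. At the pole \<open>s\<close>
  is 0, so the leading coefficient \<open>a_k\<close> would vanish.\<close>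

lemma eq_E_pole_degree:
  assumes w: "meromorphic_solution (eq_E P) w" and pole: "is_pole w z0"
  shows "degree P \<le> 4"
proof (rule ccontr)
  assume "\<not> degree P \<le> 4"
  \<comment> \<open>Here \<open>Suc k\<close> is the positive excess of the degree over 4.\<close>
  then obtain k where k: "degree P = Suc k + 4" by (metis add.commute less_imp_Suc_add not_le add_Suc_right)
  have n: "w nicely_meromorphic_on UNIV"
    and eq: "\<And>z. \<not> is_pole w z \<Longrightarrow> w z * deriv (deriv w) z - deriv w z ^ 2 + poly P (w z) = 0"
    using w by (auto simp: meromorphic_solution_E)
  have m: "w meromorphic_on {z0}" using n by (auto simp: nicely_meromorphic_on_def intro: meromorphic_on_subset)
  define s where "s = remove_sings (\<lambda>z. inverse (w z))"
  note inv = inverse_at_pole[OF m pole, folded s_def]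
  define h where "h = (\<lambda>z. s z ^ Suc k * (s z * deriv (deriv s) z - deriv s z ^ 2) - poly (reflect_poly P) (s z))"
  have "h z0 = 0"
  proof (rule analytic_eventually_zero_imp_zero[of h])
    show "h analytic_on {z0}" unfolding h_def using inv(1) by (intro analytic_intros)
    from inv(3) eventually_at_imp_eventually_nhds[OF inv(3)] eventually_analytic_at[OF n, of z0]
    show "eventually (\<lambda>z. h z = 0) (at z0)"
    proof eventually_elim
      case (elim z)
      have "eventually (\<lambda>x. s x = inverse (w x)) (nhds z)" using elim(2) by eventually_elim simp
      hence "s z * deriv (deriv s) z - deriv s z ^ 2 = - (w z * deriv (deriv w) z - deriv w z ^ 2) * s z ^ 4"
        using elim by (intro reciprocal_wronskian) auto
      also have "- (w z * deriv (deriv w) z - deriv w z ^ 2) = poly P (w z)"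
        using eq[of z] elim(3) by (simp add: add_eq_0_iff)
      finally have "h z = s z ^ Suc k * (poly P (w z) * s z ^ 4) - poly (reflect_poly P) (s z)" by (simp add: h_def)
      moreover have "poly (reflect_poly P) (s z) = s z ^ (Suc k + 4) * poly P (w z)"
        using elim(1) k by (simp add: poly_reflect_poly_nz)
      ultimately show "h z = 0" unfolding power_add
        by (simp only: mult.assoc mult.commute[of "poly P (w z)"] diff_self)
    qed
  qed
  hence "poly (reflect_poly P) 0 = 0" using inv(2) by (simp add: h_def)
  hence "P = 0" by (simp add: poly_0_coeff_0)
  thus False using k by simp
qed

lemma no_poles_imp_entire:
  assumes "u nicely_meromorphic_on UNIV" "\<And>z. \<not> is_pole u z"
  shows "u holomorphic_on UNIV"
  using nicely_meromorphic_without_singularities[OF assms(1)] assms(2) analytic_imp_holomorphic by blast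

lemma eq_E_has_pole:
  assumes w: "w \<in> nonconst_meromorphic_solutions (eq_E P)" and P: "degree P \<ge> 3"
  shows "\<exists>z. is_pole w z"
proof (rule ccontr)
  assume no: "\<nexists>z. is_pole w z"
  have "w holomorphic_on UNIV" using w no
    by (intro no_poles_imp_entire) (auto simp: nonconst_meromorphic_solutions_def meromorphic_solution_E)
  hence "w constant_on UNIV" using w no P
    by (intro entire_solution_constant[of w P])
       (auto simp: nonconst_meromorphic_solutions_def meromorphic_solution_E)
  thus False using w by (simp add: nonconst_meromorphic_solutions_def)
qed

lemma eq_E_quadratic_coefficient:
  assumes w: "w \<in> nonconst_meromorphic_solutions (eq_E P)" and P: "degree P \<le> 4"
    and z: "is_pole w z \<or> w z = 0"
  shows "coeff P 2 = 0"
proof -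
  have n: "w nicely_meromorphic_on UNIV" "\<not> w constant_on UNIV"
    and eq: "\<And>z. \<not> is_pole w z \<Longrightarrow> w z * deriv (deriv w) z - deriv w z ^ 2 + poly P (w z) = 0"
    using w by (auto simp: nonconst_meromorphic_solutions_def meromorphic_solution_E)
  show ?thesis
  proof (rule quadratic_coefficient_vanishes[of w z])
    show "w meromorphic_on {z}" using n by (auto simp: nicely_meromorphic_on_def intro: meromorphic_on_subset)
    show "is_pole w z \<or> isolated_zero w z" using isolated_zeroI[OF n, of z] z by blast
    show "\<forall>\<^sub>F z in at z. w z * deriv (deriv w) z - (deriv w z)\<^sup>2 + poly P (w z) = 0"
      using eventually_analytic_at[OF n(1), of z] by eventually_elim (use eq in auto)
  qed fact
qed

section \<open>Quadratic polynomials\<close>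

text \<open>A zero of \<open>u\<close> would force \<open>a = 0\<close> by the residue argument. So
  \<open>u'/u\<close> is holomorphic, and the equation is \<open>(u'/u)' = - a\<close>.\<close>

lemma eq_E_monomial_solution:
  assumes S: "open S" "connected S" "u holomorphic_on S" "\<not> u constant_on S" and a: "a \<noteq> 0"
    and eq: "\<And>z. z \<in> S \<Longrightarrow> u z * deriv (deriv u) z - deriv u z ^ 2 + a * u z ^ 2 = 0"
  shows "\<exists>c1 c2. c1 \<noteq> 0 \<and> (\<forall>z\<in>S. u z = c1 * exp (- (a / 2) * z^2 + c2 * z))"
proof -
  have nz: "u z \<noteq> 0" if z: "z \<in> S" for z
  proof
    assume uz: "u z = 0"
    have ua: "u analytic_on {z}" using S z analytic_at by blast
    have un: "u nicely_meromorphic_on S"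
      using S by (intro analytic_on_imp_nicely_meromorphic_on) (simp add: analytic_on_open)
    have "eventually (\<lambda>w. u w \<noteq> 0) (at z)"
    proof (rule ccontr)
      assume "\<not> ?thesis"
      hence "\<exists>\<^sub>F w in at z. u w = 0" by (simp add: frequently_def)
      from frequently_eq_meromorphic_imp_constant[OF this un S(1,2) z] have "u w = 0" if "w \<in> S" for w using that .
      thus False using S(4) by (auto simp: constant_on_def)
    qed
    hence iz: "isolated_zero u z" using ua uz by (simp add: isolated_zero_analytic_iff)
    have "eventually (\<lambda>w. w \<in> S) (at z)" using S z by (simp add: eventually_at_in_open')
    hence "eventually (\<lambda>w. u w * deriv (deriv u) w - deriv u w ^ 2 + poly [:0, 0, a:] (u w) = 0) (at z)"
      by eventually_elim (use eq in \<open>simp add: power2_eq_square algebra_simps\<close>)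
    hence "coeff [:0, 0, a:] 2 = 0"
      using iz ua by (intro quadratic_coefficient_vanishes[of u z]) (auto simp: analytic_on_imp_meromorphic_on)
    thus False using a by (simp add: numeral_2_eq_2)
  qed
  have du: "deriv u holomorphic_on S" using S by (intro holomorphic_deriv)
  have u1: "(u has_field_derivative deriv u z) (at z)" if "z \<in> S" for z
    using S that holomorphic_derivI by blast
  have u2: "(deriv u has_field_derivative deriv (deriv u) z) (at z)" if "z \<in> S" for z
    using S du that holomorphic_derivI by blast
  have "(\<lambda>z. deriv u z / u z + a * z) constant_on S"
  proof (rule has_field_derivative_0_imp_constant_on)
    fix z assume z: "z \<in> S"
    have "((\<lambda>z. deriv u z / u z + a * z) has_field_derivative
       (deriv (deriv u) z * u z - deriv u z * deriv u z) / (u z * u z) + a) (at z)"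
      using u1[OF z] u2[OF z] nz[OF z] by (auto intro!: derivative_eq_intros)
    also have "(deriv (deriv u) z * u z - deriv u z * deriv u z) / (u z * u z) + a = 0"
      using eq[OF z] nz[OF z] by (simp add: field_simps power2_eq_square)
    finally show "((\<lambda>z. deriv u z / u z + a * z) has_field_derivative 0) (at z)" .
  qed (use S in auto)
  then obtain c2 where "\<And>z. z \<in> S \<Longrightarrow> deriv u z / u z + a * z = c2" by (auto simp: constant_on_def)
  hence c2': "deriv u z / u z = c2 - a * z" if "z \<in> S" for z
    using that by (metis add_diff_cancel_right')
  have c2: "deriv u z = (c2 - a * z) * u z" if "z \<in> S" for z
    unfolding c2'[OF that, symmetric] using nz[OF that] by simp
  have "(\<lambda>z. u z * exp (a / 2 * z^2 - c2 * z)) constant_on S"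
  proof (rule has_field_derivative_0_imp_constant_on)
    fix z assume z: "z \<in> S"
    show "((\<lambda>z. u z * exp (a / 2 * z^2 - c2 * z)) has_field_derivative 0) (at z)"
      using u1[OF z] c2[OF z] by (auto intro!: derivative_eq_intros simp: algebra_simps)
  qed (use S in auto)
  then obtain c1 where c1: "\<And>z. z \<in> S \<Longrightarrow> u z * exp (a / 2 * z^2 - c2 * z) = c1" by (auto simp: constant_on_def)
  have form: "u z = c1 * exp (- (a / 2) * z^2 + c2 * z)" if "z \<in> S" for z
  proof -
    have "c1 * exp (- (a / 2) * z^2 + c2 * z) = u z * (exp (a / 2 * z^2 - c2 * z) * exp (- (a / 2) * z^2 + c2 * z))"
      unfolding c1[OF that, symmetric] by (simp only: mult.assoc)
    also have "exp (a / 2 * z^2 - c2 * z) * exp (- (a / 2) * z^2 + c2 * z) = 1"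
      unfolding exp_add[symmetric] by simp
    finally show ?thesis by simp
  qed
  moreover have "c1 \<noteq> 0"
  proof
    assume "c1 = 0"
    hence "u z = 0" if "z \<in> S" for z using form[OF that] by simp
    thus False using S(4) by (auto simp: constant_on_def)
  qed
  ultimately show ?thesis by blast
qed

lemma gaussian_solution:
  fixes a c1 c2 :: complex
  defines "w \<equiv> (\<lambda>z. c1 * exp (- (a / 2) * z^2 + c2 * z))"
  shows "w holomorphic_on UNIV"
    "w z * deriv (deriv w) z - deriv w z ^ 2 + a * w z ^ 2 = 0"
    "a \<noteq> 0 \<Longrightarrow> c1 \<noteq> 0 \<Longrightarrow> \<not> w constant_on UNIV"
proof -
  show "w holomorphic_on UNIV" unfolding w_def by (intro holomorphic_intros)
  have w1: "(w has_field_derivative (c2 - a * z) * w z) (at z)" for z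
    unfolding w_def by (auto intro!: derivative_eq_intros simp: algebra_simps)
  hence d1: "deriv w = (\<lambda>z. (c2 - a * z) * w z)" by (auto intro: DERIV_imp_deriv)
  have w2: "(deriv w has_field_derivative (- a * w z + (c2 - a * z) * ((c2 - a * z) * w z))) (at z)" for z
    unfolding d1 using w1[of z] by (auto intro!: derivative_eq_intros simp: algebra_simps)
  hence d2: "deriv (deriv w) z = - a * w z + (c2 - a * z) * ((c2 - a * z) * w z)" for z
    by (rule DERIV_imp_deriv)
  show "w z * deriv (deriv w) z - deriv w z ^ 2 + a * w z ^ 2 = 0"
    unfolding d2 by (simp add: d1 algebra_simps power2_eq_square)
  show "\<not> w constant_on UNIV" if "a \<noteq> 0" "c1 \<noteq> 0"
  proof
    assume "w constant_on UNIV"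
    then obtain c where "\<And>z. w z = c" by (auto simp: constant_on_def)
    hence "w = (\<lambda>_. c)" by (rule ext)
    \<comment> \<open>At this point \<open>w' = - w \<noteq> 0\<close>.\<close>
    hence "deriv w ((c2 + 1) / a) = 0" by simp
    moreover have "deriv w ((c2 + 1) / a) = - w ((c2 + 1) / a)" unfolding d1 using that by simp
    moreover have "w ((c2 + 1) / a) \<noteq> 0" using that by (simp add: w_def)
    ultimately show False by simp
  qed
qed

text \<open>Since \<open>a_2 \<noteq> 0\<close>, solutions have neither zeros nor poles. If
  \<open>a_0\<close> or \<open>a_1\<close> were not 0, then \<open>v = 1/w\<close> would be an
  entire solution of the equation with the reversed polynomial \<open>- (a_2 v^2 + a_1 v^3 + a_0
  v^4)\<close> of degree at least 3, hence constant.\<close>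

lemma eq_E_quadratic:
  assumes P: "degree P = 2" and ne: "nonconst_meromorphic_solutions (eq_E P) \<noteq> {}"
  shows "coeff P 0 = 0" "coeff P 1 = 0" 
    "nonconst_meromorphic_solutions (eq_E P) =
       {w. \<exists>c1 c2. c1 \<noteq> 0 \<and> w = (\<lambda>z. c1 * exp (- (coeff P 2 / 2) * z^2 + c2 * z))}"
    "general_solution (eq_E P) (nonconst_meromorphic_solutions (eq_E P))"
proof -
  define a where "a = coeff P 2"
  have a: "a \<noteq> 0" using P by (metis a_def degree_0 leading_coeff_0_iff zero_neq_numeral)
  have P4: "coeff P 3 = 0" "coeff P 4 = 0" using P by (simp_all add: coeff_eq_0)
  have ent: "w holomorphic_on UNIV \<and> (\<forall>z. w z \<noteq> 0 \<and> \<not> is_pole w z)" if "w \<in> nonconst_meromorphic_solutions (eq_E P)" for w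
  proof -
    have *: "w z \<noteq> 0" "\<not> is_pole w z" for z
      using eq_E_quadratic_coefficient[OF that, of z] P a by (auto simp: a_def)
    thus ?thesis using that
      by (auto intro!: no_poles_imp_entire simp: nonconst_meromorphic_solutions_def meromorphic_solution_E)
  qed
  obtain w where w: "w \<in> nonconst_meromorphic_solutions (eq_E P)" using ne by blast
  have wh: "w holomorphic_on UNIV" and wnz: "\<And>z. w z \<noteq> 0" and wnc: "\<not> w constant_on UNIV"
    and weq: "\<And>z. w z * deriv (deriv w) z - deriv w z ^ 2 + poly P (w z) = 0"
    using ent[OF w] w by (auto simp: nonconst_meromorphic_solutions_def meromorphic_solution_E)
  have P01: "coeff P 0 = 0 \<and> coeff P 1 = 0"
  proof (rule ccontr)
    assume no: "\<not> ?thesis"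
    define v where "v = (\<lambda>z. inverse (w z))"
    define V where "V = - [:0, 0, a, coeff P 1, coeff P 0:]"
    have vh: "v holomorphic_on UNIV" unfolding v_def using wh wnz by (intro holomorphic_intros) auto
    have "degree V \<ge> 3" using no by (auto simp: V_def)
    have "v constant_on UNIV"
    proof (rule entire_solution_constant[OF vh \<open>degree V \<ge> 3\<close>])
      fix z
      have wv: "w z * v z = 1" using wnz by (simp add: v_def)
      have "w analytic_on {z}" using wh analytic_at by blast
      hence "v z * deriv (deriv v) z - deriv v z ^ 2 = - (w z * deriv (deriv w) z - deriv w z ^ 2) * v z ^ 4"
        using wnz by (intro reciprocal_wronskian) (simp_all add: v_def)
      also have "- (w z * deriv (deriv w) z - deriv w z ^ 2) = poly P (w z)"
        using weq[of z] by (simp add: add_eq_0_iff)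
      also have "poly P (w z) = coeff P 0 + coeff P 1 * w z + a * w z ^ 2"
        using poly_degree_le_4[of P "w z"] P P4 by (simp add: a_def)
      also have "(coeff P 0 + coeff P 1 * w z + a * w z ^ 2) * v z ^ 4 =
         coeff P 0 * v z ^ 4 + coeff P 1 * v z ^ 3 * (w z * v z) + a * v z ^ 2 * (w z * v z) ^ 2"
        by (simp add: algebra_simps eval_nat_numeral)
      also have "\<dots> = - poly V (v z)" unfolding wv by (simp add: V_def algebra_simps eval_nat_numeral)
      finally show "v z * deriv (deriv v) z - (deriv v z)\<^sup>2 + poly V (v z) = 0" by simp
    qed
    then obtain c where "\<And>z. v z = c" by (auto simp: constant_on_def)
    hence "w z = inverse c" for z by (metis inverse_inverse_eq v_def)
    thus False using wnc by (auto simp: constant_on_def)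
  qed
  thus "coeff P 0 = 0" "coeff P 1 = 0" by auto
  have Pp: "poly P x = a * x ^ 2" for x
    using poly_degree_le_4[of P x] P P4 P01 by (simp add: a_def)
  show eqs: "nonconst_meromorphic_solutions (eq_E P) =
       {w. \<exists>c1 c2. c1 \<noteq> 0 \<and> w = (\<lambda>z. c1 * exp (- (coeff P 2 / 2) * z^2 + c2 * z))}"
  proof (intro set_eqI iffI)
    fix w assume w: "w \<in> nonconst_meromorphic_solutions (eq_E P)"
    have "\<exists>c1 c2. c1 \<noteq> 0 \<and> (\<forall>z\<in>UNIV. w z = c1 * exp (- (a / 2) * z^2 + c2 * z))"
      by (rule eq_E_monomial_solution)
         (use ent[OF w] w a in \<open>auto simp: nonconst_meromorphic_solutions_def meromorphic_solution_E Pp\<close>)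
    thus "w \<in> {w. \<exists>c1 c2. c1 \<noteq> 0 \<and> w = (\<lambda>z. c1 * exp (- (coeff P 2 / 2) * z^2 + c2 * z))}"
      by (auto simp: a_def fun_eq_iff)
  next
    fix w assume "w \<in> {w. \<exists>c1 c2. c1 \<noteq> 0 \<and> w = (\<lambda>z. c1 * exp (- (coeff P 2 / 2) * z^2 + c2 * z))}"
    then obtain c1 c2 where c: "c1 \<noteq> 0" "w = (\<lambda>z. c1 * exp (- (a / 2) * z^2 + c2 * z))" by (auto simp: a_def)
    note g = gaussian_solution[where a = a and ?c1.0 = c1 and ?c2.0 = c2, folded c(2)]
    have "w nicely_meromorphic_on UNIV"
      using g(1) by (intro analytic_on_imp_nicely_meromorphic_on) (simp add: analytic_on_open)
    moreover have "w z * deriv (deriv w) z - deriv w z ^ 2 + a * w z ^ 2 = 0" for z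
      using g(2)[of z] by (simp only: c(2))
    ultimately show "w \<in> nonconst_meromorphic_solutions (eq_E P)" using g(3)[OF a c(1)]
      by (simp add: nonconst_meromorphic_solutions_def meromorphic_solution_E Pp)
  qed
  show "general_solution (eq_E P) (nonconst_meromorphic_solutions (eq_E P))"
    unfolding general_solution_def
  proof (intro conjI allI impI)
    fix S u assume "open S \<and> connected S \<and> u holomorphic_on S \<and> \<not> u constant_on S \<and> (\<forall>z\<in>S. satisfies_at (eq_E P) u z)"
    hence "\<exists>c1 c2. c1 \<noteq> 0 \<and> (\<forall>z\<in>S. u z = c1 * exp (- (a / 2) * z^2 + c2 * z))"
      using a by (intro eq_E_monomial_solution) (auto simp: satisfies_at_def eq_E_def Pp)
    then obtain c1 c2 where c: "c1 \<noteq> 0" "\<And>z. z \<in> S \<Longrightarrow> u z = c1 * exp (- (a / 2) * z^2 + c2 * z)" by blast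
    define U where "U = (\<lambda>z. c1 * exp (- (a / 2) * z^2 + c2 * z))"
    have U: "U \<in> nonconst_meromorphic_solutions (eq_E P)" unfolding eqs U_def using c(1) by (auto simp: a_def)
    have "\<not> is_pole U z" for z using ent[OF U] by blast
    thus "\<exists>U\<in>nonconst_meromorphic_solutions (eq_E P). \<forall>z\<in>S. \<not> is_pole U z \<and> u z = U z"
      using U c(2) by (auto simp: U_def)
  qed (use ne in auto)
qed

section \<open>The first integral\<close>

definition first_integral_poly :: "complex poly \<Rightarrow> complex \<Rightarrow> complex poly" where
  "first_integral_poly P C = [:coeff P 0, 2 * coeff P 1, - 2 * C, - 2 * coeff P 3, - coeff P 4:]"

lemma first_integral_eq: "first_integral P C = first_order_ode (first_integral_poly P C)"
  by (simp add: first_integral_def first_order_ode_def first_integral_poly_def fun_eq_iff eval_nat_numeral algebra_simps)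

text \<open>The derivative of \<open>(w'^2 - a_0 - 2 a_1 w + 2 a_3 w^3 + a_4 w^4) / w^2\<close> is \<open>2
  w'/w^3\<close> times the left-hand side of the equation, provided that \<open>a_2 = 0\<close>.
  So this quotient is constant near any point that is neither zero nor pole, and the resulting
  first order equation extends to the plane.\<close>

lemma eq_E_imp_first_integral:
  assumes w: "meromorphic_solution (eq_E P) w" and P: "degree P \<le> 4" "coeff P 2 = 0"
  shows "\<exists>C. meromorphic_solution (first_integral P C) w"
proof -
  have n: "w nicely_meromorphic_on UNIV"
    and eq: "\<And>z. \<not> is_pole w z \<Longrightarrow> w z * deriv (deriv w) z - deriv w z ^ 2 + poly P (w z) = 0"
    using w by (auto simp: meromorphic_solution_E)
  have "eventually (\<lambda>z. w z = 0) (at 0) \<or> (\<exists>z. w z \<noteq> 0 \<and> \<not> is_pole w z)"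
    using eventually_analytic_at[OF n, of 0] by (metis (mono_tags, lifting) eventually_mono)
  thus ?thesis
  proof
    \<comment> \<open>Only the zero function is excluded from the quotient; if it is a solution then \<open>a_0 =
      0\<close>, and any \<open>C\<close> serves.\<close>
    assume ev: "eventually (\<lambda>z. w z = 0) (at 0)"
    hence "w = (\<lambda>_. 0)" by (rule nicely_meromorphic_eqI[OF n nicely_meromorphic_on_const])
    moreover from this have "coeff P 0 = 0" using eq[of 0] by (simp add: poly_0_coeff_0)
    ultimately show ?thesis
      using n by (intro exI[of _ 0]) (simp add: first_integral_eq meromorphic_solution_def satisfies_first_order first_integral_poly_def)
  next
    assume "\<exists>z. w z \<noteq> 0 \<and> \<not> is_pole w z"
    then obtain z1 where z1: "w z1 \<noteq> 0" "\<not> is_pole w z1" by blast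
    have "w analytic_on {z1}" using nicely_meromorphic_on_imp_analytic_at[OF n _ z1(2)] by simp
    then obtain r1 where r1: "r1 > 0" "w holomorphic_on ball z1 r1" by (auto simp: analytic_on_def)
    have "isCont w z1" using r1 holomorphic_on_imp_continuous_on continuous_on_eq_continuous_at
      by (metis centre_in_ball open_ball)
    hence "eventually (\<lambda>z. w z \<noteq> 0) (nhds z1)"
      using z1(1) tendsto_imp_eventually_ne[of w "w z1" "nhds z1" 0] by (simp add: continuous_at tendsto_at_iff_tendsto_nhds)
    then obtain r2 where r2: "r2 > 0" "\<And>z. dist z z1 < r2 \<Longrightarrow> w z \<noteq> 0"
      unfolding eventually_nhds_metric by blast
    define B where "B = ball z1 (min r1 r2)"
    have B: "open B" "connected B" "z1 \<in> B" "w holomorphic_on B" "\<And>z. z \<in> B \<Longrightarrow> w z \<noteq> 0"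
      using r1 r2 by (auto simp: B_def dist_commute intro: holomorphic_on_subset)
    have np: "\<not> is_pole w z" if "z \<in> B" for z
      using that B analytic_at analytic_at_imp_no_pole by blast
    have dw: "deriv w holomorphic_on B" using B by (intro holomorphic_deriv)
    define N where "N = (\<lambda>z. deriv w z ^ 2 - coeff P 0 - 2 * coeff P 1 * w z + 2 * coeff P 3 * w z ^ 3 + coeff P 4 * w z ^ 4)"
    have "(\<lambda>z. N z / w z ^ 2) constant_on B"
    proof (rule has_field_derivative_0_imp_constant_on)
      fix z assume z: "z \<in> B"
      have 1: "(w has_field_derivative deriv w z) (at z)" using B z holomorphic_derivI by blast
      have 2: "(deriv w has_field_derivative deriv (deriv w) z) (at z)" using B dw z holomorphic_derivI by blast
      have N: "(N has_field_derivative (2 * deriv w z * deriv (deriv w) z - 2 * coeff P 1 * deriv w z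
           + 6 * coeff P 3 * w z ^ 2 * deriv w z + 4 * coeff P 4 * w z ^ 3 * deriv w z)) (at z)"
        unfolding N_def by (rule derivative_eq_intros 1 2 refl)+ (simp add: algebra_simps)
      define x where "x = w z"
      define x' where "x' = deriv w z"
      define x'' where "x'' = deriv (deriv w) z"
      have "((\<lambda>z. N z / w z ^ 2) has_field_derivative
         ((2 * x' * x'' - 2 * coeff P 1 * x' + 6 * coeff P 3 * x ^ 2 * x' + 4 * coeff P 4 * x ^ 3 * x') * x^2
           - N z * (2 * x * x')) / (x^2 * x^2)) (at z)"
        using DERIV_divide[OF N DERIV_power[OF 1, of 2]] B(5)[OF z] unfolding x_def x'_def x''_def
        by (simp add: mult_ac)
      also have "(2 * x' * x'' - 2 * coeff P 1 * x' + 6 * coeff P 3 * x ^ 2 * x' + 4 * coeff P 4 * x ^ 3 * x') * x^2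
           - N z * (2 * x * x') =
         2 * x * x' * (x * x'' - x'^2 + (coeff P 0 + coeff P 1 * x + coeff P 2 * x^2 + coeff P 3 * x^3 + coeff P 4 * x^4))"
        using P(2) unfolding N_def x_def[symmetric] x'_def[symmetric]
        by (simp add: algebra_simps eval_nat_numeral)
      also have "\<dots> = 0" using eq[OF np[OF z]] poly_degree_le_4[OF P(1), of x] by (simp add: x_def x'_def x''_def)
      finally show "((\<lambda>z. N z / w z ^ 2) has_field_derivative 0) (at z)" by simp
    qed (use B in auto)
    then obtain C0 where C0: "\<And>z. z \<in> B \<Longrightarrow> N z / w z ^ 2 = C0" by (auto simp: constant_on_def)
    define C where "C = - C0 / 2"
    have "deriv w z ^ 2 = poly (first_integral_poly P C) (w z)" if z: "z \<in> B" for z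
    proof -
      have "N z = - 2 * C * w z ^ 2" using C0[OF z] B(5)[OF z] by (simp add: C_def field_simps)
      thus ?thesis by (simp add: N_def first_integral_poly_def algebra_simps eval_nat_numeral)
    qed
    moreover have "eventually (\<lambda>z. z \<in> B) (at z1)" using B by (simp add: eventually_at_in_open')
    ultimately have "eventually (\<lambda>z. deriv w z ^ 2 = poly (first_integral_poly P C) (w z)) (at z1)"
      by (auto elim: eventually_mono)
    from first_order_solutionI[OF n this] show ?thesis by (auto simp: first_integral_eq)
  qed
qed

lemma first_integral_imp_eq_E:
  assumes P: "degree P \<le> 4" "coeff P 2 = 0"
  shows "nonconst_meromorphic_solutions (first_integral P C) \<subseteq> nonconst_meromorphic_solutions (eq_E P)"
proof
  fix w assume w: "w \<in> nonconst_meromorphic_solutions (first_integral P C)"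
  have n: "w nicely_meromorphic_on UNIV" "\<not> w constant_on UNIV"
    and eq: "\<And>z. \<not> is_pole w z \<Longrightarrow> deriv w z ^ 2 = poly (first_integral_poly P C) (w z)"
    using w unfolding first_integral_eq
    by (auto simp: nonconst_meromorphic_solutions_def meromorphic_solution_def satisfies_first_order)
  have "w z * deriv (deriv w) z - deriv w z ^ 2 + poly P (w z) = 0" if np: "\<not> is_pole w z" for z
    unfolding eq[OF np] nonconst_second_order[OF w[unfolded first_integral_eq] np] poly_degree_le_4[OF P(1)]
    using P(2) by (simp add: first_integral_poly_def pderiv_pCons field_simps eval_nat_numeral)
  thus "w \<in> nonconst_meromorphic_solutions (eq_E P)"
    using n by (simp add: nonconst_meromorphic_solutions_def meromorphic_solution_E)
qed

section \<open>Lattices and Weierstrass functions\<close>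

lemma summable_int_powr: "(\<lambda>m::int. (1 + \<bar>real_of_int m\<bar>) powr (-3/2)) summable_on UNIV"
proof -
  have "summable (\<lambda>n. real n powr (-3/2))" by (simp add: summable_real_powr_iff)
  hence "summable (\<lambda>n. real (Suc n) powr (-3/2))" by (subst summable_Suc_iff)
  hence s1: "(\<lambda>n. real (Suc n) powr (-3/2)) summable_on UNIV"
    by (intro norm_summable_imp_summable_on) simp
  have "summable (\<lambda>n. real (Suc (Suc n)) powr (-3/2))"
    using \<open>summable (\<lambda>n. real (Suc n) powr (-3/2))\<close> by (subst (asm) summable_Suc_iff[symmetric])
  hence s2: "(\<lambda>n. real (Suc (Suc n)) powr (-3/2)) summable_on UNIV"
    by (intro norm_summable_imp_summable_on) simp
  have "(\<lambda>m::int. (1 + \<bar>real_of_int m\<bar>) powr (-3/2)) summable_on range int"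
    using s1 by (subst summable_on_reindex) (auto simp: o_def add.commute)
  moreover have "(\<lambda>m::int. (1 + \<bar>real_of_int m\<bar>) powr (-3/2)) summable_on range (\<lambda>n. - int n - 1)"
    using s2 by (subst summable_on_reindex) (auto simp: o_def inj_def add_ac)
  ultimately have "(\<lambda>m::int. (1 + \<bar>real_of_int m\<bar>) powr (-3/2)) summable_on (range int \<union> range (\<lambda>n. - int n - 1))"
    by (rule summable_on_union)
  also have "range int \<union> range (\<lambda>n. - int n - 1) = UNIV"
  proof (intro equalityI subsetI)
    fix m :: int
    show "m \<in> range int \<union> range (\<lambda>n. - int n - 1)"
    proof (cases "m \<ge> 0")
      case True thus ?thesis by (metis UnI1 nat_0_le rangeI)
    next
      case False
      hence "m = - int (nat (- m - 1)) - 1" by simp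
      thus ?thesis by blast
    qed
  qed auto
  finally show ?thesis .
qed

text \<open>Cramer's rule.\<close>

lemma real_coordinates:
  assumes D: "Im (cnj \<omega>1 * \<omega>2) \<noteq> 0"
  obtains x y where "z = of_real x * \<omega>1 + of_real y * \<omega>2"
proof -
  define D where "D = Im (cnj \<omega>1 * \<omega>2)"
  have D: "D \<noteq> 0" using assms by (simp add: D_def)
  define a b where "a = - Im (cnj \<omega>2 * z)" and "b = Im (cnj \<omega>1 * z)"
  have "of_real D * z = of_real a * \<omega>1 + of_real b * \<omega>2"
    by (simp add: complex_eq_iff D_def a_def b_def algebra_simps)
  hence "z = of_real (a / D) * \<omega>1 + of_real (b / D) * \<omega>2"
    using D by (simp add: field_simps)
  thus ?thesis by (rule that)
qed

locale complex_lattice =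
  fixes \<Lambda> :: "complex set"
  assumes lattice: "is_period_lattice \<Lambda>"
begin

lemma zero_in_lattice: "0 \<in> \<Lambda>"
  using lattice unfolding is_period_lattice_def period_lattice_def by (auto intro!: exI[of _ "0::int"])

lemma diff_in_lattice:
  assumes "x \<in> \<Lambda>" "y \<in> \<Lambda>" shows "x - y \<in> \<Lambda>"
proof -
  obtain \<omega>1 \<omega>2 where L: "\<Lambda> = period_lattice \<omega>1 \<omega>2" using lattice by (auto simp: is_period_lattice_def)
  obtain m n m' n' where "x = of_int m * \<omega>1 + of_int n * \<omega>2" "y = of_int m' * \<omega>1 + of_int n' * \<omega>2"
    using assms by (auto simp: L period_lattice_def)
  hence "x - y = of_int (m - m') * \<omega>1 + of_int (n - n') * \<omega>2" by (simp add: algebra_simps)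
  thus ?thesis unfolding L period_lattice_def by blast
qed

lemma uminus_in_lattice: "x \<in> \<Lambda> \<Longrightarrow> - x \<in> \<Lambda>"
  using diff_in_lattice[OF zero_in_lattice, of x] by simp

lemma uminus_in_lattice_iff [simp]: "- x \<in> \<Lambda> \<longleftrightarrow> x \<in> \<Lambda>"
  using uminus_in_lattice[of x] uminus_in_lattice[of "-x"] by auto

lemma add_in_lattice: "x \<in> \<Lambda> \<Longrightarrow> y \<in> \<Lambda> \<Longrightarrow> x + y \<in> \<Lambda>"
  using diff_in_lattice[of x "-y"] by simp

lemma add_lattice_iff: "p \<in> \<Lambda> \<Longrightarrow> z + p \<in> \<Lambda> \<longleftrightarrow> z \<in> \<Lambda>"
  using diff_in_lattice[of "z + p" p] add_in_lattice[of z p] by auto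

text \<open>In a lattice basis the coordinates are bounded by the norm: pairing \<open>m \<omega>_1 + n
  \<omega>_2\<close> with a generator by \<open>Im (cnj x * y)\<close> isolates one coordinate.\<close>

lemma lattice_coordinates:
  obtains \<omega>1 \<omega>2 c where "\<Lambda> = period_lattice \<omega>1 \<omega>2" "Im (cnj \<omega>1 * \<omega>2) \<noteq> 0" "c > 0"
    "\<And>m n. c * \<bar>real_of_int m\<bar> \<le> norm (of_int m * \<omega>1 + of_int n * \<omega>2)"
    "\<And>m n. c * \<bar>real_of_int n\<bar> \<le> norm (of_int m * \<omega>1 + of_int n * \<omega>2)"
proof -
  obtain \<omega>1 \<omega>2 where L: "\<Lambda> = period_lattice \<omega>1 \<omega>2" "Im (cnj \<omega>1 * \<omega>2) \<noteq> 0"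
    using lattice by (auto simp: is_period_lattice_def)
  define D where "D = Im (cnj \<omega>1 * \<omega>2)"
  have D: "D \<noteq> 0" using L by (simp add: D_def)
  have nz: "\<omega>1 \<noteq> 0" "\<omega>2 \<noteq> 0" using L by auto
  define M where "M = norm \<omega>1 + norm \<omega>2"
  have M: "M > 0" using nz by (simp add: M_def add_pos_pos)
  have 1: "\<bar>D\<bar> / M * \<bar>real_of_int n\<bar> \<le> norm (of_int m * \<omega>1 + of_int n * \<omega>2)" (is "_ \<le> norm ?w") for m n
  proof -
    have "Im (cnj \<omega>1 * ?w) = real_of_int n * D"
      by (simp add: D_def algebra_simps)
    hence "\<bar>real_of_int n\<bar> * \<bar>D\<bar> \<le> norm (cnj \<omega>1 * ?w)" using abs_Im_le_cmod[of "cnj \<omega>1 * ?w"]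
      by (simp add: abs_mult)
    also have "\<dots> \<le> M * norm ?w" by (simp add: norm_mult M_def mult_right_mono)
    finally show ?thesis using M by (simp add: field_simps)
  qed
  have 2: "\<bar>D\<bar> / M * \<bar>real_of_int m\<bar> \<le> norm (of_int m * \<omega>1 + of_int n * \<omega>2)" (is "_ \<le> norm ?w") for m n
  proof -
    have "Im (cnj \<omega>2 * ?w) = - (real_of_int m * D)"
      by (simp add: D_def algebra_simps)
    hence "\<bar>real_of_int m\<bar> * \<bar>D\<bar> \<le> norm (cnj \<omega>2 * ?w)" using abs_Im_le_cmod[of "cnj \<omega>2 * ?w"]
      by (simp add: abs_mult)
    also have "\<dots> \<le> M * norm ?w" by (simp add: norm_mult M_def mult_right_mono)
    finally show ?thesis using M by (simp add: field_simps)
  qed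
  show ?thesis by (rule that[OF L _ 2 1]) (use M D in auto)
qed

lemma finite_lattice_ball: "finite {\<omega> \<in> \<Lambda>. norm \<omega> < B}"
proof -
  obtain \<omega>1 \<omega>2 c where L: "\<Lambda> = period_lattice \<omega>1 \<omega>2" and c: "c > 0"
    "\<And>m n. c * \<bar>real_of_int m\<bar> \<le> norm (of_int m * \<omega>1 + of_int n * \<omega>2)"
    "\<And>m n. c * \<bar>real_of_int n\<bar> \<le> norm (of_int m * \<omega>1 + of_int n * \<omega>2)"
    using lattice_coordinates by metis
  define N where "N = \<lceil>B / c\<rceil>"
  have "{\<omega> \<in> \<Lambda>. norm \<omega> < B} \<subseteq> (\<lambda>(m, n). of_int m * \<omega>1 + of_int n * \<omega>2) ` ({-N..N} \<times> {-N..N})"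
  proof
    fix \<omega> assume "\<omega> \<in> {\<omega> \<in> \<Lambda>. norm \<omega> < B}"
    then obtain m n where w: "\<omega> = of_int m * \<omega>1 + of_int n * \<omega>2" "norm \<omega> < B"
      by (auto simp: L period_lattice_def)
    have "c * \<bar>real_of_int m\<bar> < B" "c * \<bar>real_of_int n\<bar> < B" using c(2,3)[where m = m and n = n] w(2)[unfolded w(1)] by linarith+
    hence "\<bar>real_of_int m\<bar> < B / c" "\<bar>real_of_int n\<bar> < B / c" using c(1) by (simp_all add: field_simps)
    hence "\<bar>m\<bar> \<le> N" "\<bar>n\<bar> \<le> N" unfolding N_def by linarith+
    thus "\<omega> \<in> (\<lambda>(m, n). of_int m * \<omega>1 + of_int n * \<omega>2) ` ({-N..N} \<times> {-N..N})"
      by (intro image_eqI[of _ _ "(m, n)"]) (auto simp: w)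
  qed
  thus ?thesis by (rule finite_subset) auto
qed

lemma closed_sublattice:
  assumes "A \<subseteq> \<Lambda>" shows "closed A"
  unfolding closed_limpt
proof safe
  fix x assume "x islimpt A"
  hence "infinite (A \<inter> ball x 1)" by (simp add: islimpt_eq_infinite_ball)
  moreover have "A \<inter> ball x 1 \<subseteq> {\<omega> \<in> \<Lambda>. norm \<omega> < norm x + 1}"
  proof
    fix y assume "y \<in> A \<inter> ball x 1"
    thus "y \<in> {\<omega> \<in> \<Lambda>. norm \<omega> < norm x + 1}"
      using assms norm_triangle_ineq2[of y x] by (auto simp: dist_norm norm_minus_commute)
  qed
  ultimately show "x \<in> A" using finite_lattice_ball finite_subset by blast
qed

lemma open_minus_sublattice: "A \<subseteq> \<Lambda> \<Longrightarrow> open (- A)"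
  using closed_sublattice by (simp add: open_Compl)

lemma eventually_not_in_lattice: "eventually (\<lambda>z. z \<notin> \<Lambda>) (at z0)"
proof -
  have "open (- (\<Lambda> - {z0}))" by (rule open_minus_sublattice) auto
  thus ?thesis unfolding eventually_at_topological by (intro exI[of _ "- (\<Lambda> - {z0})"]) auto
qed

text \<open>Every point is congruent to one in the fundamental parallelogram.\<close>

lemma lattice_reduction: "\<exists>B. \<forall>z. \<exists>\<omega>\<in>\<Lambda>. norm (z + \<omega>) \<le> B"
proof -
  obtain \<omega>1 \<omega>2 where L: "\<Lambda> = period_lattice \<omega>1 \<omega>2" "Im (cnj \<omega>1 * \<omega>2) \<noteq> 0"
    using lattice by (auto simp: is_period_lattice_def)
  have "\<exists>\<omega>\<in>\<Lambda>. norm (z + \<omega>) \<le> norm \<omega>1 + norm \<omega>2" for z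
  proof -
    obtain x y where z: "z = of_real x * \<omega>1 + of_real y * \<omega>2" using real_coordinates[OF L(2)] by blast
    define \<omega> where "\<omega> = of_int (- \<lfloor>x\<rfloor>) * \<omega>1 + of_int (- \<lfloor>y\<rfloor>) * \<omega>2"
    have mem: "\<omega> \<in> \<Lambda>" unfolding L \<omega>_def period_lattice_def by blast
    have "z + \<omega> = of_real (frac x) * \<omega>1 + of_real (frac y) * \<omega>2"
      by (simp add: z \<omega>_def frac_def algebra_simps)
    hence "norm (z + \<omega>) \<le> \<bar>frac x\<bar> * norm \<omega>1 + \<bar>frac y\<bar> * norm \<omega>2"
      using norm_triangle_ineq[of "of_real (frac x) * \<omega>1" "of_real (frac y) * \<omega>2"] by (simp add: norm_mult)
    also have "\<dots> \<le> 1 * norm \<omega>1 + 1 * norm \<omega>2"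
      using frac_lt_1[of x] frac_lt_1[of y] by (intro add_mono mult_right_mono) auto
    finally have "norm (z + \<omega>) \<le> norm \<omega>1 + norm \<omega>2" by simp
    thus ?thesis using mem by blast
  qed
  thus ?thesis by blast
qed

text \<open>Since both coordinates are bounded by a multiple of the norm, \<open>1/|\<omega>|^3\<close> is
  at most a constant times \<open>(1 + |m|)^{-3/2} (1 + |n|)^{-3/2}\<close>, a product of terms of
  convergent series.\<close>

lemma summable_lattice_cube: "(\<lambda>\<omega>. 1 / norm \<omega> ^ 3) summable_on \<Lambda>"
proof -
  obtain \<omega>1 \<omega>2 c where L: "\<Lambda> = period_lattice \<omega>1 \<omega>2" and c: "c > 0"
    "\<And>m n. c * \<bar>real_of_int m\<bar> \<le> norm (of_int m * \<omega>1 + of_int n * \<omega>2)"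
    "\<And>m n. c * \<bar>real_of_int n\<bar> \<le> norm (of_int m * \<omega>1 + of_int n * \<omega>2)"
    using lattice_coordinates by metis
  define h where "h = (\<lambda>(m, n). of_int m * \<omega>1 + of_int n * \<omega>2)"
  define a where "a = (\<lambda>m::int. (1 + \<bar>real_of_int m\<bar>) powr (-3/2))"
  have \<Lambda>: "\<Lambda> = range h" by (auto simp: L period_lattice_def h_def)
  have h0: "m = 0 \<and> n = 0" if "h (m, n) = 0" for m n
    using c(2,3)[where m = m and n = n] that c(1) by (auto simp: h_def mult_le_0_iff)
  have inj: "inj h"
  proof (rule injI)
    fix x y assume e: "h x = h y"
    have "h (fst x - fst y, snd x - snd y) = h x - h y"
      by (cases x; cases y) (simp add: h_def algebra_simps)
    thus "x = y" using e h0[of "fst x - fst y" "snd x - snd y"] by (auto simp: prod_eq_iff)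
  qed
  have asum: "a summable_on UNIV" unfolding a_def by (rule summable_int_powr)
  have "(\<lambda>(m, n). 8 / c^3 * (a m * a n)) summable_on UNIV \<times> UNIV"
  proof (rule summable_on_SigmaI)
    fix m :: int
    have "(a has_sum infsum a UNIV) UNIV" using asum by (rule has_sum_infsum)
    from has_sum_cmult_right[OF this, of "8 / c^3 * a m"]
    show "((\<lambda>n. case (m, n) of (m, n) \<Rightarrow> 8 / c^3 * (a m * a n)) has_sum 8 / c^3 * a m * infsum a UNIV) UNIV"
      by (simp add: mult_ac)
  next
    show "(\<lambda>m. 8 / c^3 * a m * infsum a UNIV) summable_on UNIV"
      by (intro summable_on_cmult_left summable_on_cmult_right asum)
  qed (use c in \<open>auto simp: a_def\<close>)
  hence "(\<lambda>(m, n). 8 / c^3 * (a m * a n)) summable_on UNIV" by simp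
  hence "((\<lambda>\<omega>. 1 / norm \<omega> ^ 3) \<circ> h) summable_on UNIV"
  proof (rule summable_on_comparison_test)
    fix x :: "int \<times> int"
    obtain m n where x: "x = (m, n)" by force
    have "1 / norm (h (m, n)) ^ 3 \<le> 8 / c^3 * (a m * a n)"
    proof (cases "h (m, n) = 0")
      case True thus ?thesis using c by (simp add: a_def)
    next
      case False
      define X where "X = norm (h (m, n))"
      have X: "X > 0" using False by (simp add: X_def)
      have le: "c * \<bar>real_of_int m\<bar> \<le> X" "c * \<bar>real_of_int n\<bar> \<le> X"
        using c(2,3)[where m = m and n = n] by (simp_all add: X_def h_def)
      have "m \<noteq> 0 \<or> n \<noteq> 0" using False by (auto simp: h_def)
      hence "1 \<le> \<bar>real_of_int m\<bar> \<or> 1 \<le> \<bar>real_of_int n\<bar>" by linarith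
      hence "c * 1 \<le> c * \<bar>real_of_int m\<bar> \<or> c * 1 \<le> c * \<bar>real_of_int n\<bar>"
        using c(1) by (meson mult_left_mono less_imp_le)
      hence "c \<le> X" using le by linarith
      have "1 + \<bar>real_of_int m\<bar> \<le> 2 * X / c" "1 + \<bar>real_of_int n\<bar> \<le> 2 * X / c"
        using le \<open>c \<le> X\<close> c(1) by (simp_all add: field_simps)
      hence "(2 * X / c) powr (-3/2) \<le> a m" "(2 * X / c) powr (-3/2) \<le> a n"
        unfolding a_def by (auto intro!: powr_mono2')
      hence "(2 * X / c) powr (-3/2) * (2 * X / c) powr (-3/2) \<le> a m * a n"
        by (intro mult_mono) (auto simp: a_def)
      also have "(2 * X / c) powr (-3/2) * (2 * X / c) powr (-3/2) = (2 * X / c) powr (- real 3)"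
        by (simp flip: powr_add)
      also have "\<dots> = inverse ((2 * X / c) ^ 3)" using X c(1) by (simp add: powr_minus powr_realpow)
      also have "\<dots> = c^3 / 8 * (1 / X^3)" by (simp add: power_divide power_mult_distrib field_simps)
      finally have "c^3 / 8 * (1 / X^3) \<le> a m * a n" .
      thus ?thesis using c(1) by (simp add: X_def field_simps)
    qed
    thus "((\<lambda>\<omega>. 1 / norm \<omega> ^ 3) \<circ> h) x \<le> (case x of (m, n) \<Rightarrow> 8 / c^3 * (a m * a n))"
      by (simp add: x o_def)
  qed auto
  thus ?thesis unfolding \<Lambda> by (subst summable_on_reindex[OF inj])
qed

text \<open>On a disc of radius \<open>R\<close> all but finitely many terms are dominated by a multiple of
  \<open>1/|\<omega>|^3\<close>, so the series converges uniformly up to a finite sum and may be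
  differentiated term by term. Subsets \<open>A\<close> of the lattice are allowed so that single
  terms can be split off at lattice points.\<close>

lemma lattice_series:
  assumes A: "A \<subseteq> \<Lambda> - {0}"
    and d: "\<And>\<omega> z. \<omega> \<in> A \<Longrightarrow> z \<noteq> \<omega> \<Longrightarrow> (t \<omega> has_field_derivative t' \<omega> z) (at z)"
    and bound: "\<And>R. R > 0 \<Longrightarrow> \<exists>C. \<forall>\<omega>\<in>A. \<forall>z. norm z \<le> R \<longrightarrow> norm \<omega> \<ge> 2 * R \<longrightarrow> norm (t \<omega> z) \<le> C / norm \<omega> ^ 3"
  shows "(\<lambda>\<omega>. t \<omega> z) summable_on A"
    "z \<notin> A \<Longrightarrow> ((\<lambda>z. \<Sum>\<^sub>\<infinity>\<omega>\<in>A. t \<omega> z) has_field_derivative (\<Sum>\<^sub>\<infinity>\<omega>\<in>A. t' \<omega> z)) (at z)"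
    "z \<notin> A \<Longrightarrow> (\<lambda>\<omega>. t' \<omega> z) summable_on A"
proof -
  define R where "R = norm z + 1"
  have R: "R > 0" "norm z < R" by (simp_all add: R_def add_nonneg_pos)
  obtain C where C: "\<And>\<omega> y. \<omega> \<in> A \<Longrightarrow> norm y \<le> R \<Longrightarrow> norm \<omega> \<ge> 2 * R \<Longrightarrow> norm (t \<omega> y) \<le> C / norm \<omega> ^ 3"
    using bound[OF R(1)] by blast
  define N where "N = {\<omega> \<in> A. norm \<omega> < 2 * R}"
  define B where "B = A - N"
  have fin: "finite N" by (rule finite_subset[OF _ finite_lattice_ball[of "2 * R"]]) (use A in \<open>auto simp: N_def\<close>)
  have AB: "A = N \<union> B" "N \<inter> B = {}" by (auto simp: N_def B_def)
  have "(\<lambda>\<omega>. 1 / norm \<omega> ^ 3) summable_on B"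
    by (rule summable_on_subset_banach[OF summable_lattice_cube]) (use A in \<open>auto simp: B_def\<close>)
  from summable_on_cmult_right[OF this, of C]
  have M: "(\<lambda>\<omega>. C / norm \<omega> ^ 3) summable_on B" by simp
  have le: "norm (t \<omega> y) \<le> C / norm \<omega> ^ 3" if "\<omega> \<in> B" "y \<in> cball 0 R" for \<omega> y
    using that by (intro C) (auto simp: B_def N_def)
  have ul: "uniform_limit (cball 0 R) (\<lambda>X y. \<Sum>\<omega>\<in>X. t \<omega> y) (\<lambda>y. \<Sum>\<^sub>\<infinity>\<omega>\<in>B. t \<omega> y) (finite_subsets_at_top B)"
    by (rule Weierstrass_m_test_general[OF le M])
  have sumB: "(\<lambda>\<omega>. t \<omega> y) summable_on B" if "norm y \<le> R" for y
  proof (rule abs_summable_summable)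
    show "(\<lambda>\<omega>. norm (t \<omega> y)) summable_on B"
      by (rule Infinite_Sum.abs_summable_on_comparison_test'[OF M]) (use le that in auto)
  qed
  show "(\<lambda>\<omega>. t \<omega> z) summable_on A"
    unfolding AB(1) using fin sumB[of z] R by (intro summable_on_Un_disjoint AB) auto
  assume z: "z \<notin> A"
  have far: "y \<noteq> \<omega>" if "\<omega> \<in> B" "norm y \<le> R" for y \<omega>
    using that R by (auto simp: B_def N_def)
  have ev: "eventually (\<lambda>X. continuous_on (cball 0 R) (\<lambda>y. \<Sum>\<omega>\<in>X. t \<omega> y) \<and>
      (\<forall>w\<in>ball 0 R. ((\<lambda>y. \<Sum>\<omega>\<in>X. t \<omega> y) has_field_derivative (\<Sum>\<omega>\<in>X. t' \<omega> w)) (at w))) (finite_subsets_at_top B)"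
  proof (rule eventually_finite_subsets_at_top_weakI, intro conjI ballI)
    fix X assume X: "finite X" "X \<subseteq> B"
    have D: "((\<lambda>y. \<Sum>\<omega>\<in>X. t \<omega> y) has_field_derivative (\<Sum>\<omega>\<in>X. t' \<omega> w)) (at w)" if "norm w \<le> R" for w
      using X far that by (intro DERIV_sum d) (auto simp: B_def)
    thus "((\<lambda>y. \<Sum>\<omega>\<in>X. t \<omega> y) has_field_derivative (\<Sum>\<omega>\<in>X. t' \<omega> w)) (at w)" if "w \<in> ball 0 R" for w
      using that by simp
    show "continuous_on (cball 0 R) (\<lambda>y. \<Sum>\<omega>\<in>X. t \<omega> y)"
      by (intro continuous_at_imp_continuous_on ballI DERIV_isCont) (use D in auto)
  qed
  obtain g' where g': "\<And>w. w \<in> ball 0 R \<Longrightarrow> ((\<lambda>y. \<Sum>\<^sub>\<infinity>\<omega>\<in>B. t \<omega> y) has_field_derivative g' w) (at w) \<and>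
      ((\<lambda>X. \<Sum>\<omega>\<in>X. t' \<omega> w) \<longlongrightarrow> g' w) (finite_subsets_at_top B)"
    using has_complex_derivative_uniform_limit[OF ev ul _ R(1)] by (metis finite_subsets_at_top_neq_bot)
  have zR: "z \<in> ball 0 R" using R by simp
  have hs: "((\<lambda>\<omega>. t' \<omega> z) has_sum g' z) B" using g'[OF zR] by (simp add: has_sum_def)
  hence "(\<lambda>\<omega>. t' \<omega> z) summable_on B" by (rule has_sum_imp_summable)
  thus "(\<lambda>\<omega>. t' \<omega> z) summable_on A" unfolding AB(1) using fin by (intro summable_on_Un_disjoint AB) auto
  have eq': "(\<Sum>\<^sub>\<infinity>\<omega>\<in>A. t' \<omega> z) = (\<Sum>\<omega>\<in>N. t' \<omega> z) + g' z"
    unfolding AB(1) using fin \<open>(\<lambda>\<omega>. t' \<omega> z) summable_on B\<close> hs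
    by (subst infsum_Un_disjoint) (auto simp: AB infsumI)
  have eq: "(\<Sum>\<^sub>\<infinity>\<omega>\<in>A. t \<omega> y) = (\<Sum>\<omega>\<in>N. t \<omega> y) + (\<Sum>\<^sub>\<infinity>\<omega>\<in>B. t \<omega> y)" if "y \<in> ball 0 R" for y
    unfolding AB(1) using fin sumB[of y] that by (subst infsum_Un_disjoint) (auto simp: AB)
  have "((\<lambda>y. (\<Sum>\<omega>\<in>N. t \<omega> y) + (\<Sum>\<^sub>\<infinity>\<omega>\<in>B. t \<omega> y)) has_field_derivative (\<Sum>\<omega>\<in>N. t' \<omega> z) + g' z) (at z)"
    using z g'[OF zR] by (intro DERIV_add DERIV_sum d) (auto simp: N_def)
  thus "((\<lambda>z. \<Sum>\<^sub>\<infinity>\<omega>\<in>A. t \<omega> z) has_field_derivative (\<Sum>\<^sub>\<infinity>\<omega>\<in>A. t' \<omega> z)) (at z)"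
    unfolding eq' by (rule has_field_derivative_transform_within_open[OF _ open_ball zR]) (simp add: eq)
qed

lemma lattice_denominator_bound:
  fixes z \<omega> :: complex
  assumes "norm z \<le> R" "norm \<omega> \<ge> 2 * R"
  shows "norm (z - \<omega>) \<ge> norm \<omega> / 2"
  using norm_triangle_ineq2[of \<omega> z] assms by (simp add: norm_minus_commute)

abbreviation zeta_term :: "complex \<Rightarrow> complex \<Rightarrow> complex" where
  "zeta_term \<omega> z \<equiv> 1 / (z - \<omega>) + 1 / \<omega> + z / \<omega>^2"

abbreviation p_term :: "complex \<Rightarrow> complex \<Rightarrow> complex" where
  "p_term \<omega> z \<equiv> 1 / (z - \<omega>)^2 - 1 / \<omega>^2"

lemma zeta_term_bound:
  assumes R: "R > 0" and "\<omega> \<noteq> 0" "norm z \<le> R" "norm \<omega> \<ge> 2 * R"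
  shows "norm (zeta_term \<omega> z) \<le> (2 * R^2) / norm \<omega> ^ 3"
proof -
  have nz: "z - \<omega> \<noteq> 0" using assms by auto
  have "zeta_term \<omega> z = z^2 / (\<omega>^2 * (z - \<omega>))"
    using nz assms(2) by (simp add: divide_simps) (simp add: algebra_simps power2_eq_square)
  hence "norm (zeta_term \<omega> z) = norm z ^ 2 / (norm \<omega> ^ 2 * norm (z - \<omega>))"
    by (simp add: norm_divide norm_mult norm_power)
  also have "\<dots> \<le> R^2 / (norm \<omega> ^ 2 * (norm \<omega> / 2))"
    using assms lattice_denominator_bound[OF assms(3,4)]
    by (intro frac_le mult_left_mono power_mono) auto
  also have "\<dots> = (2 * R^2) / norm \<omega> ^ 3" by (simp add: power2_eq_square power3_eq_cube)
  finally show ?thesis .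
qed

lemma p_term_bound:
  assumes R: "R > 0" and "\<omega> \<noteq> 0" "norm z \<le> R" "norm \<omega> \<ge> 2 * R"
  shows "norm (p_term \<omega> z) \<le> (12 * R) / norm \<omega> ^ 3"
proof -
  have nz: "z - \<omega> \<noteq> 0" using assms by auto
  have "p_term \<omega> z = z * (2 * \<omega> - z) / (\<omega>^2 * (z - \<omega>)^2)"
    using nz assms(2) by (simp add: divide_simps) (simp add: algebra_simps power2_eq_square)
  hence "norm (p_term \<omega> z) = norm z * norm (2 * \<omega> - z) / (norm \<omega> ^ 2 * norm (z - \<omega>) ^ 2)"
    by (simp add: norm_divide norm_mult norm_power)
  also have "\<dots> \<le> (R * (3 * norm \<omega>)) / (norm \<omega> ^ 2 * (norm \<omega> / 2) ^ 2)"
  proof (intro frac_le mult_mono power_mono)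
    show "norm (2 * \<omega> - z) \<le> 3 * norm \<omega>" 
      using norm_triangle_ineq4[of "2 * \<omega>" z] assms by (simp add: norm_mult)
    show "norm \<omega> / 2 \<le> norm (z - \<omega>)" by (rule lattice_denominator_bound[OF assms(3,4)])
  qed (use assms in auto)
  also have "\<dots> = (12 * R) / norm \<omega> ^ 3" using assms(2) by (simp add: power2_eq_square power3_eq_cube field_simps)
  finally show ?thesis .
qed

lemma zeta_series:
  assumes A: "A \<subseteq> \<Lambda> - {0}"
  shows "(\<lambda>\<omega>. zeta_term \<omega> z) summable_on A"
    "z \<notin> A \<Longrightarrow> ((\<lambda>z. \<Sum>\<^sub>\<infinity>\<omega>\<in>A. zeta_term \<omega> z) has_field_derivative (- (\<Sum>\<^sub>\<infinity>\<omega>\<in>A. p_term \<omega> z))) (at z)"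
proof -
  have d: "(zeta_term \<omega> has_field_derivative - p_term \<omega> z) (at z)" if "\<omega> \<in> A" "z \<noteq> \<omega>" for \<omega> z
    using that A by (auto intro!: derivative_eq_intros simp: field_simps power2_eq_square)
  have b: "\<exists>C. \<forall>\<omega>\<in>A. \<forall>z. norm z \<le> R \<longrightarrow> norm \<omega> \<ge> 2 * R \<longrightarrow> norm (zeta_term \<omega> z) \<le> C / norm \<omega> ^ 3"
    if "R > 0" for R
    using zeta_term_bound[OF that] A by (intro exI[of _ "2 * R^2"]) blast
  show "(\<lambda>\<omega>. zeta_term \<omega> z) summable_on A"
    by (rule lattice_series(1)[where t' = "\<lambda>\<omega> z. - p_term \<omega> z", OF A]) (rule d; assumption | rule b; assumption)+
  show "((\<lambda>z. \<Sum>\<^sub>\<infinity>\<omega>\<in>A. zeta_term \<omega> z) has_field_derivative (- (\<Sum>\<^sub>\<infinity>\<omega>\<in>A. p_term \<omega> z))) (at z)" if "z \<notin> A"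
    unfolding infsum_uminus[symmetric]
    by (rule lattice_series(2)[where t' = "\<lambda>\<omega> z. - p_term \<omega> z", OF A]) (rule d; assumption | rule b; assumption | rule that)+
qed

lemma p_series:
  assumes A: "A \<subseteq> \<Lambda> - {0}"
  shows "(\<lambda>\<omega>. p_term \<omega> z) summable_on A"
    "z \<notin> A \<Longrightarrow> ((\<lambda>z. \<Sum>\<^sub>\<infinity>\<omega>\<in>A. p_term \<omega> z) has_field_derivative (\<Sum>\<^sub>\<infinity>\<omega>\<in>A. - 2 / (z - \<omega>)^3)) (at z)"
    "z \<notin> A \<Longrightarrow> (\<lambda>\<omega>. - 2 / (z - \<omega>)^3) summable_on A"
proof -
  have d: "(p_term \<omega> has_field_derivative - 2 / (z - \<omega>)^3) (at z)" if "\<omega> \<in> A" "z \<noteq> \<omega>" for \<omega> z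
  proof -
    have nz: "z - \<omega> \<noteq> 0" using that by simp
    have "(p_term \<omega> has_field_derivative - (2 * (z - \<omega>)) / ((z - \<omega>)^2 * (z - \<omega>)^2)) (at z)"
      using nz by (auto intro!: derivative_eq_intros)
    also have "- (2 * x) / (x^2 * x^2) = - 2 / x^3" if "x \<noteq> 0" for x :: complex
      using that by (simp add: eval_nat_numeral)
    from this[OF nz] have "- (2 * (z - \<omega>)) / ((z - \<omega>)^2 * (z - \<omega>)^2) = - 2 / (z - \<omega>)^3" .
    finally show ?thesis .
  qed
  have b: "\<exists>C. \<forall>\<omega>\<in>A. \<forall>z. norm z \<le> R \<longrightarrow> norm \<omega> \<ge> 2 * R \<longrightarrow> norm (p_term \<omega> z) \<le> C / norm \<omega> ^ 3"
    if "R > 0" for R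
    using p_term_bound[OF that] A by (intro exI[of _ "12 * R"]) blast
  show "(\<lambda>\<omega>. p_term \<omega> z) summable_on A"
    by (rule lattice_series(1)[where t' = "\<lambda>\<omega> z. - 2 / (z - \<omega>)^3", OF A]) (rule d; assumption | rule b; assumption)+
  show "((\<lambda>z. \<Sum>\<^sub>\<infinity>\<omega>\<in>A. p_term \<omega> z) has_field_derivative (\<Sum>\<^sub>\<infinity>\<omega>\<in>A. - 2 / (z - \<omega>)^3)) (at z)" if "z \<notin> A"
    by (rule lattice_series(2)[where t' = "\<lambda>\<omega> z. - 2 / (z - \<omega>)^3", OF A]) (rule d; assumption | rule b; assumption | rule that)+
  show "(\<lambda>\<omega>. - 2 / (z - \<omega>)^3) summable_on A" if "z \<notin> A"
    by (rule lattice_series(3)[where t' = "\<lambda>\<omega> z. - 2 / (z - \<omega>)^3" and t = p_term, OF A]) (rule d; assumption | rule b; assumption | rule that)+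
qed

lemma analytic_off_sublattice:
  assumes "A \<subseteq> \<Lambda>" "\<And>z. z \<notin> A \<Longrightarrow> \<exists>D. (f has_field_derivative D) (at z)" "z \<notin> A"
  shows "f analytic_on {z}"
proof -
  have "f holomorphic_on (- A)"
    unfolding holomorphic_on_def field_differentiable_def
    using assms(2) has_field_derivative_at_within by blast
  thus ?thesis using open_minus_sublattice[OF assms(1)] assms(3) analytic_at by blast
qed

lemma infsum_remove:
  fixes f :: "complex \<Rightarrow> complex"
  assumes "f summable_on A - {p}" "p \<in> A"
  shows "infsum f A = f p + infsum f (A - {p})"
  using infsum_Un_disjoint[of f "{p}" "A - {p}"] assms by (simp add: insert_absorb)

lemma zeta_at_lattice_point:
  assumes p: "p \<in> \<Lambda>"
  shows "\<exists>h. h analytic_on {p} \<and> (\<forall>z. weierstrass_zeta \<Lambda> z = 1 / (z - p) + h z)"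
proof (cases "p = 0")
  case True
  define h where "h = (\<lambda>z. \<Sum>\<^sub>\<infinity>\<omega>\<in>\<Lambda>-{0}. zeta_term \<omega> z)"
  have "h analytic_on {p}" unfolding h_def
    by (rule analytic_off_sublattice[of "\<Lambda> - {0}"]) (use zeta_series(2)[of "\<Lambda> - {0}"] True in \<open>auto\<close>)
  thus ?thesis using True by (intro exI[of _ h]) (simp add: weierstrass_zeta_def h_def)
next
  case False
  define A where "A = \<Lambda> - {0} - {p}"
  define g where "g = (\<lambda>z. \<Sum>\<^sub>\<infinity>\<omega>\<in>A. zeta_term \<omega> z)"
  define h where "h = (\<lambda>z. 1 / z + 1 / p + z / p^2 + g z)"
  have A: "A \<subseteq> \<Lambda> - {0}" by (auto simp: A_def)
  have "g analytic_on {p}" unfolding g_def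
    by (rule analytic_off_sublattice[of A]) (use zeta_series(2)[OF A] A in \<open>auto simp: A_def\<close>)
  hence "h analytic_on {p}" unfolding h_def using False by (intro analytic_intros) auto
  moreover have "weierstrass_zeta \<Lambda> z = 1 / (z - p) + h z" for z
    unfolding weierstrass_zeta_def h_def g_def A_def
    using infsum_remove[of "\<lambda>\<omega>. zeta_term \<omega> z" "\<Lambda> - {0}" p] zeta_series(1)[OF A, of z] p False
    by (simp add: A_def)
  ultimately show ?thesis by blast
qed

lemma p_at_lattice_point:
  assumes p: "p \<in> \<Lambda>"
  shows "\<exists>h. h analytic_on {p} \<and> (\<forall>z. weierstrass_p \<Lambda> z = 1 / (z - p)^2 + h z) \<and> (p = 0 \<longrightarrow> h 0 = 0)"
proof (cases "p = 0")
  case True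
  define h where "h = (\<lambda>z. \<Sum>\<^sub>\<infinity>\<omega>\<in>\<Lambda>-{0}. p_term \<omega> z)"
  have "h analytic_on {p}" unfolding h_def
    by (rule analytic_off_sublattice[of "\<Lambda> - {0}"]) (use p_series(2)[of "\<Lambda> - {0}"] True in \<open>auto\<close>)
  moreover have "h 0 = 0" unfolding h_def by simp
  ultimately show ?thesis using True by (intro exI[of _ h]) (simp add: weierstrass_p_def h_def)
next
  case False
  define A where "A = \<Lambda> - {0} - {p}"
  define g where "g = (\<lambda>z. \<Sum>\<^sub>\<infinity>\<omega>\<in>A. p_term \<omega> z)"
  define h where "h = (\<lambda>z. 1 / z^2 - 1 / p^2 + g z)"
  have A: "A \<subseteq> \<Lambda> - {0}" by (auto simp: A_def)
  have "g analytic_on {p}" unfolding g_def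
    by (rule analytic_off_sublattice[of A]) (use p_series(2)[OF A] A in \<open>auto simp: A_def\<close>)
  hence "h analytic_on {p}" unfolding h_def using False by (intro analytic_intros) auto
  moreover have "weierstrass_p \<Lambda> z = 1 / (z - p)^2 + h z" for z
    unfolding weierstrass_p_def h_def g_def A_def
    using infsum_remove[of "\<lambda>\<omega>. p_term \<omega> z" "\<Lambda> - {0}" p] p_series(1)[OF A, of z] p False
    by (simp add: A_def)
  ultimately show ?thesis using False by blast
qed

lemma zeta_deriv:
  assumes z: "z \<notin> \<Lambda>"
  shows "(weierstrass_zeta \<Lambda> has_field_derivative - weierstrass_p \<Lambda> z) (at z)"
proof -
  have z0: "z \<noteq> 0" using z zero_in_lattice by auto
  have 1: "((\<lambda>z. 1 / z) has_field_derivative - (1 / z^2)) (at z)"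
    using z0 by (auto intro!: derivative_eq_intros simp: power2_eq_square)
  have "((\<lambda>z. 1 / z + (\<Sum>\<^sub>\<infinity>\<omega>\<in>\<Lambda>-{0}. zeta_term \<omega> z)) has_field_derivative
      - (1 / z^2) + - (\<Sum>\<^sub>\<infinity>\<omega>\<in>\<Lambda>-{0}. p_term \<omega> z)) (at z)"
    using z by (intro DERIV_add[OF 1 zeta_series(2)]) auto
  thus ?thesis by (simp add: weierstrass_zeta_def[abs_def] weierstrass_p_def)
qed

text \<open>After differentiation the convergence factors disappear and the sum runs over the whole lattice,
  which makes periodicity evident.\<close>

lemma p_deriv:
  assumes z: "z \<notin> \<Lambda>"
  shows "(weierstrass_p \<Lambda> has_field_derivative (\<Sum>\<^sub>\<infinity>\<omega>\<in>\<Lambda>. - 2 / (z - \<omega>)^3)) (at z)"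
proof -
  have z0: "z \<noteq> 0" using z zero_in_lattice by auto
  have "(\<Sum>\<^sub>\<infinity>\<omega>\<in>\<Lambda>. - 2 / (z - \<omega>)^3) = - 2 / z^3 + (\<Sum>\<^sub>\<infinity>\<omega>\<in>\<Lambda>-{0}. - 2 / (z - \<omega>)^3)"
    using infsum_remove[of "\<lambda>\<omega>. - 2 / (z - \<omega>)^3" \<Lambda> 0] p_series(3)[of "\<Lambda> - {0}" z] z zero_in_lattice by simp
  moreover have 1: "((\<lambda>z. 1 / z^2) has_field_derivative - 2 / z^3) (at z)"
    using z0 by (auto intro!: derivative_eq_intros simp: eval_nat_numeral)
  have "((\<lambda>z. 1 / z^2 + (\<Sum>\<^sub>\<infinity>\<omega>\<in>\<Lambda>-{0}. p_term \<omega> z)) has_field_derivative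
      - 2 / z^3 + (\<Sum>\<^sub>\<infinity>\<omega>\<in>\<Lambda>-{0}. - 2 / (z - \<omega>)^3)) (at z)"
    using z by (intro DERIV_add[OF 1 p_series(2)]) auto
  ultimately show ?thesis by (simp add: weierstrass_p_def[abs_def])
qed

lemma p_deriv_periodic:
  assumes z: "z \<notin> \<Lambda>" and p: "p \<in> \<Lambda>"
  shows "deriv (weierstrass_p \<Lambda>) (z + p) = deriv (weierstrass_p \<Lambda>) z"
proof -
  have bij: "bij_betw (\<lambda>\<omega>. \<omega> + p) \<Lambda> \<Lambda>"
    by (rule bij_betwI[of _ _ _ "\<lambda>\<omega>. \<omega> - p"]) (use p add_in_lattice diff_in_lattice in auto)
  have "(\<Sum>\<^sub>\<infinity>\<omega>\<in>\<Lambda>. - 2 / (z + p - \<omega>)^3) = (\<Sum>\<^sub>\<infinity>\<omega>\<in>\<Lambda>. - 2 / (z - \<omega>)^3)"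
    using infsum_reindex_bij_betw[OF bij, of "\<lambda>\<omega>. - 2 / (z + p - \<omega>)^3"] by simp
  thus ?thesis using p_deriv[OF z] p_deriv[of "z + p"] z add_lattice_iff[OF p, of z] DERIV_imp_deriv by metis
qed

lemma bij_uminus_lattice: "bij_betw uminus (\<Lambda> - {0}) (\<Lambda> - {0})"
  by (rule bij_betwI[of _ _ _ uminus]) (use uminus_in_lattice in auto)

lemma p_even: "weierstrass_p \<Lambda> (- z) = weierstrass_p \<Lambda> z"
proof -
  have "(\<Sum>\<^sub>\<infinity>\<omega>\<in>\<Lambda>-{0}. p_term \<omega> (- z)) = (\<Sum>\<^sub>\<infinity>\<omega>\<in>\<Lambda>-{0}. p_term (- \<omega>) (- z))"
    using infsum_reindex_bij_betw[OF bij_uminus_lattice, of "\<lambda>\<omega>. p_term \<omega> (- z)"] by simp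
  moreover have "p_term (- \<omega>) (- z) = p_term \<omega> z" for \<omega>
    by (simp add: power2_commute[of \<omega> z])
  ultimately show ?thesis by (simp add: weierstrass_p_def)
qed

lemma zeta_odd: "weierstrass_zeta \<Lambda> (- z) = - weierstrass_zeta \<Lambda> z"
proof -
  have "(\<Sum>\<^sub>\<infinity>\<omega>\<in>\<Lambda>-{0}. zeta_term \<omega> (- z)) = (\<Sum>\<^sub>\<infinity>\<omega>\<in>\<Lambda>-{0}. zeta_term (- \<omega>) (- z))"
    using infsum_reindex_bij_betw[OF bij_uminus_lattice, of "\<lambda>\<omega>. zeta_term \<omega> (- z)"] by simp
  moreover have "zeta_term (- \<omega>) (- z) = - zeta_term \<omega> z" for \<omega>
  proof -
    have "1 / (\<omega> - z) = - (1 / (z - \<omega>))" by (simp add: minus_divide_right)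
    thus ?thesis by simp
  qed
  moreover have "(\<Sum>\<^sub>\<infinity>\<omega>\<in>\<Lambda>-{0}. - zeta_term \<omega> z) = - (\<Sum>\<^sub>\<infinity>\<omega>\<in>\<Lambda>-{0}. zeta_term \<omega> z)" by (rule infsum_uminus)
  ultimately have "(\<Sum>\<^sub>\<infinity>\<omega>\<in>\<Lambda>-{0}. zeta_term \<omega> (- z)) = - (\<Sum>\<^sub>\<infinity>\<omega>\<in>\<Lambda>-{0}. zeta_term \<omega> z)"
    by (simp only:)
  thus ?thesis by (simp add: weierstrass_zeta_def)
qed

lemma analytic_p: "z \<notin> \<Lambda> \<Longrightarrow> weierstrass_p \<Lambda> analytic_on {z}"
  using analytic_off_sublattice[of \<Lambda>] p_deriv by blast

lemma analytic_zeta: "z \<notin> \<Lambda> \<Longrightarrow> weierstrass_zeta \<Lambda> analytic_on {z}"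
  using analytic_off_sublattice[of \<Lambda>] zeta_deriv by blast

lemma meromorphic_p: "weierstrass_p \<Lambda> meromorphic_on A"
proof -
  have "weierstrass_p \<Lambda> meromorphic_on {z}" for z
  proof (cases "z \<in> \<Lambda>")
    case True
    then obtain h where h: "h analytic_on {z}" "\<And>w. weierstrass_p \<Lambda> w = 1 / (w - z)^2 + h w"
      using p_at_lattice_point by blast
    have "(\<lambda>w. 1 / (w - z)^2 + h w) meromorphic_on {z}"
      using h by (intro meromorphic_intros analytic_on_imp_meromorphic_on)
    thus ?thesis using h(2) by presburger
  qed (simp add: analytic_p analytic_on_imp_meromorphic_on)
  thus ?thesis using meromorphic_on_meromorphic_at by blast
qed

lemma meromorphic_zeta: "weierstrass_zeta \<Lambda> meromorphic_on A"
proof -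
  have "weierstrass_zeta \<Lambda> meromorphic_on {z}" for z
  proof (cases "z \<in> \<Lambda>")
    case True
    then obtain h where h: "h analytic_on {z}" "\<And>w. weierstrass_zeta \<Lambda> w = 1 / (w - z) + h w"
      using zeta_at_lattice_point by blast
    have "(\<lambda>w. 1 / (w - z) + h w) meromorphic_on {z}"
      using h by (intro meromorphic_intros analytic_on_imp_meromorphic_on)
    thus ?thesis using h(2) by presburger
  qed (simp add: analytic_zeta analytic_on_imp_meromorphic_on)
  thus ?thesis using meromorphic_on_meromorphic_at by blast
qed

text \<open>The derivative of \<open>E\<close> is entire and elliptic, hence a constant \<open>c\<close> by
  Liouville's theorem, so \<open>E(z) = c z + d\<close>, and \<open>c = 0\<close> as
  \<open>E\<close> is even. Periodicity is required of the derivative only, because this is what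
  the series for \<open>\<wp>'\<close> gives directly and because zeta is merely quasi-periodic.\<close>

lemma entire_even_quasiperiodic_constant:
  assumes E: "E holomorphic_on UNIV" and even: "\<And>z. E (- z) = E z"
    and per: "\<And>\<omega>. \<omega> \<in> \<Lambda> \<Longrightarrow> eventually (\<lambda>z. deriv E (z + \<omega>) = deriv E z) (at z0)"
  shows "E constant_on UNIV"
proof -
  have E': "deriv E holomorphic_on UNIV" using E by (intro holomorphic_deriv) auto
  have n: "deriv E nicely_meromorphic_on UNIV"
    using E' by (intro analytic_on_imp_nicely_meromorphic_on) (simp add: analytic_on_open)
  have per': "deriv E (z + \<omega>) = deriv E z" if "\<omega> \<in> \<Lambda>" for z \<omega>
  proof -
    have "(\<lambda>z. deriv E (1 * z + \<omega>)) = deriv E"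
      using per[OF that] by (intro nicely_meromorphic_eqI[OF nicely_meromorphic_affine[OF n] n]) auto
    from fun_cong[OF this, of z] show ?thesis by simp
  qed
  obtain B where B: "\<And>z. \<exists>\<omega>\<in>\<Lambda>. norm (z + \<omega>) \<le> B" using lattice_reduction by blast
  have "compact (deriv E ` cball 0 B)"
    by (intro compact_continuous_image compact_cball holomorphic_on_imp_continuous_on holomorphic_on_subset[OF E']) auto
  hence "bounded (deriv E ` cball 0 B)" by (rule compact_imp_bounded)
  moreover have "range (deriv E) \<subseteq> deriv E ` cball 0 B"
  proof safe
    fix z
    obtain \<omega> where "\<omega> \<in> \<Lambda>" "norm (z + \<omega>) \<le> B" using B by blast
    thus "deriv E z \<in> deriv E ` cball 0 B" using per'[of \<omega> z] by (intro image_eqI[of _ _ "z + \<omega>"]) auto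
  qed
  ultimately have "bounded (range (deriv E))" using bounded_subset by blast
  then obtain c where c: "\<And>z. deriv E z = c" using Liouville_theorem[OF E'] by (auto simp: constant_on_def)
  have "(\<lambda>z. E z - c * z) constant_on UNIV"
  proof (rule has_field_derivative_0_imp_constant_on)
    fix z
    have "(E has_field_derivative c) (at z)" using holomorphic_derivI[OF E open_UNIV UNIV_I] c by metis
    thus "((\<lambda>z. E z - c * z) has_field_derivative 0) (at z)" by (auto intro!: derivative_eq_intros)
  qed auto
  then obtain d where d: "\<And>z. E z - c * z = d" by (auto simp: constant_on_def)
  have "c = 0" using d[of 1] d[of "-1"] even[of 1] by (simp add: algebra_simps)
  thus ?thesis using d by (auto simp: constant_on_def)
qed

end

section \<open>Meromorphic continuation for the cubic equation\<close>

definition cubic :: "complex \<Rightarrow> complex \<Rightarrow> complex \<Rightarrow> complex poly" where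
  "cubic e1 e2 e3 = smult 4 ([:-e1, 1:] * [:-e2, 1:] * [:-e3, 1:])"

lemma poly_cubic: "poly (cubic e1 e2 e3) x = 4 * (x - e1) * (x - e2) * (x - e3)"
  by (simp add: cubic_def algebra_simps)

lemma degree_cubic: "degree (cubic e1 e2 e3) = 3"
  by (simp add: cubic_def degree_mult_eq)

text \<open>Let \<open>y\<close> be the inverse function of a primitive of \<open>1 / sqrt (\<Prod> (1 - e_j
  y^2))\<close> vanishing at 0. Then \<open>y'^2 = \<Prod> (1 - e_j y^2)\<close>, and \<open>v =
  1/y^2\<close> satisfies \<open>v'^2 = 4 y'^2 / y^6 = 4 \<Prod> (v - e_j)\<close>.\<close>

lemma local_cubic_solution:
  fixes e1 e2 e3 :: complex
  shows "\<exists>r>0. \<exists>v. v nicely_meromorphic_on ball 0 r \<and> is_pole v 0 \<and>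
     eventually (\<lambda>w. deriv v w ^ 2 = poly (cubic e1 e2 e3) (v w)) (at 0)"
proof -
  define H where "H = (\<lambda>y. (1 - e1 * y^2) * (1 - e2 * y^2) * (1 - e3 * y^2))"
  have "isCont (\<lambda>y. H y) 0" unfolding H_def by (intro continuous_intros)
  hence "(H \<longlongrightarrow> H 0) (nhds 0)" unfolding isCont_def tendsto_at_iff_tendsto_nhds .
  moreover have "H 0 = 1" by (simp add: H_def)
  ultimately have "(H \<longlongrightarrow> 1) (nhds 0)" by simp
  hence "eventually (\<lambda>y. dist (H y) 1 < 1) (nhds 0)" by (rule tendstoD) simp
  then obtain \<rho> where \<rho>: "\<rho> > 0" "\<And>y. dist y 0 < \<rho> \<Longrightarrow> dist (H y) 1 < 1"
    unfolding eventually_nhds_metric by blast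
  \<comment> \<open>On this disc the radicand \<open>H\<close> stays in the right half-plane, so that its square
    root is holomorphic.\<close>
  define B where "B = ball (0::complex) \<rho>"
  have Hre: "Re (H y) > 0" if "y \<in> B" for y
  proof -
    have "norm (1 - H y) < 1" using \<rho>(2)[of y] that by (simp add: B_def dist_norm norm_minus_commute)
    thus ?thesis using complex_Re_le_cmod[of "1 - H y"] by simp
  qed
  define h where "h = (\<lambda>y. csqrt (H y))"
  have h2: "h y ^ 2 = H y" for y by (simp add: h_def)
  have hnz: "h y \<noteq> 0" if "y \<in> B" for y using h2[of y] Hre[OF that] by auto
  have hh: "h holomorphic_on B" unfolding h_def
  proof (intro holomorphic_on_csqrt')
    show "H holomorphic_on B" unfolding H_def by (intro holomorphic_intros)
    show "H z \<notin> \<real>\<^sub>\<le>\<^sub>0" if "z \<in> B" for z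
      using Hre[OF that] by (auto simp: complex_nonpos_Reals_iff)
  qed
  have ih: "(\<lambda>y. 1 / h y) holomorphic_on B" using hh hnz by (intro holomorphic_intros)
  obtain T0 where T0: "\<And>y. y \<in> B \<Longrightarrow> (T0 has_field_derivative 1 / h y) (at y within B)"
    using holomorphic_convex_primitive'[OF _ _ ih] unfolding B_def by (metis convex_ball open_ball)
  define T where "T = (\<lambda>y. T0 y - T0 0)"
  have B: "open B" "0 \<in> B" using \<rho>(1) by (auto simp: B_def)
  have T: "(T has_field_derivative 1 / h y) (at y)" if "y \<in> B" for y
    unfolding T_def using T0[OF that] at_within_open[OF that B(1)] by (auto intro!: derivative_eq_intros)
  have Th: "T holomorphic_on B"
    unfolding holomorphic_on_def field_differentiable_def using T has_field_derivative_at_within by blast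
  have dT: "deriv T y = 1 / h y" if "y \<in> B" for y using T[OF that] by (rule DERIV_imp_deriv)
  have "deriv T 0 \<noteq> 0" using dT[OF B(2)] hnz[OF B(2)] by simp
  then obtain \<delta> where \<delta>: "\<delta> > 0" "ball 0 \<delta> \<subseteq> B" "open (T ` ball 0 \<delta>)" "inj_on T (ball 0 \<delta>)"
    using has_complex_derivative_locally_invertible[OF Th B(2,1)] by metis
  define D where "D = ball (0::complex) \<delta>"
  have TD: "T holomorphic_on D" using Th \<delta> holomorphic_on_subset unfolding D_def by blast
  obtain y where y: "y holomorphic_on (T ` D)" "\<And>z. z \<in> D \<Longrightarrow> deriv T z * deriv y (T z) = 1" "\<And>z. z \<in> D \<Longrightarrow> y (T z) = z"
    using holomorphic_has_inverse[OF TD] \<delta> unfolding D_def by (metis open_ball)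
  have T00: "T 0 = 0" by (simp add: T_def)
  have "0 \<in> T ` D" using T00 \<delta>(1) by (metis D_def centre_in_ball imageI)
  then obtain r where r: "r > 0" "ball 0 r \<subseteq> T ` D" using \<delta>(3) openE unfolding D_def by blast
  have yT: "T (y w) = w" "y w \<in> D" "deriv y w = h (y w)" if w: "w \<in> ball 0 r" for w
  proof -
    obtain z where z: "z \<in> D" "w = T z" using r w by blast
    thus "T (y w) = w" "y w \<in> D" using y(3) by auto
    have "1 / h z * deriv y w = 1" using y(2)[OF z(1)] dT[of z] z \<delta> by (auto simp: D_def)
    moreover have "h z \<noteq> 0" using hnz[of z] z \<delta> by (auto simp: D_def)
    ultimately show "deriv y w = h (y w)" using y(3)[OF z(1)] z(2) by (simp add: field_simps)
  qed
  have y0: "y 0 = 0" using y(3)[of 0] T00 \<delta>(1) by (simp add: D_def)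
  have ynz: "y w \<noteq> 0" if "w \<in> ball 0 r" "w \<noteq> 0" for w using yT(1)[OF that(1)] that(2) T00 by auto
  have yh: "y holomorphic_on ball 0 r" using y(1) r holomorphic_on_subset by blast
  have ya: "y analytic_on {w}" if "w \<in> ball 0 r" for w using yh that analytic_at by blast
  define v where "v = (\<lambda>w. inverse (y w ^ 2))"
  have ev0: "eventually (\<lambda>w. w \<in> ball 0 r - {0}) (at 0)" using r(1) by (intro eventually_at_in_open) auto
  have "isolated_zero (\<lambda>w. y w ^ 2) 0"
  proof (subst isolated_zero_analytic_iff)
    show "(\<lambda>w. y w ^ 2) analytic_on {0}" using ya[of 0] r(1) by (intro analytic_intros) auto
    show "(y 0)\<^sup>2 = 0 \<and> (\<forall>\<^sub>F z in at 0. (y z)\<^sup>2 \<noteq> 0)"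
      using ev0 ynz y0 by (auto elim!: eventually_mono)
  qed
  hence pole: "is_pole v 0" unfolding v_def by (simp add: is_pole_inverse_iff)
  have van: "v analytic_on {w}" if "w \<in> ball 0 r" "w \<noteq> 0" for w
    unfolding v_def using ya[OF that(1)] ynz[OF that] by (intro analytic_intros) auto
  have ode: "deriv v w ^ 2 = poly (cubic e1 e2 e3) (v w)" if w: "w \<in> ball 0 r" "w \<noteq> 0" for w
  proof -
    have nz: "y w \<noteq> 0" using ynz[OF w] .
    have "(y has_field_derivative h (y w)) (at w)"
      using holomorphic_derivI[OF yh open_ball w(1)] yT(3)[OF w(1)] by simp
    hence "(v has_field_derivative - (2 * y w * h (y w)) / (y w ^ 2) ^ 2) (at w)"
      unfolding v_def using nz by (auto intro!: derivative_eq_intros simp: divide_inverse power_inverse power2_eq_square)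
    hence "deriv v w = - (2 * y w * h (y w)) / (y w ^ 2) ^ 2" by (rule DERIV_imp_deriv)
    also have "\<dots> ^ 2 = 4 * H (y w) / y w ^ 6"
      using nz h2[of "y w"] by (simp add: power_divide power_mult_distrib flip: power_mult) (simp add: field_simps eval_nat_numeral)
    also have "\<dots> = poly (cubic e1 e2 e3) (v w)"
      using nz by (simp add: poly_cubic H_def v_def field_simps eval_nat_numeral)
    finally show ?thesis .
  qed
  have mero: "v meromorphic_on ball 0 r" unfolding v_def
    using yh by (intro meromorphic_intros analytic_on_imp_meromorphic_on) (simp add: analytic_on_open)
  have "v nicely_meromorphic_on ball 0 r"
    unfolding nicely_meromorphic_on_def
  proof (intro conjI mero ballI)
    fix w :: complex assume w: "w \<in> ball 0 r"
    show "is_pole v w \<and> v w = 0 \<or> v \<midarrow>w\<rightarrow> v w"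
    proof (cases "w = 0")
      case True thus ?thesis using pole y0 by (simp add: v_def)
    next
      case False
      thus ?thesis using analytic_at_imp_isCont[OF van[OF w]] by (simp add: isCont_def)
    qed
  qed
  moreover have "eventually (\<lambda>w. deriv v w ^ 2 = poly (cubic e1 e2 e3) (v w)) (at 0)"
    using ev0 by eventually_elim (use ode in auto)
  ultimately show ?thesis using r(1) pole by blast
qed

text \<open>The rational function that expresses \<open>V(2 z)\<close> by \<open>V(z)\<close> for a solution
  of \<open>V'^2 = 4 \<Prod> (V - e_j)\<close> with a pole at 0.\<close>

definition duplication :: "complex \<Rightarrow> complex \<Rightarrow> complex \<Rightarrow> complex \<Rightarrow> complex" where
  "duplication e1 e2 e3 x = e1 + ((x - e1)^2 - (e1 - e2) * (e1 - e3))^2 / (4 * (x - e1) * (x - e2) * (x - e3))"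

text \<open>With \<open>Q\<close> the cubic, the duplication function \<open>R\<close> satisfies \<open>R'^2
  Q = 4 Q(R)\<close>. It is symmetric in the roots although its definition prefers
  \<open>e_1\<close>: \<open>R - e_j = N_j^2 / Q\<close> for each \<open>j\<close>, where
  \<open>N_j = (x - e_j)^2 - (e_j - e_k)(e_j - e_l)\<close>. Hence \<open>Q(R) = 4 (N_1 N_2 N_3)^2
  / Q^3\<close>, while \<open>R' = 4 N_1 N_2 N_3 / Q^2\<close>.\<close>

lemma duplication_ode:
  fixes e1 e2 e3 x :: complex
  assumes Q: "4 * (x - e1) * (x - e2) * (x - e3) \<noteq> 0"
  shows "\<exists>d. (duplication e1 e2 e3 has_field_derivative d) (at x) \<and>
     d^2 * (4 * (x - e1) * (x - e2) * (x - e3)) =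
     4 * poly (cubic e1 e2 e3) (duplication e1 e2 e3 x)"
proof -
  define N1 where "N1 = (x - e1)^2 - (e1 - e2) * (e1 - e3)"
  define N2 where "N2 = (x - e2)^2 - (e2 - e1) * (e2 - e3)"
  define N3 where "N3 = (x - e3)^2 - (e3 - e1) * (e3 - e2)"
  define q where "q = 4 * (x - e1) * (x - e2) * (x - e3)"
  define q' where "q' = 4 * ((x - e2) * (x - e3) + (x - e1) * (x - e3) + (x - e1) * (x - e2))"
  have q: "q \<noteq> 0" using Q by (simp add: q_def)
  have R: "duplication e1 e2 e3 x = e1 + N1^2 / q" by (simp add: duplication_def N1_def q_def)
  have n2: "N1^2 + (e1 - e2) * q = N2^2" unfolding N1_def N2_def q_def by algebra
  have n3: "N1^2 + (e1 - e3) * q = N3^2" unfolding N1_def N3_def q_def by algebra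
  have m: "4 * (x - e1) * q - N1 * q' = 4 * N2 * N3" unfolding N1_def N2_def N3_def q_def q'_def by algebra
  have dq: "((\<lambda>x. 4 * (x - e1) * (x - e2) * (x - e3)) has_field_derivative q') (at x)"
    unfolding q'_def by (auto intro!: derivative_eq_intros simp: algebra_simps)
  have dN: "((\<lambda>x. ((x - e1)^2 - (e1 - e2) * (e1 - e3))^2) has_field_derivative 4 * (x - e1) * N1) (at x)"
    unfolding N1_def by (auto intro!: derivative_eq_intros)
  have "(duplication e1 e2 e3 has_field_derivative 0 + (4 * (x - e1) * N1 * q - N1^2 * q') / (q * q)) (at x)"
    unfolding duplication_def[abs_def] q_def N1_def
    by (rule DERIV_add[OF DERIV_const DERIV_divide[OF dN[unfolded N1_def] dq Q]])
  also have "4 * (x - e1) * N1 * q - N1^2 * q' = N1 * (4 * N2 * N3)"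
    unfolding m[symmetric] by (simp add: algebra_simps power2_eq_square)
  finally have d: "(duplication e1 e2 e3 has_field_derivative (N1 * (4 * N2 * N3)) / (q * q)) (at x)" by simp
  have "poly (cubic e1 e2 e3) (duplication e1 e2 e3 x) =
     4 * (N1^2 / q) * ((N1^2 + (e1 - e2) * q) / q) * ((N1^2 + (e1 - e3) * q) / q)"
    unfolding poly_cubic R using q by (simp add: field_simps)
  also have "4 * \<dots> = ((N1 * (4 * N2 * N3)) / (q * q))^2 * q"
    unfolding n2 n3 using q by (simp add: field_simps power2_eq_square)
  finally show ?thesis using d by (auto simp: q_def)
qed

lemma eventually_half:
  assumes "eventually P (at (0::complex))"
  shows "eventually (\<lambda>z. P (z / 2)) (at 0)"
proof -
  have "eventually P (filtermap (\<lambda>z. (1/2) * z + 0) (at 0))"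
    using assms by (subst filtermap_affine_at) simp_all
  thus ?thesis by (simp add: eventually_filtermap)
qed

text \<open>The function \<open>R(v(z/2))\<close> solves the same equation as \<open>v\<close>, the factor 4
  in \<open>R'^2 Q = 4 Q(R)\<close> being absorbed by the chain rule, and it has a pole at 0 as
  well. A pole determines the solution.\<close>

lemma duplication_of_solution:
  fixes e1 e2 e3 :: complex
  assumes v: "v meromorphic_on {0}" "is_pole v 0"
    and ode: "eventually (\<lambda>w. deriv v w ^ 2 = poly (cubic e1 e2 e3) (v w)) (at 0)"
  shows "eventually (\<lambda>z. duplication e1 e2 e3 (v (z / 2)) = v z) (at 0)"
proof (rule cubic_pole_unique[OF degree_cubic _ _ _ v ode])
  define W where "W = (\<lambda>z. duplication e1 e2 e3 (v (z / 2)))"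
  define v2 where "v2 = (\<lambda>z. v (z / 2))"
  have v2: "v2 meromorphic_on {0}" "is_pole v2 0"
  proof -
    show "v2 meromorphic_on {0}" unfolding v2_def
      by (rule meromorphic_on_compose[OF v(1)]) (auto intro!: analytic_intros)
    show "is_pole v2 0" using is_pole_affine_iff[of "1/2" v 0 0] v(2) by (simp add: v2_def)
  qed
  show Wm: "W meromorphic_on {0}" unfolding W_def duplication_def v2_def[symmetric]
    using v2(1)[unfolded v2_def] by (intro meromorphic_intros)
  note inv = inverse_at_pole[OF v2]
  define s where "s = remove_sings (\<lambda>z. inverse (v2 z))"
  have s: "s analytic_on {0}" "s 0 = 0" "eventually (\<lambda>w. v2 w \<noteq> 0 \<and> s w = inverse (v2 w)) (at 0)"
    using inv by (auto simp: s_def elim: eventually_mono)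
  \<comment> \<open>In \<open>s = 1/x\<close> the duplication function is \<open>e_1 + A(s) / (s B(s))\<close>
    with \<open>A(0) = 1\<close> and \<open>B(0) = 4\<close>, so it has a pole at \<open>s =
    0\<close>.\<close>
  define A where "A = (\<lambda>s. ((1 - e1 * s)^2 - (e1 - e2) * (e1 - e3) * s^2)^2)"
  define B where "B = (\<lambda>s. 4 * (1 - e1 * s) * (1 - e2 * s) * (1 - e3 * s))"
  have "filterlim s (at 0) (at 0)"
    unfolding filterlim_at using s(3) analytic_at_imp_isCont[OF s(1)] s(2)
    by (auto simp: isCont_def elim: eventually_mono)
  moreover have "isCont (\<lambda>z. A (s z) / B (s z)) 0"
    using analytic_at_imp_isCont[OF s(1)] s(2) unfolding A_def B_def by (intro continuous_intros) auto
  ultimately have "is_pole (\<lambda>z. (A (s z) / B (s z)) / s z) 0"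
    using s(2) by (intro is_pole_divide) (auto simp: A_def B_def)
  hence "is_pole (\<lambda>z. (A (s z) / B (s z)) / s z + e1) 0" by (rule iffD1[OF is_pole_plus_const_iff])
  moreover have "eventually (\<lambda>z. (A (s z) / B (s z)) / s z + e1 = W z) (at 0)"
    using s(3)
  proof eventually_elim
    case (elim z)
    define x where "x = v2 z"
    have x: "x \<noteq> 0" "s z = 1 / x" using elim by (auto simp: x_def inverse_eq_divide)
    have "A (1 / x) = ((x - e1)^2 - (e1 - e2) * (e1 - e3))^2 / x^4"
    proof -
      have "(1 - e1 * (1 / x))^2 - (e1 - e2) * (e1 - e3) * (1 / x)^2 = ((x - e1)^2 - (e1 - e2) * (e1 - e3)) / x^2"
        using x(1) by (simp add: divide_simps)
      thus ?thesis by (simp add: A_def power_divide flip: power_mult)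
    qed
    moreover have "B (1 / x) = (4 * (x - e1) * (x - e2) * (x - e3)) / x^3"
      using x(1) by (simp add: B_def field_simps eval_nat_numeral)
    ultimately have "(A (s z) / B (s z)) / s z = 
       ((x - e1)^2 - (e1 - e2) * (e1 - e3))^2 / (4 * (x - e1) * (x - e2) * (x - e3))"
      unfolding x(2) using x(1) by (simp add: eval_nat_numeral)
    thus ?case by (simp add: W_def duplication_def x_def v2_def)
  qed
  ultimately show "is_pole W 0" by (rule is_pole_transform) simp
  have iso: "isolated_singularity_at v 0" using v(1) by (simp add: meromorphic_at_iff)
  hence an: "eventually (\<lambda>w. v analytic_on {w}) (at 0)" by (simp add: isolated_singularity_at_altdef)
  \<comment> \<open>Near its pole \<open>v\<close> avoids the zeros of the cubic.\<close>
  define K where "K = norm e1 + norm e2 + norm e3 + 1"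
  have K: "K > 0" by (simp add: K_def add_nonneg_pos)
  have "eventually (\<lambda>w. norm (v w) \<ge> K) (at 0)"
    using v(2) K unfolding is_pole_def filterlim_at_infinity[OF order.refl] by blast
  hence big: "eventually (\<lambda>w. 4 * (v w - e1) * (v w - e2) * (v w - e3) \<noteq> 0) (at 0)"
  proof eventually_elim
    case (elim w)
    have "norm (v w) > norm e1" "norm (v w) > norm e2" "norm (v w) > norm e3"
      using elim norm_ge_zero[of e1] norm_ge_zero[of e2] norm_ge_zero[of e3] unfolding K_def by linarith+
    hence "v w \<noteq> e1" "v w \<noteq> e2" "v w \<noteq> e3" by auto
    thus ?case by simp
  qed
  show "eventually (\<lambda>w. deriv W w ^ 2 = poly (cubic e1 e2 e3) (W w)) (at 0)"
    using eventually_half[OF an] eventually_half[OF big] eventually_half[OF ode]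
  proof eventually_elim
    case (elim z)
    define x where "x = v (z / 2)"
    obtain d where d: "(duplication e1 e2 e3 has_field_derivative d) (at x)"
      "d^2 * (4 * (x - e1) * (x - e2) * (x - e3)) = 4 * poly (cubic e1 e2 e3) (duplication e1 e2 e3 x)"
      using duplication_ode[of x e1 e2 e3] elim(2) by (auto simp: x_def)
    have "(v has_field_derivative deriv v (z / 2)) (at (z / 2))"
      using elim(1) analytic_on_imp_differentiable_at DERIV_deriv_iff_field_differentiable by blast
    moreover have "((\<lambda>z. z / 2) has_field_derivative 1 / 2) (at z)" by (auto intro!: derivative_eq_intros)
    ultimately have "((\<lambda>z. v (z / 2)) has_field_derivative deriv v (z / 2) * (1 / 2)) (at z)"
      by (rule DERIV_chain2)
    from DERIV_chain2[OF d(1)[unfolded x_def] this]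
    have "deriv W z = d * (deriv v (z / 2) * (1 / 2))" unfolding W_def by (rule DERIV_imp_deriv)
    hence "deriv W z ^ 2 = (d * (deriv v (z / 2) * (1 / 2))) ^ 2" by (simp only:)
    also have "\<dots> = d^2 * deriv v (z / 2) ^ 2 / 4" by (simp add: power_mult_distrib power_divide)
    also have "deriv v (z / 2) ^ 2 = 4 * (x - e1) * (x - e2) * (x - e3)" using elim(3) by (simp add: poly_cubic x_def)
    also have "d^2 * (4 * (x - e1) * (x - e2) * (x - e3)) / 4 = poly (cubic e1 e2 e3) (duplication e1 e2 e3 x)"
      unfolding d(2) by simp
    finally show ?case by (simp add: W_def x_def)
  qed
qed

lemma nicely_meromorphic_cong:
  assumes "f nicely_meromorphic_on A" "open A" "\<And>z. z \<in> A \<Longrightarrow> f z = g z"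
  shows "g nicely_meromorphic_on A"
proof -
  have ev: "eventually (\<lambda>w. f w = g w) (at z)" if "z \<in> A" for z
    using eventually_at_in_open'[OF assms(2) that] by eventually_elim (use assms(3) in auto)
  have "g meromorphic_on A" using meromorphic_on_cong[OF ev refl] assms(1) by (simp add: nicely_meromorphic_on_def)
  moreover have "is_pole g z \<and> g z = 0 \<or> g \<midarrow>z\<rightarrow> g z" if z: "z \<in> A" for z
    using assms(1,3) z is_pole_cong[OF ev[OF z] refl] tendsto_cong[OF ev[OF z]]
    unfolding nicely_meromorphic_on_def by metis
  ultimately show ?thesis by (simp add: nicely_meromorphic_on_def)
qed

text \<open>If \<open>F\<close> continues \<open>v\<close> to a disc, then \<open>R(F(z/2))\<close>
  continues \<open>v\<close> to the disc of twice the radius.\<close>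

lemma cubic_solution_extension:
  assumes r: "r > 0" and v: "v nicely_meromorphic_on ball 0 r" "is_pole v 0"
    and ode: "eventually (\<lambda>w. deriv v w ^ 2 = poly (cubic e1 e2 e3) (v w)) (at 0)"
  shows "\<exists>F. F nicely_meromorphic_on ball 0 (2 ^ n * r) \<and> eventually (\<lambda>z. F z = v z) (at 0)"
proof (induction n)
  case 0
  show ?case using v by (intro exI[of _ v]) auto
next
  case (Suc n)
  then obtain F where F: "F nicely_meromorphic_on ball 0 (2 ^ n * r)" "eventually (\<lambda>z. F z = v z) (at 0)" by blast
  define G where "G = (\<lambda>z. duplication e1 e2 e3 (F (z / 2)))"
  have "(\<lambda>z. F (z / 2)) meromorphic_on ball 0 (2 ^ Suc n * r)"
  proof (rule meromorphic_on_compose[where g = F])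
    show "F meromorphic_on ball 0 (2 ^ n * r)" using F by (simp add: nicely_meromorphic_on_def)
  qed (auto intro!: analytic_intros simp: norm_divide)
  hence G: "G meromorphic_on ball 0 (2 ^ Suc n * r)"
    unfolding G_def duplication_def by (intro meromorphic_intros)
  have "v meromorphic_on {0}" using v r by (auto simp: nicely_meromorphic_on_def intro: meromorphic_on_subset)
  note dup = duplication_of_solution[OF this v(2) ode]
  have "isolated_singularity_at G 0" using G r by (auto simp: meromorphic_on_altdef)
  from eventually_remove_sings_eq_at[OF this] dup eventually_half[OF F(2)]
  have "eventually (\<lambda>z. remove_sings G z = v z) (at 0)"
    by eventually_elim (simp add: G_def)
  moreover have "remove_sings G nicely_meromorphic_on ball 0 (2 ^ Suc n * r)"
    by (rule remove_sings_nicely_meromorphic[OF G])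
  ultimately show ?case by blast
qed

lemma global_cubic_solution:
  fixes e1 e2 e3 :: complex
  shows "\<exists>V. V \<in> nonconst_meromorphic_solutions (first_order_ode (cubic e1 e2 e3)) \<and> is_pole V 0"
proof -
  obtain r v where r: "r > 0" and v: "v nicely_meromorphic_on ball 0 r" "is_pole v 0"
    and ode: "eventually (\<lambda>w. deriv v w ^ 2 = poly (cubic e1 e2 e3) (v w)) (at 0)"
    using local_cubic_solution by metis
  obtain F where F: "\<And>n. F n nicely_meromorphic_on ball 0 (2 ^ n * r)" "\<And>n. eventually (\<lambda>z. F n z = v z) (at 0)"
    using cubic_solution_extension[OF r v ode] by metis
  have agree: "F m z = F n z" if "z \<in> ball 0 (2 ^ m * r)" "m \<le> n" for m n z
  proof (rule nicely_meromorphic_identity(1)[of "F m" "ball 0 (2 ^ m * r)" "F n" 0 z])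
    have "2 ^ m * r \<le> 2 ^ n * r" using that(2) r by (intro mult_right_mono) (auto intro: power_increasing)
    thus "F n nicely_meromorphic_on ball 0 (2 ^ m * r)"
      by (intro nicely_meromorphic_on_subset[OF F(1)]) auto
    show "eventually (\<lambda>z. F m z = F n z) (at 0)" using F(2)[of m] F(2)[of n] by eventually_elim simp
  qed (use F that r in auto)
  have ex: "\<exists>n. norm z < 2 ^ n * r" for z :: complex
    using real_arch_pow[of 2 "norm z / r"] r by (auto simp: field_simps)
  \<comment> \<open>The continuations to growing discs agree where they are both defined; \<open>V z\<close> is
    taken from the first disc containing \<open>z\<close>.\<close>
  define N where "N = (\<lambda>z::complex. LEAST n. norm z < 2 ^ n * r)"
  define V where "V = (\<lambda>z. F (N z) z)"
  have VF: "F n z = V z" if "z \<in> ball 0 (2 ^ n * r)" for n z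
  proof -
    have "N z \<le> n" unfolding N_def using that by (intro Least_le) simp
    moreover have "norm z < 2 ^ N z * r" unfolding N_def by (rule LeastI_ex[OF ex])
    ultimately show ?thesis using agree[of z "N z" n] by (simp add: V_def)
  qed
  have Vb: "V nicely_meromorphic_on ball 0 (2 ^ n * r)" for n
    by (rule nicely_meromorphic_cong[OF F(1) open_ball VF])
  have V: "V nicely_meromorphic_on UNIV"
  proof -
    have "V nicely_meromorphic_on {z}" for z
    proof -
      obtain n where "norm z < 2 ^ n * r" using ex by blast
      thus ?thesis by (intro nicely_meromorphic_on_subset[OF Vb[of n]]) simp
    qed
    thus ?thesis unfolding nicely_meromorphic_on_def using meromorphic_on_meromorphic_at[of V UNIV] by blast
  qed
  have "eventually (\<lambda>z. z \<in> ball 0 (2 ^ 0 * r)) (at 0)" using r by (intro eventually_at_in_open') auto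
  hence Vv: "eventually (\<lambda>z. V z = v z) (at 0)" using F(2)[of 0]
    by eventually_elim (use VF[where n = 0] in auto)
  have pole: "is_pole V 0" using is_pole_cong[OF Vv refl] v(2) by blast
  from Vv eventually_at_imp_eventually_nhds[OF Vv] ode
  have "eventually (\<lambda>z. deriv V z ^ 2 = poly (cubic e1 e2 e3) (V z)) (at 0)"
  proof eventually_elim
    case (elim z)
    have "deriv V z = deriv v z" using elim(2) by (intro deriv_cong_ev) auto
    thus ?case using elim by simp
  qed
  hence "meromorphic_solution (first_order_ode (cubic e1 e2 e3)) V" by (rule first_order_solutionI[OF V])
  moreover have "\<not> V constant_on UNIV"
    using pole not_is_pole_const by (metis UNIV_I constant_on_def ext)
  ultimately show ?thesis using pole by (auto simp: nonconst_meromorphic_solutions_def)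
qed

section \<open>Uniformization of the cubic equation\<close>

lemma discrete_minimal:
  fixes S :: "complex set"
  assumes fin: "\<And>B. finite {g \<in> S. norm g < B}" and ne: "S \<noteq> {}"
  obtains m where "m \<in> S" "\<And>g. g \<in> S \<Longrightarrow> norm m \<le> norm g"
proof -
  obtain s where s: "s \<in> S" using ne by blast
  define F where "F = {g \<in> S. norm g < norm s + 1}"
  have F: "finite F" "s \<in> F" using fin s by (auto simp: F_def)
  have "Min (norm ` F) \<in> norm ` F" using F by (intro Min_in) auto
  then obtain m where m: "m \<in> F" "norm m = Min (norm ` F)" by (metis imageE)
  have "norm m \<le> norm g" if "g \<in> S" for g
  proof (cases "g \<in> F")
    case True thus ?thesis using m F by simp
  next
    case False
    have "norm m \<le> norm s" using m F by simp
    thus ?thesis using False that by (auto simp: F_def)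
  qed
  thus ?thesis using that m by (auto simp: F_def)
qed

lemma int_multiple_in_group:
  fixes G :: "complex set"
  assumes zero: "0 \<in> G" and diff: "\<And>x y. x \<in> G \<Longrightarrow> y \<in> G \<Longrightarrow> x - y \<in> G" and x: "x \<in> G"
  shows "of_int n * x \<in> G"
proof -
  have um: "- y \<in> G" if "y \<in> G" for y using diff[OF zero that] by simp
  have "of_nat m * x \<in> G" for m
  proof (induction m)
    case (Suc m)
    thus ?case using diff[OF Suc um[OF x]] by (simp add: algebra_simps)
  qed (use zero in simp)
  from this[of "nat n"] um[OF this[of "nat (- n)"]] show ?thesis by (cases "n \<ge> 0") auto
qed

text \<open>A shortest nonzero element \<open>\<omega>_1\<close> and a shortest element
  \<open>\<omega>_2\<close> outside its multiples form a basis. Reducing the real coordinates of a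
  group element to absolute value at most 1/2 leaves a remainder shorter than
  \<open>\<omega>_2\<close>, which is therefore a multiple of \<open>\<omega>_1\<close>. The rank
  hypothesis says that the group is not cyclic.\<close>

lemma discrete_group_is_lattice:
  fixes G :: "complex set"
  assumes fin: "\<And>B. finite {g \<in> G. norm g < B}" and zero: "0 \<in> G"
    and diff: "\<And>x y. x \<in> G \<Longrightarrow> y \<in> G \<Longrightarrow> x - y \<in> G"
    and rank: "\<And>\<omega>. \<omega> \<in> G \<Longrightarrow> \<exists>g\<in>G. \<forall>n. g \<noteq> of_int n * \<omega>"
  shows "is_period_lattice G"
proof -
  have um: "- x \<in> G" if "x \<in> G" for x using diff[OF zero that] by simp
  have add: "x + y \<in> G" if "x \<in> G" "y \<in> G" for x y using diff[OF that(1) um[OF that(2)]] by simp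
  note int_mult = int_multiple_in_group[of G, OF zero diff]
  have finS: "finite {g \<in> S. norm g < B}" if "S \<subseteq> G" for S B
    by (rule finite_subset[OF _ fin[of B]]) (use that in auto)
  have "G - {0} \<noteq> {}" using rank[OF zero] by auto
  then obtain \<omega>1 where w1: "\<omega>1 \<in> G - {0}" "\<And>g. g \<in> G - {0} \<Longrightarrow> norm \<omega>1 \<le> norm g"
    using discrete_minimal[OF finS[of "G - {0}"]] by auto
  define Z where "Z = range (\<lambda>n::int. of_int n * \<omega>1)"
  have "G - Z \<noteq> {}" using rank[of \<omega>1] w1 by (auto simp: Z_def)
  then obtain \<omega>2 where w2: "\<omega>2 \<in> G - Z" "\<And>g. g \<in> G - Z \<Longrightarrow> norm \<omega>2 \<le> norm g"
    using discrete_minimal[OF finS[of "G - Z"]] by auto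
  have small: "g = 0" if "g \<in> G" "norm g < norm \<omega>1" for g
    using w1(2)[of g] that by fastforce
  define D where "D = Im (cnj \<omega>1 * \<omega>2)"
  \<comment> \<open>If the two elements were parallel, subtracting the integral part of their quotient would leave
    an element shorter than \<open>\<omega>_1\<close>.\<close>
  have D: "D \<noteq> 0"
  proof
    assume "D = 0"
    define t where "t = Re (\<omega>2 / \<omega>1)"
    have "\<omega>2 / \<omega>1 = of_real t"
    proof (rule complex_eqI)
      have "Im (\<omega>2 / \<omega>1) = D / norm \<omega>1 ^ 2"
        by (simp add: D_def Im_divide cmod_power2 algebra_simps)
      thus "Im (\<omega>2 / \<omega>1) = Im (of_real t)" using \<open>D = 0\<close> by simp
    qed (simp add: t_def)
    hence t: "\<omega>2 = of_real t * \<omega>1" using w1(1) by (simp add: field_simps)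
    have "\<omega>2 - of_int \<lfloor>t\<rfloor> * \<omega>1 \<in> G" using w1 w2 int_mult diff by auto
    moreover have e: "\<omega>2 - of_int \<lfloor>t\<rfloor> * \<omega>1 = of_real (frac t) * \<omega>1"
      by (simp add: t frac_def algebra_simps)
    moreover have "norm (of_real (frac t) * \<omega>1) < norm \<omega>1"
      using frac_lt_1[of t] frac_ge_0[of t] w1(1) by (simp add: norm_mult)
    ultimately have "\<omega>2 - of_int \<lfloor>t\<rfloor> * \<omega>1 = 0" using small by metis
    hence "\<omega>2 \<in> Z" by (auto simp: Z_def)
    thus False using w2 by blast
  qed
  have "G = period_lattice \<omega>1 \<omega>2"
  proof (intro equalityI subsetI)
    fix g assume "g \<in> period_lattice \<omega>1 \<omega>2"
    thus "g \<in> G" using w1 w2 int_mult add by (auto simp: period_lattice_def)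
  next
    fix g assume g: "g \<in> G"
    obtain x y where gxy: "g = of_real x * \<omega>1 + of_real y * \<omega>2"
      using real_coordinates[of \<omega>1 \<omega>2 g] D unfolding D_def by blast
    define a where "a = x - of_int (round x)"
    define b where "b = y - of_int (round y)"
    have ab: "\<bar>a\<bar> \<le> 1 / 2" "\<bar>b\<bar> \<le> 1 / 2"
      using of_int_round_abs_le[of x] of_int_round_abs_le[of y] by (simp_all add: a_def b_def abs_minus_commute)
    define X where "X = of_real a * \<omega>1"
    define Y where "Y = of_real b * \<omega>2"
    define g' where "g' = g - of_int (round x) * \<omega>1 - of_int (round y) * \<omega>2"
    have g': "g' = X + Y" unfolding g'_def gxy X_def Y_def a_def b_def by (simp add: algebra_simps)
    have "g' \<in> G" unfolding g'_def using g w1 w2 int_mult diff by auto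
    have nX: "norm X \<le> norm \<omega>1 / 2" "norm Y \<le> norm \<omega>2 / 2"
      using ab mult_right_mono[of "\<bar>a\<bar>" "1/2" "norm \<omega>1"] mult_right_mono[of "\<bar>b\<bar>" "1/2" "norm \<omega>2"]
      by (simp_all add: X_def Y_def norm_mult)
    have w12: "norm \<omega>1 \<le> norm \<omega>2" "norm \<omega>1 > 0" using w1 w2 by (auto simp: Z_def intro!: w1(2))
    \<comment> \<open>The bound \<open>|X| + |Y| \<le> |\<omega>_2|\<close> is not strict; equality in the
      triangle inequality makes \<open>X\<close> and \<open>Y\<close> parallel, so that one of
      them is 0.\<close>
    have "norm g' < norm \<omega>2"
    proof (cases "norm (X + Y) = norm X + norm Y")
      case False
      hence "norm (X + Y) < norm X + norm Y" using norm_triangle_ineq[of X Y] by linarith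
      thus ?thesis using nX w12 g' by simp
    next
      case True
      hence "norm X *\<^sub>R Y = norm Y *\<^sub>R X" by (simp add: norm_triangle_eq)
      hence "cnj X * (norm X *\<^sub>R Y) = cnj X * (norm Y *\<^sub>R X)" by simp
      hence "Im (cnj X * (norm X *\<^sub>R Y)) = Im (cnj X * (norm Y *\<^sub>R X))" by simp
      hence "norm X * (a * b * D) = 0"
        by (simp add: X_def Y_def D_def algebra_simps)
      hence "X = 0 \<or> Y = 0" using D w12 by (auto simp: X_def Y_def)
      hence "norm g' = norm X \<or> norm g' = norm Y" using g' by auto
      thus ?thesis using nX w12 by linarith
    qed
    hence "g' \<in> Z" using w2(2)[of g'] \<open>g' \<in> G\<close> by auto
    then obtain n where "g' = of_int n * \<omega>1" by (auto simp: Z_def)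
    hence "g = of_int (n + round x) * \<omega>1 + of_int (round y) * \<omega>2"
      unfolding g'_def by (simp add: algebra_simps)
    thus "g \<in> period_lattice \<omega>1 \<omega>2" unfolding period_lattice_def by blast
  qed
  thus ?thesis using D unfolding is_period_lattice_def D_def by blast
qed

text \<open>The composite solution also has a pole at \<open>p\<close>, and a pole determines the solution.
  For \<open>a = 1\<close> differences of poles are periods; for \<open>a = -1\<close> the
  solution is symmetric about each pole.\<close>

lemma cubic_solution_period:
  assumes V: "V \<in> nonconst_meromorphic_solutions (first_order_ode (cubic e1 e2 e3))"
    and a: "a^2 = 1" and p: "is_pole V p" "is_pole V q"
  shows "V (a * z + (q - a * p)) = V z"
proof -
  define W where "W = (\<lambda>z. V (a * z + (q - a * p)))"
  have W: "W \<in> nonconst_meromorphic_solutions (first_order_ode (cubic e1 e2 e3))"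
    unfolding W_def by (rule nonconst_solution_affine[OF V a])
  have anz: "a \<noteq> 0" using a by auto
  have n: "V nicely_meromorphic_on UNIV" "W nicely_meromorphic_on UNIV"
    using V W by (auto simp: nonconst_meromorphic_solutions_def meromorphic_solution_def)
  have m: "V meromorphic_on {p}" "W meromorphic_on {p}"
    using n by (auto simp: nicely_meromorphic_on_def intro: meromorphic_on_subset)
  have "is_pole W p" unfolding W_def using is_pole_affine_iff[OF anz, of V "q - a * p" p] p by simp
  moreover have "meromorphic_solution (first_order_ode (cubic e1 e2 e3)) W"
    "meromorphic_solution (first_order_ode (cubic e1 e2 e3)) V"
    using V W by (simp_all add: nonconst_meromorphic_solutions_def)
  ultimately have "eventually (\<lambda>w. W w = V w) (at p)"
    using cubic_pole_unique[OF degree_cubic m(2) _ _ m(1) p(1)] first_order_solutionD by blast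
  hence "W = V" by (rule nicely_meromorphic_eqI[OF n(2,1)])
  hence "W z = V z" by simp
  thus ?thesis by (simp add: W_def)
qed

lemma first_order_solution_unique:
  assumes U: "U \<in> nonconst_meromorphic_solutions (first_order_ode Q)"
    and W: "W \<in> nonconst_meromorphic_solutions (first_order_ode Q)"
    and np: "\<not> is_pole U z0" "\<not> is_pole W z0"
    and init: "U z0 = W z0" "deriv U z0 = deriv W z0"
  shows "U = W"
proof -
  have n: "U nicely_meromorphic_on UNIV" "W nicely_meromorphic_on UNIV"
    using U W by (auto simp: nonconst_meromorphic_solutions_def meromorphic_solution_def)
  have an: "U analytic_on {z0}" "W analytic_on {z0}"
    using nicely_meromorphic_on_imp_analytic_at n np by blast+
  have so: "eventually (\<lambda>w. deriv (deriv V) w = poly (smult (1/2) (pderiv Q)) (V w)) (nhds z0)"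
    if V: "V \<in> nonconst_meromorphic_solutions (first_order_ode Q)" "\<not> is_pole V z0" for V
  proof -
    have "V nicely_meromorphic_on UNIV"
      using V by (auto simp: nonconst_meromorphic_solutions_def meromorphic_solution_def)
    from eventually_analytic_at[OF this, of z0]
    have "eventually (\<lambda>w. \<not> is_pole V w) (at z0)" by eventually_elim simp
    hence "eventually (\<lambda>w. \<not> is_pole V w) (nhds z0)"
      using V(2) by (simp add: eventually_nhds_conv_at)
    thus ?thesis by eventually_elim (use nonconst_second_order[OF V(1)] in auto)
  qed
  have "eventually (\<lambda>w. U w = W w) (nhds z0)"
    by (rule second_order_unique[OF an so[OF U np(1)] so[OF W np(2)] init])
  hence "eventually (\<lambda>w. U w = W w) (at z0)" by (simp add: eventually_nhds_conv_at)
  thus ?thesis by (rule nicely_meromorphic_eqI[OF n])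
qed

text \<open>At a zero of \<open>Q(V)\<close> the derivative of \<open>V\<close> is 0, so \<open>V\<close>
  and its reflection in this point have the same initial data.\<close>

lemma first_order_solution_reflection:
  assumes V: "V \<in> nonconst_meromorphic_solutions (first_order_ode Q)"
    and z0: "\<not> is_pole V z0" "poly Q (V z0) = 0"
  shows "V (2 * z0 - z) = V z"
proof -
  define W where "W = (\<lambda>z. V ((-1) * z + 2 * z0))"
  have W: "W \<in> nonconst_meromorphic_solutions (first_order_ode Q)"
    unfolding W_def by (rule nonconst_solution_affine[OF V]) simp
  have Wz0: "\<not> is_pole W z0" unfolding W_def using is_pole_affine_iff[of "-1" V "2 * z0" z0] z0(1) by simp
  have d0: "deriv U z0 = 0" if U: "U \<in> nonconst_meromorphic_solutions (first_order_ode Q)" 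
    "\<not> is_pole U z0" "poly Q (U z0) = 0" for U
    using U by (auto simp: nonconst_meromorphic_solutions_def meromorphic_solution_def satisfies_first_order)
  have WV: "W z0 = V z0" by (simp add: W_def)
  have "W = V"
    by (rule first_order_solution_unique[OF W V Wz0 z0(1) WV])
       (use d0[OF W Wz0] d0[OF V z0] z0 WV in simp)
  hence "W z = V z" by simp
  thus ?thesis by (simp add: W_def)
qed

text \<open>An omitted value \<open>e\<close> would make \<open>y = 1/(V - e)\<close> entire. It satisfies
  \<open>y'^2 = 4 y \<Prod> (1 + (e - e_j) y)\<close>, of degree at least 3 because
  \<open>e\<close> equals at most one of the distinct roots; so \<open>y\<close> would be
  constant.\<close>

lemma cubic_solution_surjective:
  assumes V: "V \<in> nonconst_meromorphic_solutions (first_order_ode (cubic e1 e2 e3))" and dist: "distinct [e1, e2, e3]"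
  shows "\<exists>z. \<not> is_pole V z \<and> V z = e"
proof (rule ccontr)
  assume "\<not> ?thesis"
  hence no: "V z \<noteq> e" if "\<not> is_pole V z" for z using that by blast
  have n: "V nicely_meromorphic_on UNIV" "\<not> V constant_on UNIV"
    and eq: "\<And>z. \<not> is_pole V z \<Longrightarrow> deriv V z ^ 2 = poly (cubic e1 e2 e3) (V z)"
    using V by (auto simp: nonconst_meromorphic_solutions_def meromorphic_solution_def satisfies_first_order)
  have m: "V meromorphic_on UNIV" using n by (simp add: nicely_meromorphic_on_def)
  define y where "y = remove_sings (\<lambda>z. inverse (V z - e))"
  have ym: "(\<lambda>z. inverse (V z - e)) meromorphic_on UNIV" by (intro meromorphic_intros m)
  have yn: "y nicely_meromorphic_on UNIV" unfolding y_def by (rule remove_sings_nicely_meromorphic[OF ym])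
  have iso: "isolated_singularity_at (\<lambda>z. inverse (V z - e)) z" for z using ym by (auto simp: meromorphic_on_altdef)
  have ynp: "\<not> is_pole y z" for z
  proof (cases "is_pole V z")
    case True
    hence "is_pole (\<lambda>z. V z - e) z" using is_pole_plus_const_iff[of V z "- e"] by simp
    hence "((\<lambda>z. inverse (V z - e)) \<longlongrightarrow> 0) (at z)" using is_pole_tendsto by (fastforce simp: o_def)
    hence "y analytic_on {z}" unfolding y_def by (rule remove_sings_analytic_at[OF iso])
    thus ?thesis by (rule analytic_at_imp_no_pole)
  next
    case False
    have "V analytic_on {z}" using nicely_meromorphic_on_imp_analytic_at n False by blast
    hence "(\<lambda>z. inverse (V z - e)) analytic_on {z}" using no[OF False] by (intro analytic_intros) auto
    hence "y analytic_on {z}" unfolding y_def by (rule remove_sings_analytic_on)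
    thus ?thesis by (rule analytic_at_imp_no_pole)
  qed
  define Q where "Q = [:0, 4:] * [:1, e - e1:] * [:1, e - e2:] * [:1, e - e3:]"
  have degQ: "degree Q \<ge> 3" using dist by (auto simp: Q_def degree_mult_eq)
  have ye: "eventually (\<lambda>w. y w = inverse (V w - e)) (at 0)"
    unfolding y_def by (rule eventually_remove_sings_eq_at[OF iso])
  from ye eventually_at_imp_eventually_nhds[OF ye] eventually_analytic_at[OF n(1), of 0]
  have "eventually (\<lambda>w. deriv y w ^ 2 = poly Q (y w)) (at 0)"
  proof eventually_elim
    case (elim w)
    define x where "x = V w - e"
    have x: "x \<noteq> 0" using no elim by (auto simp: x_def)
    have "(V has_field_derivative deriv V w) (at w)"
      using elim analytic_on_imp_differentiable_at DERIV_deriv_iff_field_differentiable by blast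
    hence "((\<lambda>z. inverse (V z - e)) has_field_derivative - deriv V w / x ^ 2) (at w)"
      using x unfolding x_def by (auto intro!: derivative_eq_intros simp: field_simps power2_eq_square)
    hence "deriv (\<lambda>z. inverse (V z - e)) w = - deriv V w / x ^ 2" by (rule DERIV_imp_deriv)
    hence "deriv y w = - deriv V w / x ^ 2" using deriv_cong_ev[OF elim(2) refl] by simp
    hence "deriv y w ^ 2 = deriv V w ^ 2 / x ^ 4" by (simp add: power_divide flip: power_mult)
    also have "deriv V w ^ 2 = 4 * (x + (e - e1)) * (x + (e - e2)) * (x + (e - e3))"
      using eq elim by (simp add: poly_cubic x_def)
    also have "\<dots> / x ^ 4 = poly Q (inverse x)" using x by (simp add: Q_def field_simps eval_nat_numeral)
    finally show ?case using elim by (simp add: x_def)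
  qed
  hence "meromorphic_solution (first_order_ode Q) y" by (rule first_order_solutionI[OF yn])
  hence "y constant_on UNIV"
    using entire_first_order_constant[OF no_poles_imp_entire[OF yn ynp], of Q] degQ ynp
    by (auto simp: meromorphic_solution_def satisfies_first_order)
  then obtain c where c: "\<And>z. y z = c" by (auto simp: constant_on_def)
  have "eventually (\<lambda>w. V w = e + inverse c) (at 0)" using ye
    by eventually_elim (use c in auto)
  from nicely_meromorphic_eqI[OF n(1) nicely_meromorphic_on_const this]
  show False using n(2) by (auto simp: constant_on_def)
qed

text \<open>Poles are periods, hence form a discrete group. Points \<open>z_1\<close>, \<open>z_2\<close>
  with values \<open>e_1\<close>, \<open>e_2\<close> are half-periods, by the reflection in
  \<open>z_j\<close> and the one in 0. If all poles were multiples of one \<open>\<omega>\<close>,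
  then \<open>2 z_j\<close> would be odd multiples of it, as \<open>z_j\<close> is not a pole; so
  \<open>z_1 - z_2\<close> would be a period, contradicting \<open>V(z_1) \<noteq> V(z_2)\<close>.\<close>

lemma poles_form_lattice:
  assumes V: "V \<in> nonconst_meromorphic_solutions (first_order_ode (cubic e1 e2 e3))"
    and e: "distinct [e1, e2, e3]" and pole0: "is_pole V 0"
  shows "is_period_lattice {z. is_pole V z}"
    "is_pole V \<omega> \<Longrightarrow> V (z + \<omega>) = V z" "V (- z) = V z"
proof -
  have n: "V nicely_meromorphic_on UNIV"
    using V by (auto simp: nonconst_meromorphic_solutions_def meromorphic_solution_def)
  show per: "V (z + \<omega>) = V z" if "is_pole V \<omega>" for z \<omega>
    using cubic_solution_period[OF V, of 1 0 \<omega> z] that pole0 by simp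
  show even: "V (- z) = V z" for z
    using cubic_solution_period[OF V, of "-1" 0 0 z] pole0 by simp
  define \<Lambda> where "\<Lambda> = {z. is_pole V z}"
  have shift: "is_pole V (z + \<omega>) \<longleftrightarrow> is_pole V z" if "is_pole V \<omega>" for z \<omega>
    using is_pole_affine_iff[of 1 V \<omega> z] per[OF that] by simp
  have neg: "is_pole V (- z) \<longleftrightarrow> is_pole V z" for z
    using is_pole_affine_iff[of "-1" V 0 z] even by simp
  have diff: "x - y \<in> \<Lambda>" if "x \<in> \<Lambda>" "y \<in> \<Lambda>" for x y
    using shift[of y "x - y"] that by (simp add: \<Lambda>_def)
  have add: "x + y \<in> \<Lambda>" if "x \<in> \<Lambda>" "y \<in> \<Lambda>" for x y
    using shift[of y "x"] that by (simp add: \<Lambda>_def)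
  have half: "2 * z \<in> \<Lambda>" if "\<not> is_pole V z" "poly (cubic e1 e2 e3) (V z) = 0" for z
  proof -
    have "V (w + 2 * z) = V w" for w
      using first_order_solution_reflection[OF V that, of "- w"] even[of w] by (simp add: add.commute)
    hence "is_pole V (2 * z)" using is_pole_affine_iff[of 1 V "2 * z" 0] pole0 by simp
    thus ?thesis by (simp add: \<Lambda>_def)
  qed
  obtain z1 z2 where z: "\<not> is_pole V z1" "V z1 = e1" "\<not> is_pole V z2" "V z2 = e2"
    using cubic_solution_surjective[OF V e] by metis
  have h: "2 * z1 \<in> \<Lambda>" "2 * z2 \<in> \<Lambda>" using half z by (auto simp: poly_cubic)
  have "is_period_lattice \<Lambda>"
  proof (rule discrete_group_is_lattice)
    show "0 \<in> \<Lambda>" using pole0 by (simp add: \<Lambda>_def)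
    show "finite {g \<in> \<Lambda>. norm g < B}" for B
    proof (rule ccontr)
      assume "infinite {g \<in> \<Lambda>. norm g < B}"
      moreover have "bounded {g \<in> \<Lambda>. norm g < B}" by (rule boundedI[of _ B]) auto
      ultimately obtain x where "x islimpt {g \<in> \<Lambda>. norm g < B}"
        using bounded_infinite_imp_islimpt by blast
      hence "x islimpt \<Lambda>" by (rule islimpt_subset) auto
      moreover have "eventually (\<lambda>w. w \<notin> \<Lambda>) (at x)"
        using eventually_analytic_at[OF n, of x] by eventually_elim (simp add: \<Lambda>_def)
      ultimately show False by (simp add: islimpt_iff_eventually)
    qed
    fix \<omega> assume w: "\<omega> \<in> \<Lambda>"
    have int_mult: "of_int n * \<omega> \<in> \<Lambda>" for n
      by (rule int_multiple_in_group[OF _ diff w]) (use pole0 in \<open>simp add: \<Lambda>_def\<close>)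
    show "\<exists>g\<in>\<Lambda>. \<forall>n. g \<noteq> of_int n * \<omega>"
    proof (rule ccontr)
      assume "\<not> ?thesis"
      then obtain n1 n2 where n12: "2 * z1 = of_int n1 * \<omega>" "2 * z2 = of_int n2 * \<omega>" using h by meson
      have odd: "odd k" if "2 * x = of_int k * \<omega>" "\<not> is_pole V x" for k x
      proof
        assume "even k"
        then obtain j where "k = 2 * j" by blast
        hence "x = of_int j * \<omega>" using that(1) by simp
        thus False using int_mult[of j] that(2) by (simp add: \<Lambda>_def)
      qed
      have "even (n1 - n2)" using odd[OF n12(1)] odd[OF n12(2)] z by simp
      then obtain j where j: "n1 - n2 = 2 * j" by blast
      have "2 * (z1 - z2) = of_int (n1 - n2) * \<omega>" using n12 by (simp add: algebra_simps)
      hence "2 * (z1 - z2) = 2 * (of_int j * \<omega>)" by (simp add: j)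
      hence "z1 - z2 = of_int j * \<omega>" unfolding mult_cancel_left by simp
      hence "z1 = z2 + of_int j * \<omega>" by (simp add: diff_eq_eq add.commute)
      hence "V z1 = V z2" using per[of "of_int j * \<omega>" z2] int_mult[of j] by (simp add: \<Lambda>_def)
      thus False using z e by simp
    qed
  qed (rule diff)
  thus "is_period_lattice {z. is_pole V z}" by (simp add: \<Lambda>_def)
qed

lemma analytic_factor_power:
  assumes f: "f analytic_on {0}" and d: "\<And>i. i < n \<Longrightarrow> (deriv ^^ i) f 0 = 0" and n: "n > 0"
  shows "\<exists>k. k analytic_on {0} \<and> eventually (\<lambda>z. f z = z ^ n * k z) (nhds 0)"
proof -
  define F where "F = fps_expansion f 0"
  have F: "f has_fps_expansion F" unfolding F_def by (rule analytic_at_imp_has_fps_expansion_0[OF f])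
  show ?thesis
  proof (cases "F = 0")
    case True
    hence "eventually (\<lambda>z. f z = 0) (nhds 0)" using F by (simp add: has_fps_expansion_0_iff)
    thus ?thesis by (intro exI[of _ "\<lambda>_. 0"]) simp
  next
    case False
    have "n \<le> subdegree F"
    proof (rule subdegree_geI[OF False])
      fix i assume "i < n"
      thus "fps_nth F i = 0" using fps_nth_fps_expansion[OF F, of i] d by simp
    qed
    from has_fps_expansion_shift[OF F this refl]
    have "(\<lambda>x. if x = 0 then fps_nth F n else f x / x ^ n) analytic_on {0}" (is "?k analytic_on _")
      by (rule has_fps_expansion_imp_analytic_0)
    moreover have "f z = z ^ n * ?k z" for z using d[of 0] n by (cases "z = 0") auto
    ultimately show ?thesis by (intro exI[of _ ?k] conjI always_eventually allI)
  qed
qed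

text \<open>For \<open>s = 1/V\<close> the second order equation \<open>s'' = p(s)\<close> with \<open>p(0)
  = 2\<close> gives \<open>s(0) = s'(0) = 0\<close> and \<open>s''(0) = 2\<close>, and the third
  derivative \<open>p'(0) s'(0)\<close> is 0. Hence \<open>s = z^2 + O(z^4)\<close> and \<open>1/s
  = 1/z^2 + O(1)\<close>; in particular there is no residue.\<close>

lemma cubic_solution_principal_part:
  assumes V: "V \<in> nonconst_meromorphic_solutions (first_order_ode (cubic e1 e2 e3))" and pole: "is_pole V 0"
  shows "\<exists>k. k analytic_on {0} \<and> eventually (\<lambda>z. V z = 1 / z^2 + k z) (at 0)"
proof -
  have m: "V meromorphic_on {0}" using V
    by (auto simp: nonconst_meromorphic_solutions_def meromorphic_solution_def nicely_meromorphic_on_def intro: meromorphic_on_subset)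
  have ode: "eventually (\<lambda>w. deriv V w ^ 2 = poly (cubic e1 e2 e3) (V w)) (at 0)"
    using V by (intro first_order_solutionD) (simp add: nonconst_meromorphic_solutions_def)
  define s where "s = remove_sings (\<lambda>z. inverse (V z))"
  define p where "p = smult (1/2) (pderiv (pCons 0 (reflect_poly (cubic e1 e2 e3))))"
  note inv = inverse_at_pole[OF m pole, folded s_def]
  note so = cubic_pole_second_order[OF degree_cubic m pole ode, folded s_def p_def]
  have "lead_coeff (cubic e1 e2 e3) = 4" by (simp add: cubic_def lead_coeff_mult)
  hence p0: "poly p 0 = 2" by (simp add: p_def pderiv_pCons poly_0_coeff_0)
  have d2: "deriv (deriv s) 0 = 2" using eventually_nhds_x_imp_x[OF so(1)] inv(2) p0 by simp
  have d3: "deriv (deriv (deriv s)) 0 = 0"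
  proof -
    have "(s has_field_derivative deriv s 0) (at 0)"
      using inv(1) analytic_on_imp_differentiable_at DERIV_deriv_iff_field_differentiable by blast
    hence "(s has_field_derivative 0) (at 0)" by (simp only: so(2))
    from DERIV_chain2[OF poly_DERIV this, of p]
    have "deriv (\<lambda>z. poly p (s z)) 0 = 0" by (auto intro: DERIV_imp_deriv)
    thus ?thesis using deriv_cong_ev[OF so(1) refl] by simp
  qed
  define f where "f = (\<lambda>z. s z - z^2)"
  obtain S where S: "open S" "0 \<in> S" "s holomorphic_on S" using inv(1) by (auto simp: analytic_at)
  have fh: "f holomorphic_on S" unfolding f_def using S by (intro holomorphic_intros)
  have ds: "deriv s holomorphic_on S" "deriv (deriv s) holomorphic_on S"
    using S by (auto intro!: holomorphic_deriv)
  have D: "(g has_field_derivative deriv g z) (at z)" if "g holomorphic_on S" "z \<in> S" for g z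
    using holomorphic_derivI[OF that(1) S(1) that(2)] .
  have ev: "eventually (\<lambda>z. z \<in> S) (nhds 0)" using S by (simp add: eventually_nhds_in_open)
  have f1: "deriv f z = deriv s z - 2 * z" if "z \<in> S" for z
    unfolding f_def using D[OF S(3) that] by (intro DERIV_imp_deriv) (auto intro!: derivative_eq_intros)
  have f1': "eventually (\<lambda>z. deriv f z = deriv s z - 2 * z) (nhds z)" if "z \<in> S" for z
    using eventually_nhds_in_open[OF S(1) that] by eventually_elim (use f1 in auto)
  have f2: "deriv (deriv f) z = deriv (deriv s) z - 2" if "z \<in> S" for z
  proof -
    have "deriv (deriv f) z = deriv (\<lambda>z. deriv s z - 2 * z) z" by (intro deriv_cong_ev f1' that) auto
    also have "\<dots> = deriv (deriv s) z - 2"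
      using D[OF ds(1) that] by (intro DERIV_imp_deriv) (auto intro!: derivative_eq_intros)
    finally show ?thesis .
  qed
  have f2': "eventually (\<lambda>z. deriv (deriv f) z = deriv (deriv s) z - 2) (nhds 0)"
    using ev by eventually_elim (use f2 in auto)
  have f3: "deriv (deriv (deriv f)) 0 = deriv (deriv (deriv s)) 0"
  proof -
    have "deriv (deriv (deriv f)) 0 = deriv (\<lambda>z. deriv (deriv s) z - 2) 0" by (intro deriv_cong_ev f2') auto
    also have "\<dots> = deriv (deriv (deriv s)) 0"
      using D[OF ds(2) S(2)] by (intro DERIV_imp_deriv) (auto intro!: derivative_eq_intros)
    finally show ?thesis .
  qed
  have "f analytic_on {0}" using fh S by (auto simp: analytic_at)
  moreover have "(deriv ^^ i) f 0 = 0" if i: "i < 4" for i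
  proof -
    have "i = 0 \<or> i = 1 \<or> i = 2 \<or> i = 3" using i by auto
    thus ?thesis using f1[OF S(2)] f2[OF S(2)] f3 d2 d3 so(2) inv(2)
      by (auto simp: eval_nat_numeral f_def)
  qed
  ultimately obtain k where k: "k analytic_on {0}" "eventually (\<lambda>z. f z = z ^ 4 * k z) (nhds 0)"
    using analytic_factor_power[of f 4] by auto
  define k' where "k' = (\<lambda>z. - k z / (1 + z^2 * k z))"
  have "k' analytic_on {0}" unfolding k'_def using k(1) by (intro analytic_intros) auto
  moreover have "eventually (\<lambda>z. V z = 1 / z^2 + k' z) (at 0)"
  proof -
    have "eventually (\<lambda>z. f z = z ^ 4 * k z) (at 0)" using k(2) by (simp add: eventually_nhds_conv_at)
    moreover have "eventually (\<lambda>z::complex. z \<noteq> 0) (at 0)" by (simp add: eventually_at_filter)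
    ultimately show ?thesis using inv(3)
    proof eventually_elim
      case (elim z)
      have s: "s z = z^2 * (1 + z^2 * k z)" using elim(1) by (simp add: f_def algebra_simps eval_nat_numeral)
      have nz: "1 + z^2 * k z \<noteq> 0" using elim(3) s by auto
      have "V z = 1 / s z" using elim(3) by (simp add: inverse_eq_divide)
      also have "\<dots> = 1 / z^2 + k' z" unfolding s k'_def using nz elim(2)
        by (simp add: divide_simps)
      finally show ?case .
    qed
  qed
  ultimately show ?thesis by blast
qed

text \<open>After multiplication by \<open>z^4\<close> and cancellation of the leading terms, the equation
  for \<open>1/z^2 + k(z)\<close> becomes an identity between analytic functions, whose value at 0
  is the claim.\<close>

lemma principal_part_constant_term:
  assumes V: "V \<in> nonconst_meromorphic_solutions (first_order_ode (cubic e1 e2 e3))"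
    and k: "k analytic_on {0}" "eventually (\<lambda>z. V z = 1 / z^2 + k z) (at 0)"
  shows "3 * k 0 = e1 + e2 + e3"
proof -
  define g where "g = (\<lambda>z. - 4 * z * deriv k z + z^4 * deriv k z ^ 2 - 4 * (3 * k z - (e1 + e2 + e3))
    - 4 * z^2 * ((k z - e1) * (k z - e2) + (k z - e1) * (k z - e3) + (k z - e2) * (k z - e3))
    - 4 * z^4 * ((k z - e1) * (k z - e2) * (k z - e3)))"
  have "g 0 = 0"
  proof (rule analytic_eventually_zero_imp_zero[of g])
    show "g analytic_on {0}" unfolding g_def using k(1) by (intro analytic_intros)
    have nz: "eventually (\<lambda>z::complex. z \<noteq> 0) (at 0)" by (simp add: eventually_at_filter)
    have ka: "eventually (\<lambda>z. k analytic_on {z}) (at 0)"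
      using k(1) isolated_singularity_at_analytic isolated_singularity_at_altdef by blast
    have ode: "eventually (\<lambda>w. deriv V w ^ 2 = poly (cubic e1 e2 e3) (V w)) (at 0)"
      using V by (intro first_order_solutionD) (simp add: nonconst_meromorphic_solutions_def)
    from k(2) eventually_at_imp_eventually_nhds[OF k(2)] nz ka ode
    show "eventually (\<lambda>z. g z = 0) (at 0)"
    proof eventually_elim
      case (elim z)
      have "(k has_field_derivative deriv k z) (at z)"
        using elim(4) analytic_on_imp_differentiable_at DERIV_deriv_iff_field_differentiable by blast
      hence "((\<lambda>z. 1 / z^2 + k z) has_field_derivative - 2 / z^3 + deriv k z) (at z)"
        using elim(3) by (auto intro!: derivative_eq_intros simp: eval_nat_numeral)
      hence dV: "deriv V z = - 2 / z^3 + deriv k z"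
        using deriv_cong_ev[OF elim(2) refl] DERIV_imp_deriv by metis
      have 1: "z^4 * (- 2 / z^3 + deriv k z)^2 = 4 / z^2 - 4 * z * deriv k z + z^4 * deriv k z ^ 2"
        using elim(3) by (simp add: field_simps eval_nat_numeral)
      have 2: "z^4 * (4 * (1 / z^2 + A) * (1 / z^2 + B) * (1 / z^2 + C)) =
         4 / z^2 + 4 * (A + B + C) + 4 * z^2 * (A * B + A * C + B * C) + 4 * z^4 * (A * B * C)" for A B C
        using elim(3) by (simp add: field_simps eval_nat_numeral)
      have "z^4 * deriv V z ^ 2 = z^4 * (4 * (1 / z^2 + (k z - e1)) * (1 / z^2 + (k z - e2)) * (1 / z^2 + (k z - e3)))"
        using elim(5) elim(1) by (simp add: poly_cubic add_diff_eq)
      thus "g z = 0" unfolding dV 1 2 g_def by (simp add: algebra_simps)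
    qed
  qed
  moreover define X where "X = 3 * k 0 - (e1 + e2 + e3)"
  have "g 0 = - (4 * X)" by (simp add: g_def X_def)
  ultimately have "X = 0" by simp
  thus ?thesis by (simp add: X_def)
qed

text \<open>The difference \<open>V - \<wp>\<close> has removable singularities at the lattice points and is
  even, and its derivative is periodic; so it is constant. The constant is read off from the
  expansions at 0, where \<open>\<wp>\<close> has no constant term.\<close>

lemma elliptic_uniformization:
  fixes e1 e2 e3 :: complex
  assumes e: "distinct [e1, e2, e3]"
  obtains \<Lambda> V where "is_period_lattice \<Lambda>"
    "V \<in> nonconst_meromorphic_solutions (first_order_ode (cubic e1 e2 e3))"
    "\<And>z. is_pole V z \<longleftrightarrow> z \<in> \<Lambda>" "\<And>\<omega> z. \<omega> \<in> \<Lambda> \<Longrightarrow> V (z + \<omega>) = V z" "\<And>z. V (- z) = V z"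
    "\<And>z. z \<notin> \<Lambda> \<Longrightarrow> V z = (e1 + e2 + e3) / 3 + weierstrass_p \<Lambda> z"
proof -
  obtain V where V: "V \<in> nonconst_meromorphic_solutions (first_order_ode (cubic e1 e2 e3))" and pole0: "is_pole V 0"
    using global_cubic_solution by blast
  define \<Lambda> where "\<Lambda> = {z. is_pole V z}"
  note lat = poles_form_lattice[OF V e pole0]
  interpret complex_lattice \<Lambda> by unfold_locales (use lat(1) in \<open>simp add: \<Lambda>_def\<close>)
  have n: "V nicely_meromorphic_on UNIV"
    using V by (auto simp: nonconst_meromorphic_solutions_def meromorphic_solution_def)
  have Vm: "V meromorphic_on UNIV" using n by (simp add: nicely_meromorphic_on_def)
  have Van: "V analytic_on {z}" if "z \<notin> \<Lambda>" for z
    using nicely_meromorphic_on_imp_analytic_at[OF n] that by (simp add: \<Lambda>_def)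
  have per: "V (z + \<omega>) = V z" if "\<omega> \<in> \<Lambda>" for z \<omega> using lat(2) that by (simp add: \<Lambda>_def)
  obtain k where k: "k analytic_on {0}" "eventually (\<lambda>z. V z = 1 / z^2 + k z) (at 0)"
    using cubic_solution_principal_part[OF V pole0] by blast
  define f where "f = (\<lambda>z. V z - weierstrass_p \<Lambda> z)"
  define E where "E = remove_sings f"
  have fm: "f meromorphic_on UNIV" unfolding f_def by (intro meromorphic_intros Vm meromorphic_p)
  have En: "E nicely_meromorphic_on UNIV" unfolding E_def by (rule remove_sings_nicely_meromorphic[OF fm])
  have Ef: "E z = f z" if "z \<notin> \<Lambda>" for z unfolding E_def f_def
    using Van[OF that] analytic_p[OF that] by (intro remove_sings_at_analytic analytic_intros)
  \<comment> \<open>By periodicity the expansion of \<open>V\<close> at every lattice point is the one at 0.\<close>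
  have local: "\<exists>h. h analytic_on {p} \<and> eventually (\<lambda>z. E z = k (z - p) - h z) (at p) \<and> (p = 0 \<longrightarrow> h 0 = 0)"
    if p: "p \<in> \<Lambda>" for p
  proof -
    obtain h where h: "h analytic_on {p}" "\<And>z. weierstrass_p \<Lambda> z = 1 / (z - p)^2 + h z" "p = 0 \<Longrightarrow> h 0 = 0"
      using p_at_lattice_point[OF p] by blast
    have "eventually (\<lambda>z. V z = 1 / z^2 + k z) (filtermap (\<lambda>z. 1 * z + (- p)) (at p))"
      using k(2) by (subst filtermap_affine_at) simp_all
    hence "eventually (\<lambda>z. V (z - p) = 1 / (z - p)^2 + k (z - p)) (at p)"
      by (simp add: eventually_filtermap)
    hence "eventually (\<lambda>z. E z = k (z - p) - h z) (at p)"
      using eventually_not_in_lattice[of p]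
    proof eventually_elim
      case (elim z)
      have "V z = V (z - p)" using per[OF p, of "z - p"] by simp
      thus ?case using elim Ef[of z] h(2)[of z] by (simp add: f_def)
    qed
    thus ?thesis using h by blast
  qed
  have "\<not> is_pole E z" for z
  proof (cases "z \<in> \<Lambda>")
    case False
    have "E analytic_on {z}" unfolding E_def f_def
      using Van[OF False] analytic_p[OF False] by (intro remove_sings_analytic_on analytic_intros)
    thus ?thesis by (rule analytic_at_imp_no_pole)
  next
    case True
    then obtain h where h: "h analytic_on {z}" "eventually (\<lambda>w. E w = k (w - z) - h w) (at z)" using local by blast
    have "(k \<circ> (\<lambda>w. w - z)) analytic_on {z}"
      by (rule analytic_on_compose_gen[where T = "{0}"]) (auto intro!: analytic_intros k(1))
    hence "(\<lambda>w. k (w - z) - h w) analytic_on {z}" using h(1) unfolding o_def by (intro analytic_intros)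
    hence "\<not> is_pole (\<lambda>w. k (w - z) - h w) z" by (rule analytic_at_imp_no_pole)
    thus ?thesis using is_pole_cong[OF h(2) refl] by blast
  qed
  hence Eh: "E holomorphic_on UNIV" by (rule no_poles_imp_entire[OF En])
  have "E constant_on UNIV"
  proof (rule entire_even_quasiperiodic_constant[OF Eh])
    fix z
    have "eventually (\<lambda>w. E ((-1) * w + 0) = E w) (at 0)"
      using eventually_not_in_lattice[of 0]
    proof eventually_elim
      case (elim w)
      thus ?case using Ef[of w] Ef[of "- w"] lat(3)[of w] p_even[of w] by (simp add: f_def)
    qed
    hence "(\<lambda>w. E ((-1) * w + 0)) = E"
      by (intro nicely_meromorphic_eqI[OF nicely_meromorphic_affine[OF En] En]) auto
    from fun_cong[OF this, of z] show "E (- z) = E z" by simp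
  next
    fix \<omega> assume w: "\<omega> \<in> \<Lambda>"
    have dE: "deriv E z = deriv V z - deriv (weierstrass_p \<Lambda>) z" if z: "z \<notin> \<Lambda>" for z
    proof -
      have "eventually (\<lambda>w. w \<in> - \<Lambda>) (nhds z)"
        using open_minus_sublattice[of \<Lambda>] z by (intro eventually_nhds_in_open) auto
      hence "eventually (\<lambda>w. E w = f w) (nhds z)" by eventually_elim (use Ef in auto)
      hence "deriv E z = deriv f z" by (intro deriv_cong_ev) auto
      also have "\<dots> = deriv V z - deriv (weierstrass_p \<Lambda>) z" unfolding f_def
        using Van[OF z] analytic_p[OF z] by (intro deriv_diff analytic_on_imp_differentiable_at) auto
      finally show ?thesis .
    qed
    have "V = (\<lambda>z. V (1 * z + \<omega>))" using per[OF w] by simp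
    hence dV: "deriv V (z + \<omega>) = deriv V z" if z: "z \<notin> \<Lambda>" for z
      using deriv_compose_linear'[of V 1 z \<omega>] Van[of "z + \<omega>"] z add_lattice_iff[OF w, of z]
      by (simp add: analytic_on_imp_differentiable_at)
    show "eventually (\<lambda>z. deriv E (z + \<omega>) = deriv E z) (at 0)"
      using eventually_not_in_lattice[of 0]
    proof eventually_elim
      case (elim z)
      thus ?case using dE[of z] dE[of "z + \<omega>"] dV p_deriv_periodic[OF _ w, of z] add_lattice_iff[OF w, of z] by simp
    qed
  qed
  then obtain c where c: "\<And>z. E z = c" by (auto simp: constant_on_def)
  have "c = (e1 + e2 + e3) / 3"
  proof -
    obtain h where h: "h analytic_on {0}" "eventually (\<lambda>z. E z = k z - h z) (at 0)" "h 0 = 0"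
      using local[OF zero_in_lattice] by auto
    have "k 0 - h 0 - c = 0"
    proof (rule analytic_eventually_zero_imp_zero[of "\<lambda>z. k z - h z - c"])
      show "(\<lambda>z. k z - h z - c) analytic_on {0}" using k(1) h(1) by (intro analytic_intros)
      show "eventually (\<lambda>z. k z - h z - c = 0) (at 0)" using h(2) by eventually_elim (simp add: c)
    qed
    moreover have "3 * k 0 = e1 + e2 + e3" by (rule principal_part_constant_term[OF V k])
    ultimately show ?thesis using h(3) by (simp add: field_simps)
  qed
  moreover have "V z = c + weierstrass_p \<Lambda> z" if "z \<notin> \<Lambda>" for z
    using Ef[OF that] c[of z] by (simp add: f_def diff_eq_eq)
  ultimately have "V z = (e1 + e2 + e3) / 3 + weierstrass_p \<Lambda> z" if "z \<notin> \<Lambda>" for z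
    using that by simp
  thus ?thesis by (intro that[OF lattice V _ per lat(3)]) (simp_all add: \<Lambda>_def)
qed

section \<open>Binomial equations and algebraic constants\<close>

definition binomial_poly :: "complex \<Rightarrow> complex list \<Rightarrow> complex poly" where
  "binomial_poly \<alpha> es = smult \<alpha> (\<Prod>e\<leftarrow>es. [:-e, 1:])"

lemma poly_binomial_poly: "poly (binomial_poly \<alpha> es) u = \<alpha> * (\<Prod>e\<leftarrow>es. u - e)"
proof -
  have "poly (\<Prod>e\<leftarrow>es. [:-e, 1:]) u = (\<Prod>e\<leftarrow>es. u - e)"
    by (induction es) (simp_all add: algebra_simps)
  thus ?thesis by (simp add: binomial_poly_def)
qed

lemma binomial_BB_eq: "binomial_BB \<alpha> es = first_order_ode (binomial_poly \<alpha> es)"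
  by (simp add: binomial_BB_def first_order_ode_def poly_binomial_poly)

lemma zero_in_field: "0 \<in> generated_field X"
  using generated_field.diff[OF generated_field.one generated_field.one] by simp

lemma uminus_in_field: "x \<in> generated_field X \<Longrightarrow> - x \<in> generated_field X"
  using generated_field.diff[OF zero_in_field] by fastforce

lemma add_in_field: "x \<in> generated_field X \<Longrightarrow> y \<in> generated_field X \<Longrightarrow> x + y \<in> generated_field X"
  using generated_field.diff[of x X "- y"] uminus_in_field[of y X] by simp

lemma divide_in_field: "x \<in> generated_field X \<Longrightarrow> y \<in> generated_field X \<Longrightarrow> x / y \<in> generated_field X"
  unfolding divide_inverse by (intro generated_field.mult generated_field.inverse)

lemma power_in_field: "x \<in> generated_field X \<Longrightarrow> x ^ n \<in> generated_field X"
  by (induction n) (auto intro: generated_field.one generated_field.mult)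

lemma of_nat_in_field: "of_nat n \<in> generated_field X"
  by (induction n) (auto intro: zero_in_field add_in_field generated_field.one)

lemma numeral_in_field: "numeral n \<in> generated_field X"
  using of_nat_in_field[of "numeral n" X] by simp

lemmas field_intros = zero_in_field uminus_in_field add_in_field divide_in_field numeral_in_field power_in_field
  generated_field.one generated_field.diff generated_field.mult generated_field.inverse

text \<open>All constants of the list are rational in the parameters up to a square root, so quadratic
  polynomials suffice as witnesses.\<close>

lemma algebraic_if_square_in_field:
  assumes "c ^ 2 \<in> generated_field X"
  shows "algebraic_in X c"
proof -
  have "coeff [:- (c^2), 0, 1:] i \<in> generated_field X" for i
    using assms by (auto simp: coeff_pCons intro: field_intros split: nat.split)
  moreover have "poly [:- (c^2), 0, 1:] c = 0" by (simp add: power2_eq_square)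
  ultimately show ?thesis unfolding algebraic_in_def by (intro exI[of _ "[:- (c^2), 0, 1:]"]) simp
qed

lemma algebraic_if_in_field: "c \<in> generated_field X \<Longrightarrow> algebraic_in X c"
  by (intro algebraic_if_square_in_field power_in_field)

section \<open>Quotients of entire functions\<close>

text \<open>The closed formulas take arbitrary values at their removable singularities, so their symmetries
  are transferred to the normal forms.\<close>

lemma remove_sings_affine_eq:
  assumes f: "f meromorphic_on UNIV" "g meromorphic_on UNIV" and a: "a \<noteq> 0" and eq: "\<And>z. g z = f (a * z + b)"
  shows "remove_sings g z = remove_sings f (a * z + b)"
proof -
  have iso: "isolated_singularity_at g 0" "isolated_singularity_at f (a * 0 + b)"
    using f by (auto simp: meromorphic_on_altdef)
  have "eventually (\<lambda>w. remove_sings f w = f w) (filtermap (\<lambda>z. a * z + b) (at 0))"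
    unfolding filtermap_affine_at[OF a] by (rule eventually_remove_sings_eq_at[OF iso(2)])
  hence "eventually (\<lambda>w. remove_sings f (a * w + b) = f (a * w + b)) (at 0)" by (simp add: eventually_filtermap)
  with eventually_remove_sings_eq_at[OF iso(1)]
  have "eventually (\<lambda>w. remove_sings g w = remove_sings f (a * w + b)) (at 0)"
    by eventually_elim (simp add: eq)
  from nicely_meromorphic_eqI[OF remove_sings_nicely_meromorphic[OF f(2)]
       nicely_meromorphic_affine[OF remove_sings_nicely_meromorphic[OF f(1)] a] this]
  show ?thesis by (rule fun_cong)
qed

text \<open>A meromorphic solution \<open>N/D\<close> presented by entire functions without common zeros.
  The derivatives \<open>N'\<close>, \<open>D'\<close> are parameters, so that the differential
  equation becomes an algebraic condition; the zero \<open>p\<close> of \<open>D\<close> is a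
  pole, which excludes constants.\<close>

locale entire_quotient =
  fixes N D N' D' :: "complex \<Rightarrow> complex" and Q :: "complex poly" and p :: complex
  assumes N: "\<And>z. (N has_field_derivative N' z) (at z)"
    and D: "\<And>z. (D has_field_derivative D' z) (at z)"
    and coprime: "\<And>z. D z = 0 \<Longrightarrow> N z \<noteq> 0"
    and zero: "D p = 0" and nonzero: "\<exists>z. D z \<noteq> 0"
    and ode: "\<And>z. D z \<noteq> 0 \<Longrightarrow> ((N' z * D z - N z * D' z) / (D z * D z)) ^ 2 = poly Q (N z / D z)"
begin

abbreviation "f \<equiv> \<lambda>z. N z / D z"

lemma entire: "N analytic_on A" "D analytic_on A"
proof -
  have "N holomorphic_on UNIV" "D holomorphic_on UNIV"
    unfolding holomorphic_on_def field_differentiable_def using N D has_field_derivative_at_within by blast+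
  hence "N analytic_on UNIV" "D analytic_on UNIV" by (simp_all add: analytic_on_open)
  thus "N analytic_on A" "D analytic_on A" using analytic_on_subset by blast+
qed

lemma meromorphic: "f meromorphic_on A"
  using entire by (intro meromorphic_intros analytic_on_imp_meromorphic_on)

lemma eventually_nonzero: "eventually (\<lambda>w. D w \<noteq> 0) (at z)"
proof (rule ccontr)
  assume "\<not> ?thesis"
  hence "\<exists>\<^sub>F w in at z. D w = 0" by (simp add: frequently_def)
  from frequently_eq_meromorphic_imp_constant[OF this analytic_on_imp_nicely_meromorphic_on[OF entire(2)]]
  have "D w = 0" for w by auto
  thus False using nonzero by blast
qed

lemma pole: "D z = 0 \<Longrightarrow> is_pole f z"
proof (rule is_pole_divide)
  assume z: "D z = 0"
  show "isCont N z" using N DERIV_isCont by blast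
  show "N z \<noteq> 0" using coprime z .
  have "D \<midarrow>z\<rightarrow> D z" using DERIV_isCont[OF D] by (simp add: isCont_def)
  thus "filterlim D (at 0) (at z)" using eventually_nonzero[of z] z by (auto simp: filterlim_at)
qed

lemma value_eq: "D z \<noteq> 0 \<Longrightarrow> remove_sings f z = f z"
  by (intro remove_sings_at_analytic analytic_intros entire) auto

lemma solution: "remove_sings f \<in> nonconst_meromorphic_solutions (first_order_ode Q)"
proof (rule formula_solution[OF meromorphic pole[OF zero]])
  show "eventually (\<lambda>z. deriv f z ^ 2 = poly Q (f z)) (at p)"
    using eventually_nonzero[of p]
  proof eventually_elim
    case (elim z)
    have "(f has_field_derivative (N' z * D z - N z * D' z) / (D z * D z)) (at z)"
      by (rule DERIV_divide[OF N D elim])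
    hence "deriv f z = (N' z * D z - N z * D' z) / (D z * D z)" by (rule DERIV_imp_deriv)
    thus ?case using ode[OF elim] by simp
  qed
qed

lemma given_by:
  assumes holds: "\<And>z. D z \<noteq> 0 \<Longrightarrow> R z (f z)"
    and determines: "\<And>z u. z \<noteq> 0 \<Longrightarrow> D z \<noteq> 0 \<Longrightarrow> R z u \<Longrightarrow> u = f z"
  shows "given_by R = range (\<lambda>c z. remove_sings f (z + c))"
proof (rule given_by_formula[OF meromorphic])
  fix z assume "\<not> is_pole f z"
  hence "D z \<noteq> 0" using pole by blast
  thus "R z (remove_sings f z)" using holds[of z] value_eq[of z] by simp
next
  fix z :: complex
  have "eventually (\<lambda>w. w \<noteq> 0) (at z)"
    using tendsto_imp_eventually_ne[of "\<lambda>w. w" z "at z" 0] by (cases "z = 0") (auto simp: eventually_at_filter)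
  with eventually_nonzero[of z] show "eventually (\<lambda>w. \<forall>u. R w u \<longrightarrow> u = f w) (at z)"
    by eventually_elim (use determines in blast)
qed

lemma general_solution_even:
  assumes "\<And>z. D z \<noteq> 0 \<Longrightarrow> R z (f z)"
    and "\<And>z u. z \<noteq> 0 \<Longrightarrow> D z \<noteq> 0 \<Longrightarrow> R z u \<Longrightarrow> u = f z"
    and even: "\<And>z. f (- z) = f z"
  shows "general_solution (first_order_ode Q) (given_by R)"
proof (rule general_solution_translates_even[OF solution given_by])
  fix z
  show "remove_sings f (- z) = remove_sings f z"
    using remove_sings_affine_eq[OF meromorphic meromorphic, of "-1" 0 z] even by simp
qed (use assms in auto)

end

text \<open>The counterpart for entries with a sign, where the reflection of one solution is the other.\<close>

lemma general_solution_two_signs: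
  assumes 1: "entire_quotient N1 D1 N1' D1' Q p1" and 2: "entire_quotient N2 D2 N2' D2' Q p2"
    and R1: "\<And>z. D1 z \<noteq> 0 \<Longrightarrow> R 1 z (N1 z / D1 z)" 
       "\<And>z u. z \<noteq> 0 \<Longrightarrow> D1 z \<noteq> 0 \<Longrightarrow> R 1 z u \<Longrightarrow> u = N1 z / D1 z"
    and R2: "\<And>z. D2 z \<noteq> 0 \<Longrightarrow> R (-1) z (N2 z / D2 z)" 
       "\<And>z u. z \<noteq> 0 \<Longrightarrow> D2 z \<noteq> 0 \<Longrightarrow> R (-1) z u \<Longrightarrow> u = N2 z / D2 z"
    and odd: "\<And>z. N2 z / D2 z = N1 (- z) / D1 (- z)"
  shows "general_solution (first_order_ode Q) (\<Union>\<sigma>\<in>{1, - 1 :: complex}. given_by (R \<sigma>))"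
proof (rule general_solution_translates_signs[OF entire_quotient.solution[OF 1]])
  show "given_by (R 1) = range (\<lambda>c z. remove_sings (\<lambda>z. N1 z / D1 z) (z + c))"
    by (rule entire_quotient.given_by[OF 1, of "R 1"]) (use R1 in auto)
  show "given_by (R (-1)) = range (\<lambda>c z. remove_sings (\<lambda>z. N2 z / D2 z) (z + c))"
    by (rule entire_quotient.given_by[OF 2, of "R (-1)"]) (use R2 in auto)
  fix z
  show "remove_sings (\<lambda>z. N2 z / D2 z) z = remove_sings (\<lambda>z. N1 z / D1 z) (- z)"
    using remove_sings_affine_eq[OF entire_quotient.meromorphic[OF 1] entire_quotient.meromorphic[OF 2], of "-1" 0 z] odd
    by simp
qed

section \<open>Equations with multiple roots\<close>

lemma cosh_square_eq_complex: "cosh z ^ 2 = 1 + sinh z ^ 2" for z :: complex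
  using cosh_square_eq[of z] by simp

text \<open>With \<open>e_3\<close> as value of \<open>A\<close> the function \<open>u - e_1 = B /
  sinh^2\<close> and \<open>u - e_3 = B coth^2\<close> factor the right-hand side.\<close>

lemma BB_cubic_double:
  fixes \<alpha> e1 e3 :: complex
  assumes \<alpha>: "\<alpha> \<noteq> 0" and e: "e1 \<noteq> e3"
  defines "A \<equiv> e3" and "B \<equiv> e1 - e3" and "D \<equiv> csqrt (\<alpha> * (e1 - e3)) / 2"
  shows "general_solution (first_order_ode (binomial_poly \<alpha> [e1, e1, e3]))
     (given_by (\<lambda>z u. u = A + B * (cosh (D * z) / sinh (D * z))^2))"
proof -
  have B: "B \<noteq> 0" and D: "D \<noteq> 0" and D2: "4 * D^2 = \<alpha> * B"
    using \<alpha> e by (auto simp: B_def D_def power_divide)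
  have sc: "cosh (D * z) ^ 2 = 1 + sinh (D * z) ^ 2" for z by (rule cosh_square_eq_complex)
  interpret q: entire_quotient "\<lambda>z. A * sinh (D * z) ^ 2 + B * cosh (D * z) ^ 2" "\<lambda>z. sinh (D * z) ^ 2"
     "\<lambda>z. 2 * D * (A + B) * sinh (D * z) * cosh (D * z)" "\<lambda>z. 2 * D * sinh (D * z) * cosh (D * z)"
     "binomial_poly \<alpha> [e1, e1, e3]" 0
  proof
    fix z assume z: "sinh (D * z) ^ 2 \<noteq> 0"
    define s where "s = sinh (D * z)"
    define c where "c = cosh (D * z)"
    have s: "s \<noteq> 0" using z by (simp add: s_def)
    have c: "c^2 = 1 + s^2" using sc[of z] by (simp add: s_def c_def)
    have num: "2 * D * (A + B) * s * c * s^2 - (A * s^2 + B * c^2) * (2 * D * s * c) = - (2 * D * B * s * c)"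
      using c by algebra
    have v: "(A * s^2 + B * c^2) / s^2 = e3 + B * (c^2 / s^2)" using s by (simp add: A_def field_simps)
    have v1: "e3 + B * (c^2 / s^2) - e1 = B / s^2"
      unfolding c using s by (simp add: B_def field_simps)
    have "((2 * D * (A + B) * s * c * s^2 - (A * s^2 + B * c^2) * (2 * D * s * c)) / (s^2 * s^2))^2 =
        (4 * D^2) * B^2 * c^2 / s^6"
      unfolding num using s by (simp add: power_divide power_mult_distrib flip: power_mult) (simp add: field_simps eval_nat_numeral)
    also have "\<dots> = \<alpha> * (B / s^2) * ((B / s^2) * (B * (c^2 / s^2)))"
      unfolding D2 using s by (simp add: field_simps eval_nat_numeral)
    also have "\<dots> = poly (binomial_poly \<alpha> [e1, e1, e3]) ((A * s^2 + B * c^2) / s^2)"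
      unfolding v poly_binomial_poly using v1 by simp
    finally show "((2 * D * (A + B) * sinh (D * z) * cosh (D * z) * (sinh (D * z))\<^sup>2 -
          (A * (sinh (D * z))\<^sup>2 + B * (cosh (D * z))\<^sup>2) * (2 * D * sinh (D * z) * cosh (D * z))) /
         ((sinh (D * z))\<^sup>2 * (sinh (D * z))\<^sup>2))\<^sup>2 =
        poly (binomial_poly \<alpha> [e1, e1, e3]) ((A * (sinh (D * z))\<^sup>2 + B * (cosh (D * z))\<^sup>2) / (sinh (D * z))\<^sup>2)"
      by (simp only: s_def c_def)
  next
    fix z
    assume "sinh (D * z) ^ 2 = 0"
    hence "sinh (D * z) = 0" by simp
    thus "A * (sinh (D * z))\<^sup>2 + B * (cosh (D * z))\<^sup>2 \<noteq> 0" using sc[of z] B by simp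
  next
    \<comment> \<open>A point where the denominator is not 0.\<close>
    have "sinh (D * (\<i> * pi / 2 / D)) = \<i>" using D by (simp add: sinh_conv_sin)
    thus "\<exists>z. sinh (D * z) ^ 2 \<noteq> 0" by (metis complex_i_not_zero power_not_zero)
  qed (auto intro!: derivative_eq_intros simp: algebra_simps)
  show ?thesis
    by (rule q.general_solution_even) (auto simp: field_simps power_divide)
qed

lemma BB_cubic_triple:
  fixes \<alpha> e1 :: complex
  assumes \<alpha>: "\<alpha> \<noteq> 0"
  shows "general_solution (first_order_ode (binomial_poly \<alpha> [e1, e1, e1]))
     (given_by (\<lambda>z u. u = e1 + 4 / (\<alpha> * z^2)))"
proof -
  interpret q: entire_quotient "\<lambda>z. e1 * \<alpha> * z^2 + 4" "\<lambda>z. \<alpha> * z^2"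
     "\<lambda>z. 2 * e1 * \<alpha> * z" "\<lambda>z. 2 * \<alpha> * z" "binomial_poly \<alpha> [e1, e1, e1]" 0
  proof
    fix z assume z: "\<alpha> * z^2 \<noteq> 0"
    hence z: "z \<noteq> 0" by auto
    have v: "(e1 * \<alpha> * z^2 + 4) / (\<alpha> * z^2) = e1 + 4 / (\<alpha> * z^2)" using z \<alpha> by (simp add: field_simps)
    show "((2 * e1 * \<alpha> * z * (\<alpha> * z\<^sup>2) - (e1 * \<alpha> * z\<^sup>2 + 4) * (2 * \<alpha> * z)) / (\<alpha> * z\<^sup>2 * (\<alpha> * z\<^sup>2)))\<^sup>2 =
         poly (binomial_poly \<alpha> [e1, e1, e1]) ((e1 * \<alpha> * z\<^sup>2 + 4) / (\<alpha> * z\<^sup>2))"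
      unfolding v poly_binomial_poly using z \<alpha> by (simp add: field_simps eval_nat_numeral)
  next
    show "\<exists>z. \<alpha> * z^2 \<noteq> 0" using \<alpha> by (intro exI[of _ 1]) simp
  qed (use \<alpha> in \<open>auto intro!: derivative_eq_intros simp: algebra_simps\<close>)
  show ?thesis
    by (rule q.general_solution_even) (use \<alpha> in \<open>auto simp: field_simps\<close>)
qed

lemma cosh_surj: "\<exists>w. cosh w = (x :: complex)"
proof -
  have "cosh (- \<i> * Arccos x) = cos (\<i> * (- \<i> * Arccos x))" by (simp only: cosh_conv_cos)
  also have "\<i> * (- \<i> * Arccos x) = Arccos x" by simp
  finally show ?thesis by (metis cos_Arccos)
qed

text \<open>For \<open>y = 1/(u - e_1)\<close> the equation becomes \<open>y'^2 = B^2 (y - \<rho>_3) (y -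
  \<rho>_4)\<close>, where \<open>\<rho>_j = - 1/(e_1 - e_j)\<close> is the value of
  \<open>y\<close> at \<open>u = e_j\<close>. It is solved by a hyperbolic cosine centred at the
  mean of the two roots, with half their difference as amplitude.\<close>

lemma BB_quartic_double:
  fixes \<alpha> e1 e3 e4 :: complex
  assumes \<alpha>: "\<alpha> \<noteq> 0" and e: "distinct [e1, e3, e4]"
  defines "\<rho>3 \<equiv> - 1 / (e1 - e3)" and "\<rho>4 \<equiv> - 1 / (e1 - e4)"
  defines "A \<equiv> (\<rho>3 - \<rho>4) / 2" and "D \<equiv> (\<rho>3 + \<rho>4) / 2" and "B \<equiv> csqrt (\<alpha> * (e1 - e3) * (e1 - e4))"
  shows "general_solution (first_order_ode (binomial_poly \<alpha> [e1, e1, e3, e4]))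
     (given_by (\<lambda>z u. 1 / (u - e1) = A * cosh (B * z) + D))"
proof -
  have d: "e1 - e3 \<noteq> 0" "e1 - e4 \<noteq> 0" "e3 \<noteq> e4" using e by auto
  have B: "B \<noteq> 0" and B2: "B^2 = \<alpha> * (e1 - e3) * (e1 - e4)" using \<alpha> d by (auto simp: B_def)
  have A: "A \<noteq> 0" using d by (auto simp: A_def \<rho>3_def \<rho>4_def)
  define Y where "Y = (\<lambda>z. A * cosh (B * z) + D)"
  \<comment> \<open>The poles of \<open>u\<close> are the zeros of \<open>y\<close>, and cosh takes every value.\<close>
  obtain w where w: "cosh w = - D / A" using cosh_surj by blast
  have Y': "(Y has_field_derivative A * B * sinh (B * z)) (at z)" for z
    unfolding Y_def by (auto intro!: derivative_eq_intros)
  interpret q: entire_quotient "\<lambda>z. e1 * Y z + 1" Y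
     "\<lambda>z. e1 * (A * B * sinh (B * z))" "\<lambda>z. A * B * sinh (B * z)" "binomial_poly \<alpha> [e1, e1, e3, e4]" "w / B"
  proof
    fix z assume z: "Y z \<noteq> 0"
    define y where "y = Y z"
    define s where "s = sinh (B * z)"
    have y: "y \<noteq> 0" using z by (simp add: y_def)
    have v: "(e1 * y + 1) / y = e1 + 1 / y" using y by (simp add: field_simps)
    have "(y - D)^2 - A^2 = A^2 * s^2"
      using cosh_square_eq_complex[of "B * z"] by (simp add: y_def Y_def s_def power_mult_distrib algebra_simps)
    moreover have "(y - D)^2 - A^2 = (y - \<rho>3) * (y - \<rho>4)"
      by (simp add: A_def D_def field_simps power2_eq_square)
    ultimately have As: "A^2 * s^2 = (y - \<rho>3) * (y - \<rho>4)" by simp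
    have "((e1 * (A * B * s) * y - (e1 * y + 1) * (A * B * s)) / (y * y))^2 = (- (A * B * s) / (y * y))^2"
      by (simp add: algebra_simps)
    also have "\<dots> = B^2 * (A^2 * s^2) / y^4" by (simp add: power_divide eval_nat_numeral mult_ac)
    also have "\<dots> = \<alpha> * ((e1 - e3) * (y - \<rho>3)) * ((e1 - e4) * (y - \<rho>4)) / y^4"
      unfolding B2 As by (simp add: mult_ac)
    also have "(e1 - e3) * (y - \<rho>3) = y * (e1 + 1 / y - e3)" using d y by (simp add: \<rho>3_def field_simps)
    also have "(e1 - e4) * (y - \<rho>4) = y * (e1 + 1 / y - e4)" using d y by (simp add: \<rho>4_def field_simps)
    also have "\<alpha> * (y * (e1 + 1 / y - e3)) * (y * (e1 + 1 / y - e4)) / y^4 =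
       \<alpha> * (1 / y) * (1 / y) * (e1 + 1 / y - e3) * (e1 + 1 / y - e4)"
      using y by (simp add: eval_nat_numeral)
    also have "\<dots> = poly (binomial_poly \<alpha> [e1, e1, e3, e4]) ((e1 * y + 1) / y)"
      unfolding v poly_binomial_poly by (simp add: mult_ac)
    finally show "((e1 * (A * B * sinh (B * z)) * Y z - (e1 * Y z + 1) * (A * B * sinh (B * z))) / (Y z * Y z))\<^sup>2 =
         poly (binomial_poly \<alpha> [e1, e1, e3, e4]) ((e1 * Y z + 1) / Y z)" by (simp only: y_def s_def)
  next
    show "Y (w / B) = 0" using B A w by (simp add: Y_def)
    have "Y 0 = \<rho>3" by (simp add: Y_def A_def D_def field_simps)
    moreover have "\<rho>3 \<noteq> 0" using d by (simp add: \<rho>3_def)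
    ultimately show "\<exists>z. Y z \<noteq> 0" by metis
  qed (use Y' in \<open>auto intro!: derivative_eq_intros simp: algebra_simps\<close>)
  show ?thesis
  proof (rule q.general_solution_even)
    fix z assume "Y z \<noteq> 0"
    hence "(e1 * Y z + 1) / Y z - e1 = 1 / Y z" by (simp add: field_simps)
    thus "1 / ((e1 * Y z + 1) / Y z - e1) = A * cosh (B * z) + D" by (simp add: Y_def)
  next
    fix z u assume *: "Y z \<noteq> 0" "1 / (u - e1) = A * cosh (B * z) + D"
    hence "1 / (u - e1) = Y z" by (simp add: Y_def)
    moreover from this have "u - e1 \<noteq> 0" using *(1) by auto
    ultimately show "u = (e1 * Y z + 1) / Y z" using *(1) by (auto simp: field_simps)
  qed (simp add: Y_def)
qed

text \<open>For \<open>u = m + X\<close> with \<open>m\<close> the mean of the roots, \<open>(u - e_1)(u -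
  e_2) = X^2 - A^2\<close>, which is \<open>A^2 / sinh^2\<close> for \<open>X = A coth\<close> and
  either sign of \<open>A\<close>.\<close>

lemma BB_quartic_two_double:
  fixes \<alpha> e1 e2 :: complex
  assumes \<alpha>: "\<alpha> \<noteq> 0" and e: "e1 \<noteq> e2"
  defines "A \<equiv> (e1 - e2) / 2"
  defines "B \<equiv> A * csqrt \<alpha>"
  shows "general_solution (first_order_ode (binomial_poly \<alpha> [e1, e2, e1, e2]))
     (\<Union>\<sigma>\<in>{1,-1}. given_by (\<lambda>z u. u = (e1 + e2) / 2 + \<sigma> * A * (cosh (B * z) / sinh (B * z))))"
proof -
  define m where "m = (e1 + e2) / 2"
  have A: "A \<noteq> 0" and B: "B \<noteq> 0" and B2: "B^2 = A^2 * \<alpha>"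
    using \<alpha> e by (simp_all add: A_def B_def power_mult_distrib power_divide)
  have sc: "cosh (B * z) ^ 2 = 1 + sinh (B * z) ^ 2" for z by (rule cosh_square_eq_complex)
  have q: "entire_quotient (\<lambda>z. m * sinh (B * z) + \<sigma> * A * cosh (B * z)) (\<lambda>z. sinh (B * z))
     (\<lambda>z. m * (B * cosh (B * z)) + \<sigma> * A * (B * sinh (B * z))) (\<lambda>z. B * cosh (B * z))
     (binomial_poly \<alpha> [e1, e2, e1, e2]) 0" if \<sigma>: "\<sigma>^2 = 1" for \<sigma>
  proof
    fix z assume z: "sinh (B * z) \<noteq> 0"
    define s where "s = sinh (B * z)"
    define c where "c = cosh (B * z)"
    have s: "s \<noteq> 0" using z by (simp add: s_def)
    have c: "c^2 = 1 + s^2" using sc[of z] by (simp add: s_def c_def)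
    have num: "(m * (B * c) + \<sigma> * A * (B * s)) * s - (m * s + \<sigma> * A * c) * (B * c) = - (\<sigma> * A * B)"
      using c by algebra
    have v: "(m * s + \<sigma> * A * c) / s = m + \<sigma> * A * c / s" using s by (simp add: field_simps)
    have m12: "m - e1 = - A" "m - e2 = A" by (simp_all add: m_def A_def field_simps)
    define X where "X = \<sigma> * A * c / s"
    have "(m + X - e1) * (m + X - e2) = (X + (m - e1)) * (X + (m - e2))" by (simp add: algebra_simps)
    also have "\<dots> = X^2 - A^2" unfolding m12 by (simp add: algebra_simps power2_eq_square)
    finally have "(m + \<sigma> * A * c / s - e1) * (m + \<sigma> * A * c / s - e2) = (\<sigma> * A * c / s)^2 - A^2"
      by (simp only: X_def)
    also have "\<dots> = A^2 / s^2"
      using s by (simp add: power_divide power_mult_distrib \<sigma> c) (simp add: field_simps)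
    finally have v1: "(m + \<sigma> * A * c / s - e1) * (m + \<sigma> * A * c / s - e2) = A^2 / s^2" .
    have "(((m * (B * c) + \<sigma> * A * (B * s)) * s - (m * s + \<sigma> * A * c) * (B * c)) / (s * s))^2
        = \<sigma>^2 * A^2 * B^2 / (s^2)^2"
      unfolding num by (simp add: power_divide power_mult_distrib power2_eq_square)
    also have "\<dots> = \<alpha> * (A^2 / s^2) * (A^2 / s^2)" unfolding \<sigma> B2 by (simp add: power2_eq_square)
    also have "\<dots> = poly (binomial_poly \<alpha> [e1, e2, e1, e2]) ((m * s + \<sigma> * A * c) / s)"
      unfolding v poly_binomial_poly v1[symmetric] by (simp add: mult_ac)
    finally show "(((m * (B * cosh (B * z)) + \<sigma> * A * (B * sinh (B * z))) * sinh (B * z) -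
           (m * sinh (B * z) + \<sigma> * A * cosh (B * z)) * (B * cosh (B * z))) / (sinh (B * z) * sinh (B * z)))\<^sup>2 =
         poly (binomial_poly \<alpha> [e1, e2, e1, e2]) ((m * sinh (B * z) + \<sigma> * A * cosh (B * z)) / sinh (B * z))"
      by (simp only: s_def c_def)
  next
    fix z assume "sinh (B * z) = 0"
    moreover have "\<sigma> \<noteq> 0" using \<sigma> by auto
    ultimately show "m * sinh (B * z) + \<sigma> * A * cosh (B * z) \<noteq> 0" using sc[of z] A by auto
  next
    have "sinh (B * (\<i> * pi / 2 / B)) = \<i>" using B by (simp add: sinh_conv_sin)
    thus "\<exists>z. sinh (B * z) \<noteq> 0" by (metis complex_i_not_zero)
  qed (auto intro!: derivative_eq_intros)
  show ?thesis unfolding m_def[symmetric]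
  proof (rule general_solution_two_signs[OF q[of 1] q[of "-1"]], goal_cases)
    case (7 z)
    show ?case by (simp add: diff_divide_distrib)
  qed (auto simp: field_simps)
qed

text \<open>The Moebius transform \<open>t = (u - e_4)/(u - e_1)\<close> sends the simple root to 0 and the
  triple root to infinity, and the equation becomes \<open>t'^2 = \<alpha> (e_4 - e_1)^2
  t\<close>.\<close>

lemma BB_quartic_triple:
  fixes \<alpha> e1 e4 :: complex
  assumes \<alpha>: "\<alpha> \<noteq> 0" and e: "e1 \<noteq> e4"
  shows "general_solution (first_order_ode (binomial_poly \<alpha> [e1, e1, e1, e4]))
     (given_by (\<lambda>z u. (u - e4) / (u - e1) = \<alpha> * ((e4 - e1) / 2 * z)^2))"
proof -
  define d where "d = e4 - e1"
  have d: "d \<noteq> 0" using e by (simp add: d_def)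
  define t where "t = (\<lambda>z. \<alpha> * (d / 2 * z)^2)"
  have t': "(t has_field_derivative \<alpha> * d^2 * z / 2) (at z)" for z
    unfolding t_def by (auto intro!: derivative_eq_intros simp: field_simps power2_eq_square)
  interpret q: entire_quotient "\<lambda>z. e4 - e1 * t z" "\<lambda>z. 1 - t z"
     "\<lambda>z. - e1 * (\<alpha> * d^2 * z / 2)" "\<lambda>z. - (\<alpha> * d^2 * z / 2)" "binomial_poly \<alpha> [e1, e1, e1, e4]" "2 / (csqrt \<alpha> * d)"
  proof
    fix z assume z: "1 - t z \<noteq> 0"
    define x where "x = t z"
    define x' where "x' = \<alpha> * d^2 * z / 2"
    have x: "1 - x \<noteq> 0" using z by (simp add: x_def)
    have x'2: "x'^2 = \<alpha> * d^2 * x" by (simp add: x'_def x_def t_def field_simps power2_eq_square)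
    have num: "- e1 * x' * (1 - x) - (e4 - e1 * x) * - x' = x' * d" by (simp add: d_def algebra_simps)
    have v: "(e4 - e1 * x) / (1 - x) - e1 = d / (1 - x)" "(e4 - e1 * x) / (1 - x) - e4 = d * x / (1 - x)"
      using x by (simp_all add: d_def divide_simps) (simp_all add: algebra_simps)
    have "((- e1 * x' * (1 - x) - (e4 - e1 * x) * - x') / ((1 - x) * (1 - x)))^2 = x'^2 * d^2 / (1 - x)^4"
      unfolding num by (simp add: power_divide eval_nat_numeral mult_ac)
    also have "\<dots> = \<alpha> * (d / (1 - x)) * (d / (1 - x)) * (d / (1 - x)) * (d * x / (1 - x))"
      unfolding x'2 by (simp add: eval_nat_numeral mult_ac)
    also have "\<dots> = poly (binomial_poly \<alpha> [e1, e1, e1, e4]) ((e4 - e1 * x) / (1 - x))"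
      unfolding poly_binomial_poly using v by (simp add: mult_ac)
    finally show "((- e1 * (\<alpha> * d\<^sup>2 * z / 2) * (1 - t z) - (e4 - e1 * t z) * - (\<alpha> * d\<^sup>2 * z / 2)) /
          ((1 - t z) * (1 - t z)))\<^sup>2 =
         poly (binomial_poly \<alpha> [e1, e1, e1, e4]) ((e4 - e1 * t z) / (1 - t z))"
      by (simp only: x_def x'_def)
  next
    fix z assume "1 - t z = 0"
    hence "t z = 1" by simp
    thus "e4 - e1 * t z \<noteq> 0" using e by auto
  next
    show "1 - t (2 / (csqrt \<alpha> * d)) = 0" using d \<alpha> by (simp add: t_def power_divide power_mult_distrib)
    show "\<exists>z. 1 - t z \<noteq> 0" by (intro exI[of _ 0]) (simp add: t_def)
  qed (use t' in \<open>auto intro!: derivative_eq_intros\<close>)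
  show ?thesis unfolding d_def[symmetric]
  proof (rule q.general_solution_even)
    fix z assume z: "1 - t z \<noteq> 0"
    have "(e4 - e1 * t z) / (1 - t z) - e1 = d / (1 - t z)" "(e4 - e1 * t z) / (1 - t z) - e4 = d * t z / (1 - t z)"
      using z by (simp_all add: d_def divide_simps) (simp_all add: algebra_simps)
    hence "((e4 - e1 * t z) / (1 - t z) - e4) / ((e4 - e1 * t z) / (1 - t z) - e1) = t z"
      using z d by simp
    thus "((e4 - e1 * t z) / (1 - t z) - e4) / ((e4 - e1 * t z) / (1 - t z) - e1) = \<alpha> * (d / 2 * z)^2"
      by (simp only: t_def)
  next
    \<comment> \<open>At \<open>z = 0\<close> the formula is ambiguous: \<open>u = e_1\<close> also satisfies it,
      because division by 0 yields 0.\<close>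
    fix z u assume z: "z \<noteq> 0" "1 - t z \<noteq> 0" and "(u - e4) / (u - e1) = \<alpha> * (d / 2 * z)^2"
    hence *: "(u - e4) / (u - e1) = t z" by (simp add: t_def)
    moreover have "t z \<noteq> 0" using z \<alpha> d by (simp add: t_def)
    ultimately have "u - e1 \<noteq> 0" by auto
    with * have "u - e4 = t z * (u - e1)" by (simp add: divide_eq_eq)
    hence "u * (1 - t z) = e4 - e1 * t z" by (simp add: algebra_simps)
    thus "u = (e4 - e1 * t z) / (1 - t z)" using z(2) by (simp add: eq_divide_eq)
  qed (simp add: t_def)
qed

lemma BB_quartic_quadruple:
  fixes \<alpha> e1 :: complex
  assumes \<alpha>: "\<alpha> \<noteq> 0"
  shows "general_solution (first_order_ode (binomial_poly \<alpha> [e1, e1, e1, e1]))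
     (\<Union>\<sigma>\<in>{1,-1}. given_by (\<lambda>z u. u = e1 + \<sigma> * inverse (csqrt \<alpha>) / z))"
proof -
  define c where "c = inverse (csqrt \<alpha>)"
  have c: "c \<noteq> 0" "\<alpha> * c^2 = 1" using \<alpha> by (auto simp: c_def power_inverse)
  have q: "entire_quotient (\<lambda>z. e1 * z + \<sigma> * c) (\<lambda>z. z) (\<lambda>_. e1) (\<lambda>_. 1) (binomial_poly \<alpha> [e1, e1, e1, e1]) 0"
    if \<sigma>: "\<sigma>^2 = 1" for \<sigma>
  proof
    fix z :: complex assume z: "z \<noteq> 0"
    have v: "(e1 * z + \<sigma> * c) / z - e1 = \<sigma> * c / z" using z by (simp add: field_simps)
    have "poly (binomial_poly \<alpha> [e1, e1, e1, e1]) ((e1 * z + \<sigma> * c) / z) = (\<alpha> * c^2) * \<sigma>^2 * (\<sigma>^2 * c^2) / z^4"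
      unfolding poly_binomial_poly using v by (simp add: eval_nat_numeral mult_ac)
    also have "\<dots> = (\<sigma> * c)^2 / z^4" unfolding c(2) \<sigma> by (simp add: \<sigma> power_mult_distrib)
    also have "\<dots> = ((e1 * z - (e1 * z + \<sigma> * c) * 1) / (z * z))^2" by (simp add: power_divide eval_nat_numeral)
    finally show "((e1 * z - (e1 * z + \<sigma> * c) * 1) / (z * z))^2 = poly (binomial_poly \<alpha> [e1, e1, e1, e1]) ((e1 * z + \<sigma> * c) / z)" ..
  next
    have "\<sigma> \<noteq> 0" using \<sigma> by auto
    thus "e1 * z + \<sigma> * c \<noteq> 0" if "z = 0" for z using that c by simp
    show "\<exists>z::complex. z \<noteq> 0" by (intro exI[of _ 1]) simp
  qed (auto intro!: derivative_eq_intros)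
  show ?thesis unfolding c_def[symmetric]
  proof (rule general_solution_two_signs[OF q[of 1] q[of "-1"]], goal_cases)
    case (7 z)
    show ?case by (simp add: diff_divide_distrib)
  qed (auto simp: field_simps)
qed

section \<open>Cubic equations with distinct roots\<close>

lemma remove_sings_nicely:
  assumes "U nicely_meromorphic_on UNIV" shows "remove_sings U = U"
proof
  fix z
  have m: "U meromorphic_on UNIV" using assms by (simp add: nicely_meromorphic_on_def)
  have "isolated_singularity_at U z" using m by (auto simp: meromorphic_on_altdef)
  hence ev: "eventually (\<lambda>w. remove_sings U w = U w) (at z)" by (rule eventually_remove_sings_eq_at)
  show "remove_sings U z = U z"
    by (rule nicely_meromorphic_eq_at[OF _ _ ev])
       (use remove_sings_nicely_meromorphic[OF m] assms in \<open>auto intro: nicely_meromorphic_on_subset\<close>)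
qed

text \<open>The scaling \<open>u = (4/\<alpha>) V\<close> turns the leading coefficient
  \<open>\<alpha>\<close> into 4 and multiplies the roots by \<open>\<alpha>/4\<close>.\<close>

lemma BB_cubic_distinct:
  fixes \<alpha> e1 e2 e3 :: complex
  assumes \<alpha>: "\<alpha> \<noteq> 0" and e: "distinct [e1, e2, e3]"
  shows "\<exists>\<Lambda>. is_period_lattice \<Lambda> \<and> general_solution (first_order_ode (binomial_poly \<alpha> [e1, e2, e3]))
     (given_by (\<lambda>z u. u = (e1 + e2 + e3) / 3 + 4 / \<alpha> * weierstrass_p \<Lambda> z))"
proof -
  have "distinct [\<alpha> / 4 * e1, \<alpha> / 4 * e2, \<alpha> / 4 * e3]" using e \<alpha> by auto
  then obtain \<Lambda> V where lat: "is_period_lattice \<Lambda>"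
    and V: "V \<in> nonconst_meromorphic_solutions (first_order_ode (cubic (\<alpha> / 4 * e1) (\<alpha> / 4 * e2) (\<alpha> / 4 * e3)))"
    and poles: "\<And>z. is_pole V z \<longleftrightarrow> z \<in> \<Lambda>" and per: "\<And>\<omega> z. \<omega> \<in> \<Lambda> \<Longrightarrow> V (z + \<omega>) = V z" and even: "\<And>z. V (- z) = V z"
    and Vp: "\<And>z. z \<notin> \<Lambda> \<Longrightarrow> V z = (\<alpha> / 4 * e1 + \<alpha> / 4 * e2 + \<alpha> / 4 * e3) / 3 + weierstrass_p \<Lambda> z"
    by (rule elliptic_uniformization) (rule that; assumption)
  interpret complex_lattice \<Lambda> by unfold_locales (rule lat)
  define U where "U = (\<lambda>z. 4 / \<alpha> * V z)"
  have Vn: "V nicely_meromorphic_on UNIV" "\<not> V constant_on UNIV"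
    and Vode: "\<And>z. \<not> is_pole V z \<Longrightarrow> deriv V z ^ 2 = poly (cubic (\<alpha> / 4 * e1) (\<alpha> / 4 * e2) (\<alpha> / 4 * e3)) (V z)"
    using V by (auto simp: nonconst_meromorphic_solutions_def meromorphic_solution_def satisfies_first_order)
  have Un: "U nicely_meromorphic_on UNIV" unfolding U_def by (rule nicely_meromorphic_on_cmult_left[OF Vn(1)])
  have Up: "is_pole U z \<longleftrightarrow> z \<in> \<Lambda>" for z
    using poles[of z] is_pole_cmult_iff[of "4 / \<alpha>" V z] \<alpha> by (simp add: U_def)
  have Uv: "U z = (e1 + e2 + e3) / 3 + 4 / \<alpha> * weierstrass_p \<Lambda> z" if "z \<notin> \<Lambda>" for z
    unfolding U_def Vp[OF that] using \<alpha> by (simp add: field_simps)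
  have "meromorphic_solution (first_order_ode (binomial_poly \<alpha> [e1, e2, e3])) U"
    unfolding meromorphic_solution_def satisfies_first_order
  proof (intro conjI Un allI impI)
    fix z assume "\<not> is_pole U z"
    hence z: "\<not> is_pole V z" using Up poles by blast
    have "V analytic_on {z}" using nicely_meromorphic_on_imp_analytic_at[OF Vn(1) _ z] by simp
    hence "deriv U z = 4 / \<alpha> * deriv V z" unfolding U_def
      by (intro deriv_cmult analytic_on_imp_differentiable_at) auto
    hence "deriv U z ^ 2 = (4 / \<alpha>)^2 * deriv V z ^ 2" by (simp only: power_mult_distrib)
    also have "\<dots> = (4 / \<alpha>)^2 * (4 * (V z - \<alpha> / 4 * e1) * (V z - \<alpha> / 4 * e2) * (V z - \<alpha> / 4 * e3))"
      by (simp only: Vode[OF z] poly_cubic)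
    also have "\<dots> = poly (binomial_poly \<alpha> [e1, e2, e3]) (U z)"
      unfolding poly_binomial_poly U_def using \<alpha> by (simp add: field_simps power2_eq_square)
    finally show "deriv U z ^ 2 = poly (binomial_poly \<alpha> [e1, e2, e3]) (U z)" .
  qed
  moreover have "\<not> U constant_on UNIV"
  proof
    assume "U constant_on UNIV"
    then obtain c where "\<And>z. 4 / \<alpha> * V z = c" by (auto simp: constant_on_def U_def)
    hence "V z = c * \<alpha> / 4" for z using \<alpha> by (auto simp: field_simps)
    hence "V constant_on UNIV" unfolding constant_on_def by blast
    thus False using Vn(2) by blast
  qed
  ultimately have Usol: "U \<in> nonconst_meromorphic_solutions (first_order_ode (binomial_poly \<alpha> [e1, e2, e3]))"
    by (simp add: nonconst_meromorphic_solutions_def)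
  have "given_by (\<lambda>z u. u = (e1 + e2 + e3) / 3 + 4 / \<alpha> * weierstrass_p \<Lambda> z) = range (\<lambda>c z. remove_sings U (z + c))"
  proof (rule given_by_formula)
    show "U meromorphic_on UNIV" using Un by (simp add: nicely_meromorphic_on_def)
    show "remove_sings U z = (e1 + e2 + e3) / 3 + 4 / \<alpha> * weierstrass_p \<Lambda> z" if "\<not> is_pole U z" for z
      using that Up Uv by (simp add: remove_sings_nicely[OF Un])
    show "eventually (\<lambda>w. \<forall>u. u = (e1 + e2 + e3) / 3 + 4 / \<alpha> * weierstrass_p \<Lambda> w \<longrightarrow> u = U w) (at z)" for z
      using eventually_not_in_lattice[of z] by eventually_elim (use Uv in auto)
  qed
  hence "general_solution (first_order_ode (binomial_poly \<alpha> [e1, e2, e3]))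
     (given_by (\<lambda>z u. u = (e1 + e2 + e3) / 3 + 4 / \<alpha> * weierstrass_p \<Lambda> z))"
    unfolding remove_sings_nicely[OF Un] using even
    by (intro general_solution_translates_even[OF Usol]) (auto simp: U_def)
  thus ?thesis using lat by blast
qed

section \<open>Quartic equations with distinct roots\<close>

text \<open>At a simple zero of \<open>f\<close> the residue of \<open>1/f\<close> is \<open>1/f'\<close>.\<close>

lemma simple_zero_reciprocal:
  assumes f: "f analytic_on {z0}" and "f z0 = 0" and d: "deriv f z0 = d" "d \<noteq> 0"
  shows "\<exists>k. k analytic_on {z0} \<and> eventually (\<lambda>z. d / f z = 1 / (z - z0) + k z) (at z0)"
proof -
  define g where "g = (\<lambda>w. f (z0 + w))"
  have ga: "g analytic_on {0}" unfolding g_def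
    by (rule analytic_on_compose_gen[of "\<lambda>w. z0 + w" "{0}" f "{z0}", unfolded o_def])
       (auto intro!: analytic_intros f)
  have "g 0 = 0" "deriv g 0 = d" using assms by (simp_all add: g_def deriv_shift[of f])
  define h where "h = (\<lambda>w. g w - d * w)"
  have ha: "h analytic_on {0}" unfolding h_def using ga by (intro analytic_intros)
  have "(g has_field_derivative d) (at 0)"
    using ga \<open>deriv g 0 = d\<close> analytic_on_imp_differentiable_at DERIV_deriv_iff_field_differentiable by blast
  hence "deriv h 0 = 0" unfolding h_def by (intro DERIV_imp_deriv) (auto intro!: derivative_eq_intros)
  moreover have "h 0 = 0" using \<open>g 0 = 0\<close> by (simp add: h_def)
  ultimately have "(deriv ^^ i) h 0 = 0" if "i < 2" for i
    using that by (auto simp: less_2_cases_iff)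
  then obtain n where n: "n analytic_on {0}" "eventually (\<lambda>w. h w = w^2 * n w) (nhds 0)"
    using analytic_factor_power[OF ha, of 2] by auto
  define k where "k = (\<lambda>w. - n w / (d + w * n w))"
  have ka: "k analytic_on {0}" unfolding k_def using n(1) d by (intro analytic_intros) auto
  have "isCont (\<lambda>w. d + w * n w) 0" using analytic_at_imp_isCont[OF n(1)] by (intro continuous_intros)
  hence "((\<lambda>w. d + w * n w) \<longlongrightarrow> d) (at 0)" by (simp add: isCont_def)
  hence "eventually (\<lambda>w. d + w * n w \<noteq> 0) (at 0)" using d by (intro tendsto_imp_eventually_ne)
  moreover have "eventually (\<lambda>w. h w = w^2 * n w) (at 0)" using n(2) by (simp add: eventually_nhds_conv_at)
  moreover have "eventually (\<lambda>w::complex. w \<noteq> 0) (at 0)" by (simp add: eventually_at_filter)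
  ultimately have ev: "eventually (\<lambda>w. d / g w = 1 / w + k w) (at 0)"
  proof eventually_elim
    case (elim w)
    have "g w = w * (d + w * n w)" using elim(2) by (simp add: h_def algebra_simps power2_eq_square)
    thus ?case using elim(1,3) unfolding k_def by (simp add: divide_simps)
  qed
  have "eventually (\<lambda>w. d / g w = 1 / w + k w) (filtermap (\<lambda>z. 1 * z + (- z0)) (at z0))"
    using ev by (subst filtermap_affine_at) simp_all
  hence "eventually (\<lambda>z. d / f z = 1 / (z - z0) + k (z - z0)) (at z0)"
    by (simp add: eventually_filtermap g_def)
  moreover have "(k \<circ> (\<lambda>w. w - z0)) analytic_on {z0}"
    by (rule analytic_on_compose_gen[where T = "{0}"]) (auto intro!: analytic_intros ka)
  ultimately show ?thesis unfolding o_def by blast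
qed

lemma not_pole_if_eventually_analytic:
  assumes "eventually (\<lambda>w. f w = g w) (at z)" "g analytic_on {z}"
  shows "\<not> is_pole f z"
  using is_pole_cong[OF assms(1) refl] analytic_at_imp_no_pole[OF assms(2)] by blast

text \<open>The function \<open>V\<close> is the normal form of \<open>\<wp>\<close>, with value 0 at the
  lattice points. The point \<open>a\<close> is not a half-period since \<open>d \<noteq>
  0\<close>.\<close>

locale elliptic_function = complex_lattice +
  fixes V :: "complex \<Rightarrow> complex" and q1 q2 q3 a p0 d :: complex
  assumes V: "V \<in> nonconst_meromorphic_solutions (first_order_ode (cubic q1 q2 q3))"
    and poles: "\<And>z. is_pole V z \<longleftrightarrow> z \<in> \<Lambda>"
    and per: "\<And>\<omega> z. \<omega> \<in> \<Lambda> \<Longrightarrow> V (z + \<omega>) = V z"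
    and even: "\<And>z. V (- z) = V z"
    and Vp: "\<And>z. z \<notin> \<Lambda> \<Longrightarrow> V z = weierstrass_p \<Lambda> z"
    and a: "a \<notin> \<Lambda>" "V a = p0" "deriv V a = d" and d: "d \<noteq> 0"
begin

lemma nicely: "V nicely_meromorphic_on UNIV"
  and ode: "z \<notin> \<Lambda> \<Longrightarrow> deriv V z ^ 2 = poly (cubic q1 q2 q3) (V z)"
  using V poles by (auto simp: nonconst_meromorphic_solutions_def meromorphic_solution_def satisfies_first_order)

lemma analytic: "z \<notin> \<Lambda> \<Longrightarrow> V analytic_on {z}"
  using nicely_meromorphic_on_imp_analytic_at[OF nicely] poles by blast

lemma deriv_periodic:
  assumes "\<omega> \<in> \<Lambda>" "z \<notin> \<Lambda>"
  shows "deriv V (z + \<omega>) = deriv V z"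
proof -
  have "V = (\<lambda>z. V (1 * z + \<omega>))" using per[OF assms(1)] by simp
  hence "deriv V z = deriv (\<lambda>z. V (1 * z + \<omega>)) z" by simp
  also have "\<dots> = 1 * deriv V (1 * z + \<omega>)"
    using analytic[of "z + \<omega>"] assms add_lattice_iff
    by (intro deriv_compose_linear' analytic_on_imp_differentiable_at) auto
  finally show ?thesis by simp
qed

lemma deriv_odd:
  assumes "z \<notin> \<Lambda>"
  shows "deriv V (- z) = - deriv V z"
proof -
  have "V = (\<lambda>z. V ((-1) * z + 0))" using even by simp
  hence "deriv V z = deriv (\<lambda>z. V ((-1) * z + 0)) z" by simp
  also have "\<dots> = (-1) * deriv V ((-1) * z + 0)"
    using analytic[of "- z"] assms by (intro deriv_compose_linear' analytic_on_imp_differentiable_at) auto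
  finally show ?thesis by simp
qed

lemma deriv_p: "z \<notin> \<Lambda> \<Longrightarrow> deriv (weierstrass_p \<Lambda>) z = deriv V z"
proof -
  assume z: "z \<notin> \<Lambda>"
  have "eventually (\<lambda>w. w \<in> - \<Lambda>) (nhds z)"
    using open_minus_sublattice[of \<Lambda>] z by (intro eventually_nhds_in_open) auto
  hence "eventually (\<lambda>w. weierstrass_p \<Lambda> w = V w) (nhds z)" by eventually_elim (use Vp in auto)
  thus ?thesis by (intro deriv_cong_ev) auto
qed

lemma two_a: "2 * a \<notin> \<Lambda>"
proof
  assume "2 * a \<in> \<Lambda>"
  hence "deriv V (- a + 2 * a) = deriv V (- a)" using a(1) by (intro deriv_periodic) auto
  hence "d = - d" using deriv_odd[OF a(1)] a(3) by simp
  thus False using d by simp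
qed

text \<open>At a point with \<open>V z = V a\<close> the derivatives agree up to sign, so \<open>V\<close>
  is invariant under a translation or a reflection taking \<open>z\<close> to \<open>a\<close>. As
  0 is a pole of \<open>V\<close>, its image is a pole as well.\<close>

lemma fibre:
  assumes z: "z \<notin> \<Lambda>" "V z = p0"
  shows "z - a \<in> \<Lambda> \<or> z + a \<in> \<Lambda>"
proof -
  have main: "x - a \<in> \<Lambda>" if x: "x \<notin> \<Lambda>" "V x = p0" "deriv V x = d" for x
  proof -
    define W where "W = (\<lambda>z. V (1 * z + (x - a)))"
    have "W = V"
    proof (rule first_order_solution_unique[OF _ V])
      show "W \<in> nonconst_meromorphic_solutions (first_order_ode (cubic q1 q2 q3))"
        unfolding W_def by (rule nonconst_solution_affine[OF V]) simp
      show "\<not> is_pole V a" using a poles by simp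
      show "\<not> is_pole W a" unfolding W_def using is_pole_affine_iff[of 1 V "x - a" a] x poles by simp
      show "W a = V a" using x a by (simp add: W_def)
      have "deriv W a = 1 * deriv V (1 * a + (x - a))" unfolding W_def
        using analytic[OF x(1)] by (intro deriv_compose_linear' analytic_on_imp_differentiable_at) auto
      thus "deriv W a = deriv V a" using x a by simp
    qed
    hence "is_pole V (x - a)"
      using is_pole_affine_iff[of 1 V "x - a" 0] poles[of 0] zero_in_lattice by (simp add: W_def)
    thus ?thesis using poles by simp
  qed
  have "deriv V z ^ 2 = deriv V a ^ 2" using ode[OF z(1)] ode[OF a(1)] z(2) a(2) by simp
  hence "deriv V z = d \<or> deriv V z = - d" using a(3) by (simp add: power2_eq_iff)
  thus ?thesis
  proof
    assume "deriv V z = - d"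
    hence "- z - a \<in> \<Lambda>" using z even[of z] deriv_odd[OF z(1)] by (intro main) auto
    hence "- (- z - a) \<in> \<Lambda>" by (rule uminus_in_lattice)
    thus ?thesis by (simp add: add.commute)
  qed (use main z in blast)
qed

definition G :: "complex \<Rightarrow> complex" where
  "G z = weierstrass_zeta \<Lambda> (z + a) - weierstrass_zeta \<Lambda> (z - a) - 2 * weierstrass_zeta \<Lambda> a"

definition X :: "complex \<Rightarrow> complex" where
  "X z = - d / (V z - p0)"

lemma zeta_shift_meromorphic: "(\<lambda>z. weierstrass_zeta \<Lambda> (z + b)) meromorphic_on A"
  by (rule meromorphic_on_compose[OF meromorphic_zeta[of UNIV]]) (auto intro!: analytic_intros)

lemma zeta_shift_analytic: "z + b \<notin> \<Lambda> \<Longrightarrow> (\<lambda>z. weierstrass_zeta \<Lambda> (z + b)) analytic_on {z}"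
  by (rule analytic_on_compose_gen[of "\<lambda>z. z + b" "{z}" _ "{z + b}", unfolded o_def])
     (auto intro!: analytic_intros analytic_zeta)

lemma G_meromorphic: "G meromorphic_on A"
  unfolding G_def[abs_def] using zeta_shift_meromorphic[of a] zeta_shift_meromorphic[of "- a"]
  by (intro meromorphic_intros) auto

lemma G_analytic: "z + a \<notin> \<Lambda> \<Longrightarrow> z - a \<notin> \<Lambda> \<Longrightarrow> G analytic_on {z}"
  unfolding G_def[abs_def] using zeta_shift_analytic[of z a] zeta_shift_analytic[of z "- a"]
  by (intro analytic_intros) auto

lemma X_meromorphic: "X meromorphic_on A"
proof -
  have "V meromorphic_on A" using nicely meromorphic_on_subset by (auto simp: nicely_meromorphic_on_def)
  thus ?thesis unfolding X_def[abs_def] by (intro meromorphic_intros)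
qed

lemma X_analytic: "z \<notin> \<Lambda> \<Longrightarrow> z + a \<notin> \<Lambda> \<Longrightarrow> z - a \<notin> \<Lambda> \<Longrightarrow> X analytic_on {z}"
  unfolding X_def[abs_def] using analytic[of z] fibre[of z] by (intro analytic_intros) auto

lemma X_at_lattice: "z \<in> \<Lambda> \<Longrightarrow> (X \<longlongrightarrow> 0) (at z)"
proof -
  assume "z \<in> \<Lambda>"
  hence "is_pole (\<lambda>z. V z + (- p0)) z" using poles is_pole_plus_const_iff by blast
  hence "((\<lambda>z. - d * inverse (V z - p0)) \<longlongrightarrow> - d * 0) (at z)"
    using is_pole_tendsto[of "\<lambda>z. V z + (- p0)" z] by (intro tendsto_mult tendsto_const) (simp add: o_def)
  thus ?thesis by (simp add: X_def[abs_def] divide_inverse)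
qed

lemma zeta_shift_pole:
  assumes "z0 + b \<in> \<Lambda>"
  shows "\<exists>h. h analytic_on {z0} \<and> (\<forall>z. weierstrass_zeta \<Lambda> (z + b) = 1 / (z - z0) + h z)"
proof -
  obtain h where h: "h analytic_on {z0 + b}" "\<And>z. weierstrass_zeta \<Lambda> z = 1 / (z - (z0 + b)) + h z"
    using zeta_at_lattice_point[OF assms] by blast
  have "(\<lambda>z. h (z + b)) analytic_on {z0}"
    by (rule analytic_on_compose_gen[of "\<lambda>z. z + b" "{z0}" h "{z0 + b}", unfolded o_def])
       (auto intro!: analytic_intros h(1))
  thus ?thesis using h(2) by (intro exI[of _ "\<lambda>z. h (z + b)"]) (auto simp: algebra_simps)
qed

lemma simple_pole_plus_analytic:
  assumes "h analytic_on {z0}" "c \<noteq> 0"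
  shows "is_pole (\<lambda>z. c / (z - z0) + h z) z0"
proof -
  have "filterlim (\<lambda>z. c / (z - z0)) at_infinity (at z0)"
    using is_pole_cmult_iff[OF assms(2), of "\<lambda>z. 1 / (z - z0)" z0] is_pole_inverse[of z0]
    by (simp add: is_pole_def)
  moreover have "(h \<longlongrightarrow> h z0) (at z0)" using analytic_at_imp_isCont[OF assms(1)] by (simp add: isCont_def)
  ultimately have "filterlim (\<lambda>z. h z + c / (z - z0)) at_infinity (at z0)"
    by (rule tendsto_add_filterlim_at_infinity[rotated])
  thus ?thesis by (simp add: is_pole_def add.commute)
qed

text \<open>At the translates of \<open>a\<close> both functions have a simple pole with residue
  \<open>-1\<close>, coming from \<open>- \<zeta>(z - a)\<close> in \<open>G\<close> and from the
  simple zero of \<open>V - p_0\<close> in \<open>X\<close>.\<close>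

lemma G_X_at_plus:
  assumes z: "z - a \<in> \<Lambda>"
  shows "is_pole G z" "\<not> is_pole (\<lambda>z. G z - X z) z"
proof -
  have zL: "z \<notin> \<Lambda>" using add_lattice_iff[OF z, of a] a(1) by simp
  have za: "z + a \<notin> \<Lambda>" using add_lattice_iff[OF z, of "2 * a"] two_a by (simp add: algebra_simps)
  obtain h where h: "h analytic_on {z}" "\<And>w. weierstrass_zeta \<Lambda> (w + (- a)) = 1 / (w - z) + h w"
    using zeta_shift_pole[of z "- a"] z by auto
  define g where "g = (\<lambda>w. weierstrass_zeta \<Lambda> (w + a) - h w - 2 * weierstrass_zeta \<Lambda> a)"
  have g: "g analytic_on {z}" unfolding g_def using zeta_shift_analytic[OF za] h(1) by (intro analytic_intros)
  have Gg: "G w = - 1 / (w - z) + g w" for w using h(2)[of w] by (simp add: G_def g_def)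
  show "is_pole G z" using simple_pole_plus_analytic[OF g, of "-1"] by (simp add: Gg[abs_def])
  have Vz: "V z = p0" "deriv V z = d" using per[OF z, of a] deriv_periodic[OF z a(1)] a by auto
  have "\<exists>k. k analytic_on {z} \<and> eventually (\<lambda>w. d / (V w - p0) = 1 / (w - z) + k w) (at z)"
  proof (rule simple_zero_reciprocal)
    show "(\<lambda>w. V w - p0) analytic_on {z}" using analytic[OF zL] by (intro analytic_intros)
    have "deriv (\<lambda>w. V w - p0) z = deriv V z - deriv (\<lambda>_. p0) z"
      using analytic[OF zL] by (intro deriv_diff analytic_on_imp_differentiable_at) auto
    thus "deriv (\<lambda>w. V w - p0) z = d" using Vz by simp
  qed (use Vz d in auto)
  then obtain k where k: "k analytic_on {z}" "eventually (\<lambda>w. d / (V w - p0) = 1 / (w - z) + k w) (at z)" by blast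
  have "eventually (\<lambda>w. G w - X w = g w + k w) (at z)"
    using k(2) by eventually_elim (simp add: X_def Gg)
  thus "\<not> is_pole (\<lambda>z. G z - X z) z"
    by (rule not_pole_if_eventually_analytic) (use g k(1) in \<open>intro analytic_intros\<close>)
qed

lemma G_even: "G (- z) = G z"
proof -
  have e: "- z + a = - (z - a)" "- z - a = - (z + a)" by simp_all
  show ?thesis unfolding G_def e zeta_odd by simp
qed

lemma X_even: "X (- z) = X z"
  by (simp add: X_def even)

lemma G_X_at_minus:
  assumes z: "z + a \<in> \<Lambda>"
  shows "is_pole G z" "\<not> is_pole (\<lambda>z. G z - X z) z"
proof -
  have m: "- z - a \<in> \<Lambda>" using uminus_in_lattice[OF z] by simp
  have "is_pole (\<lambda>z. G ((-1) * z + 0)) z \<longleftrightarrow> is_pole G ((-1) * z + 0)"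
    "is_pole (\<lambda>z. G ((-1) * z + 0) - X ((-1) * z + 0)) z \<longleftrightarrow> is_pole (\<lambda>z. G z - X z) ((-1) * z + 0)"
    by (rule is_pole_affine_iff, simp)+
  thus "is_pole G z" "\<not> is_pole (\<lambda>z. G z - X z) z"
    using G_X_at_plus[OF m] by (simp_all add: G_even X_even)
qed

definition regular :: "complex \<Rightarrow> bool" where
  "regular z \<longleftrightarrow> z \<notin> \<Lambda> \<and> z + a \<notin> \<Lambda> \<and> z - a \<notin> \<Lambda>"

lemma regular_shift: "\<omega> \<in> \<Lambda> \<Longrightarrow> regular (z + \<omega>) \<longleftrightarrow> regular z"
  using add_lattice_iff[of \<omega> z] add_lattice_iff[of \<omega> "z + a"] add_lattice_iff[of \<omega> "z - a"]
  by (simp add: regular_def algebra_simps)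

lemma open_regular: "open {z. regular z}"
proof -
  have o: "open (- \<Lambda>)" by (rule open_minus_sublattice) simp
  have "open ((\<lambda>z. z + b) -` (- \<Lambda>))" for b by (intro open_vimage o continuous_intros)
  from this[of 0] this[of a] this[of "- a"]
  have "open ((\<lambda>z. z + 0) -` (- \<Lambda>) \<inter> (\<lambda>z. z + a) -` (- \<Lambda>) \<inter> (\<lambda>z. z + (- a)) -` (- \<Lambda>))" by (intro open_Int)
  also have "\<dots> = {z. regular z}" by (auto simp: regular_def)
  finally show ?thesis .
qed

lemma eventually_regular: "eventually regular (at 0)"
proof -
  have o: "open (- \<Lambda>)" by (rule open_minus_sublattice) simp
  have "open ((\<lambda>z. z + b) -` (- \<Lambda>))" for b by (intro open_vimage o continuous_intros)
  hence "eventually (\<lambda>z. z \<in> (\<lambda>z. z + b) -` (- \<Lambda>)) (at 0)" if "b \<notin> \<Lambda>" for b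
    using that by (intro eventually_at_in_open') auto
  from this[of a] this[of "- a"] have "eventually (\<lambda>z. z + a \<notin> \<Lambda>) (at 0)" "eventually (\<lambda>z. z - a \<notin> \<Lambda>) (at 0)"
    using a(1) by auto
  thus ?thesis using eventually_not_in_lattice[of 0] by eventually_elim (simp add: regular_def)
qed

text \<open>The poles of \<open>G\<close> and \<open>X\<close> at the translates of \<open>a\<close> and
  \<open>- a\<close> cancel, so \<open>G - X\<close> is entire after removal of singularities. It
  is even, and its derivative is periodic since \<open>\<zeta>' = - \<wp>\<close>; so it is
  constant. At 0 both functions vanish.\<close>

lemma addition_identity: "regular z \<Longrightarrow> G z = X z"
proof -
  define f where "f = (\<lambda>z. G z - X z)"
  define H where "H = remove_sings f"
  have fm: "f meromorphic_on A" for A unfolding f_def by (intro meromorphic_intros G_meromorphic X_meromorphic)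
  have iso: "isolated_singularity_at f z" for z using fm[of UNIV] by (auto simp: meromorphic_on_altdef)
  have Hn: "H nicely_meromorphic_on UNIV" unfolding H_def by (rule remove_sings_nicely_meromorphic[OF fm])
  have fan: "f analytic_on {z}" if "regular z" for z
    using that unfolding f_def regular_def by (intro analytic_intros G_analytic X_analytic) auto
  have Hf: "H z = f z" if "regular z" for z unfolding H_def by (rule remove_sings_at_analytic[OF fan[OF that]])
  have lim: "(f \<longlongrightarrow> G z) (at z)" if z: "z \<in> \<Lambda>" for z
  proof -
    have "z + a \<notin> \<Lambda>" "z - a \<notin> \<Lambda>"
      using add_lattice_iff[OF z, of a] add_lattice_iff[OF z, of "- a"] a(1) by (auto simp: add.commute)
    hence "(G \<longlongrightarrow> G z) (at z)" using analytic_at_imp_isCont[OF G_analytic] by (simp add: isCont_def)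
    from tendsto_diff[OF this X_at_lattice[OF z]] show ?thesis by (simp add: f_def)
  qed
  have "\<not> is_pole H z" for z
  proof -
    have "\<not> is_pole f z"
    proof (cases "regular z")
      case True thus ?thesis using fan analytic_at_imp_no_pole by blast
    next
      case False
      then consider "z \<in> \<Lambda>" | "z - a \<in> \<Lambda>" | "z + a \<in> \<Lambda>" by (auto simp: regular_def)
      thus ?thesis
      proof cases
        case 1
        show ?thesis using lim[OF 1] not_tendsto_and_filterlim_at_infinity[of "at z" f "G z"]
          by (auto simp: is_pole_def)
      qed (use G_X_at_plus(2) G_X_at_minus(2) in \<open>auto simp: f_def\<close>)
    qed
    thus ?thesis unfolding H_def using is_pole_remove_sings_iff[OF iso] by simp
  qed
  hence Hh: "H holomorphic_on UNIV" by (rule no_poles_imp_entire[OF Hn])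
  have "H constant_on UNIV"
  proof (rule entire_even_quasiperiodic_constant[OF Hh])
    show "H (- z) = H z" for z
      using remove_sings_affine_eq[OF fm fm, of "-1" 0 z] by (simp add: H_def f_def G_even X_even)
    fix \<omega> assume w: "\<omega> \<in> \<Lambda>"
    have dH: "deriv H z = - V (z + a) + V (z - a) - d * deriv V z / (V z - p0)^2" if z: "regular z" for z
    proof -
      have nl: "z \<notin> \<Lambda>" "z + a \<notin> \<Lambda>" "z - a \<notin> \<Lambda>" using z by (auto simp: regular_def)
      have ne: "V z - p0 \<noteq> 0" using fibre[of z] nl by auto
      have "eventually (\<lambda>w. w \<in> {z. regular z}) (nhds z)"
        using open_regular z by (intro eventually_nhds_in_open) auto
      hence "eventually (\<lambda>w. H w = f w) (nhds z)" by eventually_elim (use Hf in auto)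
      hence "deriv H z = deriv f z" by (intro deriv_cong_ev) auto
      also have "\<dots> = - V (z + a) + V (z - a) - d * deriv V z / (V z - p0)^2"
      proof (rule DERIV_imp_deriv)
        have 1: "((\<lambda>z. weierstrass_zeta \<Lambda> (z + b)) has_field_derivative - V (z + b)) (at z)" if "z + b \<notin> \<Lambda>" for b
          using DERIV_shift[of "weierstrass_zeta \<Lambda>" "- V (z + b)" z b] zeta_deriv[OF that] Vp[OF that] by simp
        have 2: "(V has_field_derivative deriv V z) (at z)"
          using analytic[OF nl(1)] analytic_on_imp_differentiable_at DERIV_deriv_iff_field_differentiable by blast
        have 3: "(X has_field_derivative d * deriv V z / (V z - p0)^2) (at z)"
          unfolding X_def[abs_def] using ne by (auto intro!: derivative_eq_intros 2 simp: power2_eq_square)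
        have "(f has_field_derivative (- V (z + a) - - V (z + (- a)) - 0) - d * deriv V z / (V z - p0)^2) (at z)"
          unfolding f_def G_def using 1[of a] 1[of "- a"] nl 3
          by (intro DERIV_diff DERIV_const) auto
        thus "(f has_field_derivative - V (z + a) + V (z - a) - d * deriv V z / (V z - p0)^2) (at z)" by simp
      qed
      finally show ?thesis .
    qed
    show "eventually (\<lambda>z. deriv H (z + \<omega>) = deriv H z) (at 0)"
      using eventually_regular
    proof eventually_elim
      case (elim z)
      have "regular (z + \<omega>)" using elim regular_shift[OF w] by simp
      moreover have "z \<notin> \<Lambda>" using elim by (simp add: regular_def)
      moreover have "V (z + \<omega> + a) = V (z + a)" "V (z + \<omega> - a) = V (z - a)"
        using per[OF w, of "z + a"] per[OF w, of "z - a"] by (simp_all add: algebra_simps)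
      ultimately show ?case using dH elim per[OF w, of z] deriv_periodic[OF w, of z] by simp
    qed
  qed
  then obtain c where c: "\<And>z. H z = c" by (auto simp: constant_on_def)
  have "G 0 = 0" using zeta_odd[of a] by (simp add: G_def)
  hence "(f \<longlongrightarrow> 0) (at 0)" using lim[OF zero_in_lattice] by simp
  moreover have "eventually (\<lambda>w. f w = c) (at 0)"
    using eventually_remove_sings_eq_at[OF iso[of 0]] by eventually_elim (use c in \<open>simp add: H_def\<close>)
  hence "(f \<longlongrightarrow> c) (at 0)" by (rule tendsto_eventually)
  ultimately have "c = 0" using LIM_unique by blast
  assume "regular z"
  thus "G z = X z" using Hf c \<open>c = 0\<close> by (simp add: f_def)
qed

end

text \<open>Scaling and shifting, \<open>u = x/s + e_4\<close> with \<open>s^2 = \<alpha>\<close>, gives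
  \<open>x'^2 = x (x - r_1)(x - r_2)(x - r_3)\<close>. The substitution \<open>x = - d/(V -
  P)\<close> moves the root 0 to infinity and leads to \<open>V'^2 = 4 \<Prod> (V - q_j)\<close>
  with \<open>q_j = P - d/r_j\<close>, provided that \<open>d = r_1 r_2 r_3 / 4\<close>. The
  condition \<open>q_1 + q_2 + q_3 = 0\<close>, under which \<open>V\<close> is
  \<open>\<wp>\<close> without additive constant, determines \<open>P\<close>. Finally \<open>4
  \<Prod> (P - q_j) = d^2\<close>, so \<open>P = \<wp>(a)\<close> and \<open>d = \<wp>'(a)\<close>
  for a suitable \<open>a\<close>.\<close>

lemma BB_quartic_distinct:
  fixes \<alpha> e1 e2 e3 e4 :: complex
  assumes \<alpha>: "\<alpha> \<noteq> 0" and e: "distinct [e1, e2, e3, e4]"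
  defines "P \<equiv> \<alpha> * ((e1 - e4) * (e2 - e4) + (e1 - e4) * (e3 - e4) + (e2 - e4) * (e3 - e4)) / 12"
    and "A \<equiv> csqrt \<alpha> * e4"
  shows "\<exists>\<Lambda> a. is_period_lattice \<Lambda> \<and> a \<notin> \<Lambda> \<and> weierstrass_p \<Lambda> a = P \<and>
     general_solution (first_order_ode (binomial_poly \<alpha> [e1, e2, e3, e4]))
       (given_by (\<lambda>z u. u = inverse (csqrt \<alpha>) *
                    (weierstrass_zeta \<Lambda> (z + a) - weierstrass_zeta \<Lambda> (z - a)
                     - 2 * weierstrass_zeta \<Lambda> a + A) \<and>
                (z \<notin> \<Lambda> \<longrightarrow>
                 u = inverse (csqrt \<alpha>) *
                     (A - deriv (weierstrass_p \<Lambda>) a / (weierstrass_p \<Lambda> z - weierstrass_p \<Lambda> a)))))"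
proof -
  define s where "s = csqrt \<alpha>"
  have s: "s \<noteq> 0" "s^2 = \<alpha>" using \<alpha> by (simp_all add: s_def)
  define r1 where "r1 = s * (e1 - e4)"
  define r2 where "r2 = s * (e2 - e4)"
  define r3 where "r3 = s * (e3 - e4)"
  have r: "r1 \<noteq> 0" "r2 \<noteq> 0" "r3 \<noteq> 0" "r1 \<noteq> r2" "r1 \<noteq> r3" "r2 \<noteq> r3"
    using s e by (auto simp: r1_def r2_def r3_def)
  have P: "P = (r1 * r2 + r1 * r3 + r2 * r3) / 12"
    unfolding P_def s(2)[symmetric] r1_def r2_def r3_def by (simp add: algebra_simps power2_eq_square)
  define d where "d = r1 * r2 * r3 / 4"
  have d: "d \<noteq> 0" using r by (simp add: d_def)
  define q1 where "q1 = P - r2 * r3 / 4"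
  define q2 where "q2 = P - r1 * r3 / 4"
  define q3 where "q3 = P - r1 * r2 / 4"
  have "distinct [q1, q2, q3]" using r by (auto simp: q1_def q2_def q3_def)
  then obtain \<Lambda> V where lat: "is_period_lattice \<Lambda>"
    and V: "V \<in> nonconst_meromorphic_solutions (first_order_ode (cubic q1 q2 q3))"
    and poles: "\<And>z. is_pole V z \<longleftrightarrow> z \<in> \<Lambda>" and per: "\<And>\<omega> z. \<omega> \<in> \<Lambda> \<Longrightarrow> V (z + \<omega>) = V z" and even: "\<And>z. V (- z) = V z"
    and Vp: "\<And>z. z \<notin> \<Lambda> \<Longrightarrow> V z = (q1 + q2 + q3) / 3 + weierstrass_p \<Lambda> z"
    by (rule elliptic_uniformization) (rule that; assumption)
  interpret complex_lattice \<Lambda> by unfold_locales (rule lat)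
  have q0: "q1 + q2 + q3 = 0" by (simp add: q1_def q2_def q3_def P field_simps)
  have Vp': "V z = weierstrass_p \<Lambda> z" if "z \<notin> \<Lambda>" for z using Vp[OF that] q0 by simp
  have Vode: "\<And>z. z \<notin> \<Lambda> \<Longrightarrow> deriv V z ^ 2 = poly (cubic q1 q2 q3) (V z)"
    using V poles by (auto simp: nonconst_meromorphic_solutions_def meromorphic_solution_def satisfies_first_order)
  have Vn: "V nicely_meromorphic_on UNIV"
    using V by (simp add: nonconst_meromorphic_solutions_def meromorphic_solution_def)
  \<comment> \<open>A point with \<open>\<wp>(a_0) = P\<close> exists; its derivative there is \<open>d\<close> or
    \<open>- d\<close>, and replacing \<open>a_0\<close> by \<open>- a_0\<close> changes the sign.\<close>
  obtain a0 where a0: "a0 \<notin> \<Lambda>" "V a0 = P"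
    using cubic_solution_surjective[OF V \<open>distinct [q1, q2, q3]\<close>, of P] poles by blast
  have "poly (cubic q1 q2 q3) P = d^2"
    by (simp add: poly_cubic q1_def q2_def q3_def d_def field_simps power2_eq_square)
  hence "deriv V a0 ^ 2 = d^2" using Vode[OF a0(1)] a0(2) by simp
  hence pm: "deriv V a0 = d \<or> deriv V a0 = - d" by (simp add: power2_eq_iff)
  have "deriv V (- a0) = - deriv V a0"
  proof -
    have "V analytic_on {- a0}" using nicely_meromorphic_on_imp_analytic_at[OF Vn] poles a0(1) by simp
    hence "deriv (\<lambda>z. V ((-1) * z + 0)) a0 = (-1) * deriv V ((-1) * a0 + 0)"
      by (intro deriv_compose_linear' analytic_on_imp_differentiable_at) auto
    thus ?thesis using even by simp
  qed
  then obtain a where a: "a \<notin> \<Lambda>" "V a = P" "deriv V a = d"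
    using pm a0 even[of a0] by (cases "deriv V a0 = d") (auto intro: that[of a0] that[of "- a0"])
  interpret E: elliptic_function \<Lambda> V q1 q2 q3 a P d
    by unfold_locales (use V poles per even Vp' a d in auto)
  define f where "f = (\<lambda>z. inverse s * (E.G z + A))"
  have fm: "f meromorphic_on UNIV" unfolding f_def by (intro meromorphic_intros E.G_meromorphic)
  have Gpole: "is_pole f z \<longleftrightarrow> is_pole E.G z" for z
    unfolding f_def using is_pole_cmult_iff[of "inverse s" "\<lambda>z. E.G z + A" z] is_pole_plus_const_iff[of E.G z A] s
    by simp
  have fp: "is_pole f a" using Gpole E.G_X_at_plus(1)[of a] zero_in_lattice by simp
  have fval: "z + a \<notin> \<Lambda> \<and> z - a \<notin> \<Lambda> \<and> remove_sings f z = f z" if "\<not> is_pole f z" for z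
  proof -
    have "z + a \<notin> \<Lambda>" "z - a \<notin> \<Lambda>" using that Gpole E.G_X_at_plus(1) E.G_X_at_minus(1) by blast+
    moreover from this have "f analytic_on {z}" unfolding f_def by (intro analytic_intros E.G_analytic)
    ultimately show ?thesis by (simp add: remove_sings_at_analytic)
  qed
  have "eventually (\<lambda>z. deriv f z ^ 2 = poly (binomial_poly \<alpha> [e1, e2, e3, e4]) (f z)) (at 0)"
    using E.eventually_regular
  proof eventually_elim
    case (elim z)
    have nl: "z \<notin> \<Lambda>" "z + a \<notin> \<Lambda>" "z - a \<notin> \<Lambda>" using elim by (auto simp: E.regular_def)
    have ne: "V z - P \<noteq> 0" using E.fibre[of z] nl by auto
    define x where "x = E.X z"
    have x: "x \<noteq> 0" "V z = P - d / x" using d ne by (simp_all add: x_def E.X_def field_simps)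
    have fX: "eventually (\<lambda>w. f w = inverse s * (E.X w + A)) (nhds z)"
    proof -
      have "eventually (\<lambda>w. w \<in> {z. E.regular z}) (nhds z)"
        using E.open_regular elim by (intro eventually_nhds_in_open) auto
      thus ?thesis by eventually_elim (simp add: f_def E.addition_identity)
    qed
    have fz: "f z = inverse s * (x + A)" using eventually_nhds_x_imp_x[OF fX] by (simp add: x_def)
    have "(V has_field_derivative deriv V z) (at z)"
      using E.analytic[OF nl(1)] analytic_on_imp_differentiable_at DERIV_deriv_iff_field_differentiable by blast
    hence "((\<lambda>w. inverse s * (- d / (V w - P) + A)) has_field_derivative inverse s * (d * deriv V z / (V z - P)^2)) (at z)"
      using ne by (auto intro!: derivative_eq_intros simp: power2_eq_square)
    hence "deriv (\<lambda>w. inverse s * (E.X w + A)) z = inverse s * (d * deriv V z / (V z - P)^2)"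
      unfolding E.X_def by (rule DERIV_imp_deriv)
    hence "deriv f z = inverse s * (d * deriv V z / (V z - P)^2)" using deriv_cong_ev[OF fX refl] by simp
    hence "deriv f z ^ 2 = inverse s ^ 2 * (d^2 * deriv V z ^ 2 / ((V z - P)^2)^2)"
      by (simp add: power_mult_distrib power_divide)
    also have "(V z - P)^2 = d^2 / x^2" unfolding x(2) by (simp add: power_divide)
    also have "deriv V z ^ 2 = d^2 * ((x - r1) * (x - r2) * (x - r3)) / x^3"
    proof -
      have v: "V z - q1 = r2 * r3 / (4 * x) * (x - r1)" "V z - q2 = r1 * r3 / (4 * x) * (x - r2)" "V z - q3 = r1 * r2 / (4 * x) * (x - r3)"
        unfolding x(2) q1_def q2_def q3_def d_def using x(1) by (simp_all add: field_simps)
      show ?thesis unfolding Vode[OF nl(1)] poly_cubic v d_def using x(1) by (simp add: field_simps eval_nat_numeral)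
    qed
    also have "d^2 * (d^2 * Z / x^3) / (d^2 / x^2)^2 = x * Z" for Z
      using d x(1) by (simp add: field_simps eval_nat_numeral)
    also have "inverse s ^ 2 * (x * ((x - r1) * (x - r2) * (x - r3))) = inverse s ^ 2 * (x * (x - r1) * (x - r2) * (x - r3))"
      by (simp only: mult.assoc)
    also have "\<dots> = poly (binomial_poly \<alpha> [e1, e2, e3, e4]) (f z)"
    proof -
      have v: "f z - e1 = inverse s * (x - r1)" "f z - e2 = inverse s * (x - r2)" "f z - e3 = inverse s * (x - r3)"
        "f z - e4 = inverse s * x"
        unfolding fz r1_def r2_def r3_def A_def s_def[symmetric] using s(1) by (simp_all add: field_simps)
      have "poly (binomial_poly \<alpha> [e1, e2, e3, e4]) (f z) = s^2 * ((f z - e1) * ((f z - e2) * ((f z - e3) * (f z - e4))))"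
        by (simp add: poly_binomial_poly s(2))
      also have "\<dots> = (s * inverse s)^2 * (inverse s ^ 2 * (x * (x - r1) * (x - r2) * (x - r3)))"
        unfolding v by (simp add: power2_eq_square mult_ac)
      also have "s * inverse s = 1" using s(1) by simp
      finally show ?thesis by simp
    qed
    finally show "deriv f z ^ 2 = poly (binomial_poly \<alpha> [e1, e2, e3, e4]) (f z)" .
  qed
  note sol = formula_solution[OF fm fp this]
  define R where "R = (\<lambda>z u. u = inverse (csqrt \<alpha>) *
                    (weierstrass_zeta \<Lambda> (z + a) - weierstrass_zeta \<Lambda> (z - a)
                     - 2 * weierstrass_zeta \<Lambda> a + A) \<and>
                (z \<notin> \<Lambda> \<longrightarrow>
                 u = inverse (csqrt \<alpha>) *
                     (A - deriv (weierstrass_p \<Lambda>) a / (weierstrass_p \<Lambda> z - weierstrass_p \<Lambda> a))))"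
  have Rf: "R z u \<longleftrightarrow> u = f z \<and> (z \<notin> \<Lambda> \<longrightarrow> u = inverse s * (A + E.X z))" for z u
    unfolding R_def f_def E.G_def E.X_def s_def using E.deriv_p[OF a(1)] Vp'[of z] Vp'[OF a(1)] a(2,3)
    by (auto simp: algebra_simps)
  have "given_by R = range (\<lambda>c z. remove_sings f (z + c))"
  proof (rule given_by_formula[OF fm])
    fix z assume np: "\<not> is_pole f z"
    note fv = fval[OF np]
    have "f z = inverse s * (A + E.X z)" if "z \<notin> \<Lambda>"
      using E.addition_identity[of z] that fv by (simp add: f_def E.regular_def add.commute)
    thus "R z (remove_sings f z)" using fv by (simp add: Rf)
  qed (simp add: Rf)
  moreover have "remove_sings f (- z) = remove_sings f z" for z
    using remove_sings_affine_eq[OF fm fm, of "-1" 0 z] by (simp add: f_def E.G_even)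
  ultimately have "general_solution (first_order_ode (binomial_poly \<alpha> [e1, e2, e3, e4])) (given_by R)"
    using general_solution_translates_even[OF sol] by blast
  moreover have "weierstrass_p \<Lambda> a = P" using a(2) Vp'[OF a(1)] by simp
  ultimately show ?thesis
    using lat a(1) unfolding R_def by (intro exI[of _ \<Lambda>] exI[of _ a] conjI)
qed

section \<open>The list and the characterization of the solutions\<close>

lemma BB_list_cubic:
  assumes \<alpha>: "\<alpha> \<noteq> 0"
  shows "BB_list \<alpha> [e1, e2, e3]"
  unfolding BB_list.simps binomial_BB_eq
proof (intro conjI impI)
  assume "distinct [e1, e2, e3]"
  thus "\<exists>\<Lambda>. is_period_lattice \<Lambda> \<and> general_solution (first_order_ode (binomial_poly \<alpha> [e1, e2, e3]))
             (given_by (\<lambda>z u. u = (e1 + e2 + e3) / 3 + 4 / \<alpha> * weierstrass_p \<Lambda> z))"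
    by (rule BB_cubic_distinct[OF \<alpha>])
next
  assume e: "e1 = e2 \<and> e2 \<noteq> e3"
  have F: "\<alpha> \<in> generated_field {\<alpha>, e1, e2, e3}" "e1 \<in> generated_field {\<alpha>, e1, e2, e3}" "e3 \<in> generated_field {\<alpha>, e1, e2, e3}"
    by (auto intro: generated_field.gen)
  have "algebraic_in {\<alpha>, e1, e2, e3} (csqrt (\<alpha> * (e1 - e3)) / 2)"
    by (rule algebraic_if_square_in_field, unfold power_divide power2_csqrt) (intro field_intros F)
  moreover have "algebraic_in {\<alpha>, e1, e2, e3} e3" "algebraic_in {\<alpha>, e1, e2, e3} (e1 - e3)"
    by (auto intro!: algebraic_if_in_field field_intros F)
  moreover have "general_solution (first_order_ode (binomial_poly \<alpha> [e1, e2, e3]))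
     (given_by (\<lambda>z u. u = e3 + (e1 - e3) * (cosh (csqrt (\<alpha> * (e1 - e3)) / 2 * z) / sinh (csqrt (\<alpha> * (e1 - e3)) / 2 * z))^2))"
    using BB_cubic_double[OF \<alpha>, of e1 e3] e by simp
  ultimately show "\<exists>A B D. (\<forall>c\<in>{A, B, D}. algebraic_in {\<alpha>, e1, e2, e3} c) \<and>
          general_solution (first_order_ode (binomial_poly \<alpha> [e1, e2, e3]))
             (given_by (\<lambda>z u. u = A + B * (cosh (D * z) / sinh (D * z))\<^sup>2))"
    by (intro exI[of _ e3] exI[of _ "e1 - e3"] exI[of _ "csqrt (\<alpha> * (e1 - e3)) / 2"]) simp
next
  assume "e1 = e2 \<and> e2 = e3"
  thus "general_solution (first_order_ode (binomial_poly \<alpha> [e1, e2, e3])) (given_by (\<lambda>z u. u = e1 + 4 / (\<alpha> * z\<^sup>2)))"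
    using BB_cubic_triple[OF \<alpha>, of e1] by simp
qed

text \<open>Apart from the square roots \<open>csqrt \<alpha>\<close> and \<open>csqrt (\<alpha> (e_1 - e_3)
  (e_1 - e_4))\<close> the constants are rational in the parameters.\<close>

lemma BB_list_quartic:
  assumes \<alpha>: "\<alpha> \<noteq> 0"
  shows "BB_list \<alpha> [e1, e2, e3, e4]"
proof -
  let ?X = "{\<alpha>, e1, e2, e3, e4}"
  have F: "\<alpha> \<in> generated_field ?X" "e1 \<in> generated_field ?X" "e2 \<in> generated_field ?X"
    "e3 \<in> generated_field ?X" "e4 \<in> generated_field ?X"
    by (auto intro: generated_field.gen)
  show ?thesis
    unfolding BB_list.simps binomial_BB_eq
  proof (intro conjI impI, goal_cases)
    case 1
    define P where "P = \<alpha> * ((e1 - e4) * (e2 - e4) + (e1 - e4) * (e3 - e4) + (e2 - e4) * (e3 - e4)) / 12"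
    have "algebraic_in ?X P" unfolding P_def by (intro algebraic_if_in_field field_intros F)
    moreover have "algebraic_in ?X (csqrt \<alpha> * e4)"
      by (rule algebraic_if_square_in_field, unfold power_mult_distrib power2_csqrt) (intro field_intros F)
    ultimately show ?case using BB_quartic_distinct[OF \<alpha> 1, folded P_def]
      by - (elim exE conjE, rule exI, rule exI, rule exI[of _ "csqrt \<alpha> * e4"],
        (intro conjI; (assumption | simp)))
  next
    case 2
    define \<rho>3 where "\<rho>3 = - 1 / (e1 - e3)"
    define \<rho>4 where "\<rho>4 = - 1 / (e1 - e4)"
    have "algebraic_in ?X ((\<rho>3 - \<rho>4) / 2)" "algebraic_in ?X ((\<rho>3 + \<rho>4) / 2)"
      unfolding \<rho>3_def \<rho>4_def by (intro algebraic_if_in_field field_intros F)+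
    moreover have "algebraic_in ?X (csqrt (\<alpha> * (e1 - e3) * (e1 - e4)))"
      by (rule algebraic_if_square_in_field, unfold power2_csqrt) (intro field_intros F)
    moreover have "general_solution (first_order_ode (binomial_poly \<alpha> [e1, e2, e3, e4]))
        (given_by (\<lambda>z u. 1 / (u - e1) = (\<rho>3 - \<rho>4) / 2 * cosh (csqrt (\<alpha> * (e1 - e3) * (e1 - e4)) * z) + (\<rho>3 + \<rho>4) / 2))"
      using BB_quartic_double[OF \<alpha>, of e1 e3 e4] 2 unfolding \<rho>3_def \<rho>4_def by auto
    ultimately show ?case
      by (intro exI[of _ "(\<rho>3 - \<rho>4) / 2"] exI[of _ "csqrt (\<alpha> * (e1 - e3) * (e1 - e4))"] exI[of _ "(\<rho>3 + \<rho>4) / 2"]) simp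
  next
    case 3
    have "algebraic_in ?X ((e1 - e2) / 2)" by (intro algebraic_if_in_field field_intros F)
    moreover have "algebraic_in ?X ((e1 - e2) / 2 * csqrt \<alpha>)"
      by (rule algebraic_if_square_in_field, unfold power_mult_distrib power2_csqrt) (intro field_intros F)
    moreover have "general_solution (first_order_ode (binomial_poly \<alpha> [e1, e2, e3, e4]))
       (\<Union>\<sigma>\<in>{1,-1}. given_by (\<lambda>z u. u = (e1 + e2) / 2 + \<sigma> * ((e1 - e2) / 2) *
          (cosh ((e1 - e2) / 2 * csqrt \<alpha> * z) / sinh ((e1 - e2) / 2 * csqrt \<alpha> * z))))"
    proof -
      have e: "e1 \<noteq> e2" "e3 = e1" "e4 = e2" using 3 by auto
      show ?thesis unfolding e(2,3) by (rule BB_quartic_two_double[OF \<alpha> e(1)])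
    qed
    ultimately show ?case
      by (intro exI[of _ "(e1 - e2) / 2"] exI[of _ "(e1 - e2) / 2 * csqrt \<alpha>"]) simp
  next
    case 4
    have "algebraic_in ?X \<alpha>" by (intro algebraic_if_in_field F)
    thus ?case using BB_quartic_triple[OF \<alpha>, of e1 e4] 4 by (intro exI[of _ \<alpha>]) simp
  next
    case 5
    thus ?case using BB_quartic_quadruple[OF \<alpha>, of e1] by simp
  qed
qed

lemma binomial_poly_nonzero_degree: "\<alpha> \<noteq> 0 \<Longrightarrow> degree (binomial_poly \<alpha> es) = length es"
proof -
  assume "\<alpha> \<noteq> 0"
  have "degree (\<Prod>e\<leftarrow>es. [:-e, 1:]) = length es \<and> (\<Prod>e\<leftarrow>es. [:-e, 1:]) \<noteq> 0"
    by (induction es) (auto simp: degree_mult_eq simp del: mult_pCons_left)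
  thus ?thesis using \<open>\<alpha> \<noteq> 0\<close> by (simp add: binomial_poly_def)
qed

text \<open>The list is claimed for every way of writing the first integral as a binomial equation.
  Comparing right-hand sides as polynomials shows that the number of roots is always the degree.\<close>

lemma first_order_ode_inject:
  assumes "first_order_ode p = first_order_ode q" shows "p = q"
proof -
  have "poly p u = poly q u" for u
    using fun_cong[OF fun_cong[OF fun_cong[OF assms, of u], of 0], of 0] by (simp add: first_order_ode_def)
  hence "poly p = poly q" by (rule ext)
  thus ?thesis by (simp add: poly_eq_poly_eq_iff)
qed

lemma complex_poly_factorization:
  fixes p :: "complex poly"
  assumes "p \<noteq> 0"
  shows "\<exists>es. length es = degree p \<and> p = binomial_poly (lead_coeff p) es"
proof -
  obtain A where A: "size A = degree p" "p = smult (lead_coeff p) (\<Prod>x\<in>#A. [:- x, 1:])"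
    using alg_closed_imp_factorization[OF assms] by blast
  obtain es where "A = mset es" by (metis ex_mset)
  moreover have "(\<Prod>x\<in>#mset es. [:- x, 1:]) = (\<Prod>e\<leftarrow>es. [:-e, 1:])"
    by (simp add: prod_mset_prod_list flip: mset_map)
  ultimately show ?thesis using A unfolding binomial_poly_def by (metis size_mset)
qed

lemma degree_first_integral_poly:
  assumes "degree P = k" "k = 3 \<or> k = 4"
  shows "degree (first_integral_poly P C) = k"
proof -
  have "P \<noteq> 0" using assms by auto
  hence "lead_coeff P \<noteq> 0" by simp
  hence "k = 4 \<Longrightarrow> coeff P 4 \<noteq> 0" "k = 3 \<Longrightarrow> coeff P 3 \<noteq> 0 \<and> coeff P 4 = 0"
    using assms(1) by (simp_all add: coeff_eq_0)
  thus ?thesis using assms(2) by (auto simp: first_integral_poly_def)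
qed

theorem theorem3p1:
  fixes P :: "complex poly" and k :: nat
  assumes "P \<noteq> 0" and "degree P = k"
    and "nonconst_meromorphic_solutions (eq_E P) \<noteq> {}"
  shows "k \<le> 4 \<and>
    (k = 0 \<or> k = 1 \<longrightarrow>
       (\<exists>\<alpha>2 \<alpha>1 \<alpha>0 \<beta>. \<not> (\<alpha>2 = 0 \<and> \<alpha>1 = 0 \<and> \<alpha>0 = 0 \<and> \<beta> = 0) \<and>
          eq_E P = eq_linear_rhs \<alpha>2 \<alpha>1 \<alpha>0 \<beta>)) \<and>
    (k = 2 \<longrightarrow>
       poly.coeff P 0 = 0 \<and> poly.coeff P 1 = 0 \<and>
       nonconst_meromorphic_solutions (eq_E P) =
         {w. \<exists>c1 c2. c1 \<noteq> 0 \<and> w = (\<lambda>z. c1 * exp (- (poly.coeff P 2 / 2) * z^2 + c2 * z))} \<and>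
       general_solution (eq_E P) (nonconst_meromorphic_solutions (eq_E P)) \<and>
       (\<forall>w \<in> nonconst_meromorphic_solutions (eq_E P).
          w holomorphic_on UNIV \<and> (\<forall>z. w z \<noteq> 0))) \<and>
    (k = 3 \<or> k = 4 \<longrightarrow>
       poly.coeff P 2 = 0 \<and>
       (\<forall>w. meromorphic_solution (eq_E P) w \<longrightarrow>
          (\<exists>C. meromorphic_solution (first_integral P C) w)) \<and>
       (\<forall>C. nonconst_meromorphic_solutions (first_integral P C)
              \<subseteq> nonconst_meromorphic_solutions (eq_E P)) \<and>
       (\<forall>C. (\<exists>\<alpha> es. \<alpha> \<noteq> 0 \<and> length es = k \<and> first_integral P C = binomial_BB \<alpha> es) \<and>
            (\<forall>\<alpha> es. first_integral P C = binomial_BB \<alpha> es \<longrightarrow> BB_list \<alpha> es)))"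
proof -
  obtain w where w: "w \<in> nonconst_meromorphic_solutions (eq_E P)" using assms(3) by blast
  hence ws: "meromorphic_solution (eq_E P) w" by (simp add: nonconst_meromorphic_solutions_def)
  have le4: "k \<le> 4"
  proof (cases "k \<ge> 3")
    case True
    then obtain z where "is_pole w z" using eq_E_has_pole[OF w] assms(2) by blast
    thus ?thesis using eq_E_pole_degree[OF ws] assms(2) by blast
  qed simp
  moreover have "\<exists>\<alpha>2 \<alpha>1 \<alpha>0 \<beta>. \<not> (\<alpha>2 = 0 \<and> \<alpha>1 = 0 \<and> \<alpha>0 = 0 \<and> \<beta> = 0) \<and>
          eq_E P = eq_linear_rhs \<alpha>2 \<alpha>1 \<alpha>0 \<beta>" if k: "k = 0 \<or> k = 1"
  proof -
    have c: "coeff P 2 = 0" "coeff P 3 = 0" "coeff P 4 = 0" using k assms(2) by (auto simp: coeff_eq_0)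
    have Pp: "poly P x = coeff P 0 + coeff P 1 * x" for x
      using poly_degree_le_4[of P x] le4 assms(2) c by simp
    have "coeff P 0 \<noteq> 0 \<or> coeff P 1 \<noteq> 0"
      using k assms(1,2) leading_coeff_0_iff[of P] by (auto simp del: leading_coeff_0_iff)
    moreover have "eq_E P = eq_linear_rhs 0 0 (- coeff P 1) (- coeff P 0)"
      by (simp add: eq_E_def eq_linear_rhs_def Pp fun_eq_iff algebra_simps)
    ultimately show ?thesis by (metis neg_equal_0_iff_equal)
  qed
  moreover have "poly.coeff P 0 = 0 \<and> poly.coeff P 1 = 0 \<and>
       nonconst_meromorphic_solutions (eq_E P) =
         {w. \<exists>c1 c2. c1 \<noteq> 0 \<and> w = (\<lambda>z. c1 * exp (- (poly.coeff P 2 / 2) * z^2 + c2 * z))} \<and>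
       general_solution (eq_E P) (nonconst_meromorphic_solutions (eq_E P)) \<and>
       (\<forall>w \<in> nonconst_meromorphic_solutions (eq_E P).
          w holomorphic_on UNIV \<and> (\<forall>z. w z \<noteq> 0))" if k: "k = 2"
  proof -
    have P2: "degree P = 2" using k assms(2) by simp
    note q = eq_E_quadratic[OF P2 assms(3)]
    have "\<forall>w \<in> nonconst_meromorphic_solutions (eq_E P). w holomorphic_on UNIV \<and> (\<forall>z. w z \<noteq> 0)"
      unfolding q(3) by (auto intro!: holomorphic_intros)
    thus ?thesis using q by blast
  qed
  moreover have "poly.coeff P 2 = 0 \<and>
       (\<forall>w. meromorphic_solution (eq_E P) w \<longrightarrow>
          (\<exists>C. meromorphic_solution (first_integral P C) w)) \<and>
       (\<forall>C. nonconst_meromorphic_solutions (first_integral P C)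
              \<subseteq> nonconst_meromorphic_solutions (eq_E P)) \<and>
       (\<forall>C. (\<exists>\<alpha> es. \<alpha> \<noteq> 0 \<and> length es = k \<and> first_integral P C = binomial_BB \<alpha> es) \<and>
            (\<forall>\<alpha> es. first_integral P C = binomial_BB \<alpha> es \<longrightarrow> BB_list \<alpha> es))" if k: "k = 3 \<or> k = 4"
  proof -
    have P4: "degree P \<le> 4" using le4 assms(2) by simp
    obtain z where "is_pole w z" using eq_E_has_pole[OF w] assms(2) k by auto
    hence c2: "coeff P 2 = 0" using eq_E_quadratic_coefficient[OF w P4] by blast
    have "(\<exists>\<alpha> es. \<alpha> \<noteq> 0 \<and> length es = k \<and> first_integral P C = binomial_BB \<alpha> es) \<and>
            (\<forall>\<alpha> es. first_integral P C = binomial_BB \<alpha> es \<longrightarrow> BB_list \<alpha> es)" for C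
    proof (intro conjI allI impI)
      let ?F = "first_integral_poly P C"
      have dF: "degree ?F = k" by (rule degree_first_integral_poly[OF assms(2) k])
      hence F0: "?F \<noteq> 0" using k by auto
      obtain es where "length es = degree ?F" "?F = binomial_poly (lead_coeff ?F) es"
        using complex_poly_factorization[OF F0] by blast
      thus "\<exists>\<alpha> es. \<alpha> \<noteq> 0 \<and> length es = k \<and> first_integral P C = binomial_BB \<alpha> es"
        using F0 dF unfolding first_integral_eq binomial_BB_eq by (metis leading_coeff_0_iff)
      fix \<alpha> es assume "first_integral P C = binomial_BB \<alpha> es"
      hence F: "?F = binomial_poly \<alpha> es"
        unfolding first_integral_eq binomial_BB_eq by (rule first_order_ode_inject)
      hence \<alpha>: "\<alpha> \<noteq> 0" using F0 by (auto simp: binomial_poly_def)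
      hence "length es = k" using binomial_poly_nonzero_degree[OF \<alpha>, of es] F dF by simp
      hence "(\<exists>e1 e2 e3. es = [e1, e2, e3]) \<or> (\<exists>e1 e2 e3 e4. es = [e1, e2, e3, e4])"
        using k by (auto simp: length_Suc_conv eval_nat_numeral)
      thus "BB_list \<alpha> es" using BB_list_cubic[OF \<alpha>] BB_list_quartic[OF \<alpha>] by blast
    qed
    thus ?thesis using c2 eq_E_imp_first_integral[OF _ P4 c2] first_integral_imp_eq_E[OF P4 c2] by blast
  qed
  ultimately show ?thesis by blast
qed

end
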